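(* Let $X$ be an infinite-dimensional real Banach space and let $p\in\{1,2,\dots\}\cup\{\infty\}$. If $X$ admits a $C^p$ smooth bump function, then there exists a $C^p$ smooth bump function $f:X\to[0,1]$ such that $f'(x)\neq 0$ for every $x\in\operatorname{int}(\operatorname{supp} f)$. Moreover, if $X$ admits a $C^p$ smooth Lipschitz bump function, then $f$ can be chosen to be, in addition, Lipschitz.
   Context: A bump function on $X$ is a function $b:X\to\mathbb{R}$ which is not identically zero and has bounded support, where $\operatorname{supp} b=\overline{\{x\in X: b(x)\neq 0\}}$. "$C^p$ smooth" refers to Fréchet differentiability of order $p$ with continuous $p$-th derivative; $f'(x)\in X^*$ denotes the Fréchet derivative. *)

theory Defs
  imports "HOL-Analysis.Analysis" "HOL-Library.Extended_Nat"
begin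

text \<open>Bounded k-linear forms on a real normed space, represented as functions of a
  sequence of arguments h :: nat \<Rightarrow> 'a of which only h 0, ..., h (k-1) matter.\<close>

definition mlin :: "nat \<Rightarrow> ((nat \<Rightarrow> 'a::real_normed_vector) \<Rightarrow> real) \<Rightarrow> bool" where
  "mlin k A \<longleftrightarrow>
     (\<forall>h h'. (\<forall>i<k. h i = h' i) \<longrightarrow> A h = A h') \<and>
     (\<forall>h i. i < k \<longrightarrow> linear (\<lambda>v. A (h(i := v)))) \<and>
     (\<exists>C. \<forall>h. \<bar>A h\<bar> \<le> C * (\<Prod>i<k. norm (h i)))"

definition mcons :: "'a \<Rightarrow> (nat \<Rightarrow> 'a) \<Rightarrow> nat \<Rightarrow> 'a" where
  "mcons v h = (\<lambda>i. case i of 0 \<Rightarrow> v | Suc j \<Rightarrow> h j)"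

text \<open>D (a bounded (k+1)-linear form) is the Frechet derivative at x of the map F from
  X into the space of k-linear forms, the latter carrying the operator norm
  (sup over arguments in the closed unit ball).\<close>

definition has_mderiv ::
  "nat \<Rightarrow> ('a::real_normed_vector \<Rightarrow> (nat \<Rightarrow> 'a) \<Rightarrow> real) \<Rightarrow> ((nat \<Rightarrow> 'a) \<Rightarrow> real) \<Rightarrow> 'a \<Rightarrow> bool" where
  "has_mderiv k F D x \<longleftrightarrow> mlin (Suc k) D \<and>
     (\<forall>e>0. \<exists>d>0. \<forall>y. norm (y - x) < d \<longrightarrow>
        (\<forall>h. (\<forall>i<k. norm (h i) \<le> 1) \<longrightarrow>
           \<bar>F y h - F x h - D (mcons (y - x) h)\<bar> \<le> e * norm (y - x)))"

definition mcont :: "nat \<Rightarrow> ('a::real_normed_vector \<Rightarrow> (nat \<Rightarrow> 'a) \<Rightarrow> real) \<Rightarrow> 'a \<Rightarrow> bool" where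
  "mcont k F x \<longleftrightarrow>
     (\<forall>e>0. \<exists>d>0. \<forall>y. norm (y - x) < d \<longrightarrow>
        (\<forall>h. (\<forall>i<k. norm (h i) \<le> 1) \<longrightarrow> \<bar>F y h - F x h\<bar> \<le> e))"

definition Cn :: "nat \<Rightarrow> ('a::real_normed_vector \<Rightarrow> real) \<Rightarrow> bool" where
  "Cn n f \<longleftrightarrow> (\<exists>Ds :: nat \<Rightarrow> 'a \<Rightarrow> (nat \<Rightarrow> 'a) \<Rightarrow> real.
      (\<forall>x. Ds 0 x = (\<lambda>h. f x)) \<and>
      (\<forall>k<n. \<forall>x. has_mderiv k (Ds k) (Ds (Suc k) x) x) \<and>
      (\<forall>x. mcont n (Ds n) x))"

definition smooth :: "enat \<Rightarrow> ('a::real_normed_vector \<Rightarrow> real) \<Rightarrow> bool" where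
  "smooth p f \<longleftrightarrow> (\<forall>n::nat. enat n \<le> p \<longrightarrow> Cn n f)"

definition supp :: "('a::topological_space \<Rightarrow> real) \<Rightarrow> 'a set" where
  "supp b = closure {x. b x \<noteq> 0}"

definition bump :: "('a::metric_space \<Rightarrow> real) \<Rightarrow> bool" where
  "bump b \<longleftrightarrow> (\<exists>x. b x \<noteq> 0) \<and> bounded (supp b)"

definition infinite_dimensional :: "'a::real_vector itself \<Rightarrow> bool" where
  "infinite_dimensional _ \<longleftrightarrow> \<not> (\<exists>B::'a set. finite B \<and> span B = UNIV)"

end

theory Submission
  imports Defs
begin

text \<open>The function is locally \<open>\<eta> \<circ> W\<close>, where \<open>\<eta> t = exp (- 1 / t)\<close> for \<open>t > 0\<close> and \<open>0\<close> otherwise, and the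
  derivative of \<open>W\<close> does not vanish where \<open>W \<ge> 0\<close>. This excludes critical points in \<open>W > 0\<close>, and it also
  shows that a point with \<open>W = 0\<close> is a limit of open sets on which the function vanishes, so that it is not
  interior to the support.

  In infinite dimensions a tube of uniform width and infinite length, going back and forth through a
  hyperplane \<open>u = 0\<close>, fits into a bounded set as a locally finite union of U-turns; consecutive U-turns use the
  coordinates of a bounded, nearly biorthogonal system. One takes \<open>W = c - h\<close>, where the cross-section \<open>c\<close> is
  a copy of the given bump, constant along the flow lines of the tube, and the threshold \<open>h\<close>
  decreases strictly along the flow, so \<open>W\<close> increases along it. At the start of the tube \<open>h > 1 \<ge> c\<close>, and the tube
  has no end. Uniform width makes \<open>W\<close> Lipschitz when the given bump is.\<close>

section \<open>Differential calculus of multilinear-form-valued maps\<close>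

text \<open>No basis of the space is at hand. The coordinates come from unit vectors
  \<open>a j\<close> and functionals of norm at most 8 for which \<open>\<psi> n (a j)\<close> is
  known only when \<open>n \<le> j + 2\<close>, so every estimate in a cell has to be read off from
  such pairs. On a cross-section of radius 1/80 each functional is at most 1/10 in absolute value;
  cells of equal parity differ by at least 8/10 in some coordinate and hence are at least 1/10
  apart. Parity organises the gluing: even cells are used where \<open>u > -1/4\<close>, odd ones
  where \<open>u < 1/4\<close>. In the common slab a point of one cell also belongs to a neighbour
  of the other parity, with the same value of \<open>W\<close>. The straightening maps are
  compositions of three shears along fixed vectors. Smoothness of \<open>W\<close> therefore rests
  on products of forms, functions of one real variable and shears, and the chain rule is proved only
  for these.\<close>

definition msmall :: "nat \<Rightarrow> 'a::real_normed_vector \<Rightarrow> ('a \<Rightarrow> (nat \<Rightarrow> 'a) \<Rightarrow> real) \<Rightarrow> bool" where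
  "msmall k x R \<longleftrightarrow> (\<forall>e>0. \<forall>\<^sub>F y in nhds x. \<forall>h. (\<forall>i<k. norm (h i) \<le> 1) \<longrightarrow> \<bar>R y h\<bar> \<le> e * norm (y - x))"

lemma has_mderiv_iff:
  "has_mderiv k F D x \<longleftrightarrow> mlin (Suc k) D \<and> msmall k x (\<lambda>y h. F y h - F x h - D (mcons (y - x) h))"
  unfolding has_mderiv_def msmall_def eventually_nhds_metric dist_norm by simp

lemma mcont_iff:
  "mcont k F x \<longleftrightarrow> (\<forall>e>0. \<forall>\<^sub>F y in nhds x. \<forall>h. (\<forall>i<k. norm (h i) \<le> 1) \<longrightarrow> \<bar>F y h - F x h\<bar> \<le> e)"
  unfolding mcont_def eventually_nhds_metric dist_norm by simp

section \<open>Bounded multilinear forms: slots, insertion, products\<close>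

lemma mcons_simps [simp]: "mcons v h 0 = v" "mcons v h (Suc i) = h i"
  by (auto simp: mcons_def)

lemma mcons_upd0: "(mcons w h)(0 := v) = mcons v h"
  by (auto simp: mcons_def fun_eq_iff split: nat.split)

lemma mlin_cong: "mlin k A \<Longrightarrow> (\<And>i. i < k \<Longrightarrow> h i = h' i) \<Longrightarrow> A h = A h'"
  unfolding mlin_def by blast

lemma mlin_linear: "mlin k A \<Longrightarrow> i < k \<Longrightarrow> linear (\<lambda>v. A (h(i := v)))"
  unfolding mlin_def by blast

lemma mlin_bound:
  assumes "mlin k A"
  obtains C where "C \<ge> 0" "\<And>h. \<bar>A h\<bar> \<le> C * (\<Prod>i<k. norm (h i))"
proof -
  obtain C where C: "\<And>h. \<bar>A h\<bar> \<le> C * (\<Prod>i<k. norm (h i))"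
    using assms unfolding mlin_def by blast
  have "\<bar>A h\<bar> \<le> \<bar>C\<bar> * (\<Prod>i<k. norm (h i))" for h
    by (rule order_trans[OF C]) (intro mult_right_mono prod_nonneg, auto)
  then show thesis by (intro that[of "\<bar>C\<bar>"]) auto
qed

lemma mlin_bound1:
  assumes "mlin k A"
  obtains C where "C \<ge> 0" "\<And>h. (\<forall>i<k. norm (h i) \<le> 1) \<Longrightarrow> \<bar>A h\<bar> \<le> C"
proof -
  obtain C where C: "C \<ge> 0" "\<And>h. \<bar>A h\<bar> \<le> C * (\<Prod>i<k. norm (h i))"
    using mlin_bound[OF assms] by blast
  have "\<bar>A h\<bar> \<le> C" if "\<forall>i<k. norm (h i) \<le> 1" for h
  proof -
    have "(\<Prod>i<k. norm (h i)) \<le> 1" using that by (intro prod_le_1) auto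
    then show ?thesis using C(2)[of h] mult_left_mono[of _ 1 C] C(1) by fastforce
  qed
  then show thesis using C(1) that by blast
qed

lemma mlin_mcons_linear:
  assumes "mlin (Suc k) D" shows "linear (\<lambda>v. D (mcons v h))"
  using mlin_linear[OF assms, of 0 "mcons 0 h"] by (simp add: mcons_upd0)

lemma mlin_mcons_bound:
  assumes "mlin (Suc k) D"
  obtains C where "C \<ge> 0" "\<And>v h. (\<forall>i<k. norm (h i) \<le> 1) \<Longrightarrow> \<bar>D (mcons v h)\<bar> \<le> C * norm v"
proof -
  obtain C where C: "C \<ge> 0" "\<And>h. \<bar>D h\<bar> \<le> C * (\<Prod>i<Suc k. norm (h i))"
    using mlin_bound[OF assms] by blast
  have "\<bar>D (mcons v h)\<bar> \<le> C * norm v" if "\<forall>i<k. norm (h i) \<le> 1" for v h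
  proof -
    have "(\<Prod>i<Suc k. norm (mcons v h i)) = norm v * (\<Prod>i<k. norm (h i))"
      by (simp only: prod.lessThan_Suc_shift mcons_simps)
    also have "\<dots> \<le> norm v * 1" using that by (intro mult_left_mono prod_le_1) auto
    finally show ?thesis using C(2)[of "mcons v h"] mult_left_mono[OF _ C(1)] by fastforce
  qed
  then show thesis using C(1) that by blast
qed

text \<open>Insertion at an arbitrary slot is needed because differentiating in the base point puts
  a new argument in front: a vector fixed in slot \<open>p\<close> then sits in slot
  \<open>Suc p\<close>.\<close>

definition ins :: "nat \<Rightarrow> 'a \<Rightarrow> (nat \<Rightarrow> 'a) \<Rightarrow> nat \<Rightarrow> 'a" where
  "ins p a h = (\<lambda>i. if i < p then h i else if i = p then a else h (i - 1))"

definition skip :: "nat \<Rightarrow> nat \<Rightarrow> nat" where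
  "skip p i = (if i < p then i else Suc i)"

lemma ins_0: "ins 0 a h = mcons a h"
  by (auto simp: ins_def mcons_def fun_eq_iff split: nat.split)

lemma mcons_ins: "mcons v (ins p a h) = ins (Suc p) a (mcons v h)"
  by (auto simp: ins_def mcons_def fun_eq_iff split: nat.split)

lemma ins_skip [simp]: "ins p a h (skip p i) = h i" "ins p a h p = a"
  by (auto simp: ins_def skip_def)

lemma ins_upd: "ins p a (h(i := v)) = (ins p a h)(skip p i := v)"
  by (auto simp: ins_def skip_def fun_eq_iff)

lemma ins_eq_upd: "ins p v h = (ins p 0 h)(p := v)"
  by (auto simp: ins_def fun_eq_iff)

lemma lessThan_Suc_skip: "p \<le> k \<Longrightarrow> {..<Suc k} = insert p (skip p ` {..<k})"
proof (intro set_eqI iffI)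
  fix i assume p: "p \<le> k" and "i \<in> {..<Suc k}"
  then have i: "i \<le> k" by simp
  consider "i < p" | "i = p" | "i > p" by linarith
  then show "i \<in> insert p (skip p ` {..<k})"
  proof cases
    case 1 then show ?thesis using p by (auto simp: skip_def intro!: image_eqI[of _ _ i])
  next
    case 3 then show ?thesis using i by (auto simp: skip_def intro!: image_eqI[of _ _ "i - 1"])
  qed simp
qed (auto simp: skip_def)

lemma prod_norm_ins:
  assumes "p \<le> k"
  shows "(\<Prod>i<Suc k. norm (ins p a h i)) = norm a * (\<Prod>i<k. norm (h i))"
proof -
  have "p \<notin> skip p ` {..<k}" "inj_on (skip p) {..<k}" by (auto simp: skip_def inj_on_def split: if_splits)
  then show ?thesis unfolding lessThan_Suc_skip[OF assms] by (simp add: prod.reindex)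
qed

lemma mlin_ins_linear:
  assumes "mlin (Suc k) D" "p \<le> k" shows "linear (\<lambda>v. D (ins p v h))"
  using mlin_linear[OF assms(1), of p "ins p 0 h"] assms(2) by (simp add: ins_eq_upd[symmetric])

lemma mlin_ins:
  assumes D: "mlin (Suc k) D" and p: "p \<le> k" shows "mlin k (\<lambda>h. D (ins p a h))"
  unfolding mlin_def
proof (intro conjI allI impI)
  fix h h' :: "nat \<Rightarrow> 'a" assume "\<forall>i<k. h i = h' i"
  then show "D (ins p a h) = D (ins p a h')"
    using p by (intro mlin_cong[OF D]) (auto simp: ins_def)
next
  fix h :: "nat \<Rightarrow> 'a" and i assume "i < k"
  then show "linear (\<lambda>v. D (ins p a (h(i := v))))"
    unfolding ins_upd by (intro mlin_linear[OF D]) (auto simp: skip_def)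
next
  obtain C where C: "C \<ge> 0" "\<And>h. \<bar>D h\<bar> \<le> C * (\<Prod>i<Suc k. norm (h i))"
    using mlin_bound[OF D] by blast
  show "\<exists>C. \<forall>h. \<bar>D (ins p a h)\<bar> \<le> C * (\<Prod>i<k. norm (h i))"
  proof (intro exI allI)
    fix h show "\<bar>D (ins p a h)\<bar> \<le> (C * norm a) * (\<Prod>i<k. norm (h i))"
      using C(2)[of "ins p a h"] unfolding prod_norm_ins[OF p] by (simp add: mult.assoc)
  qed
qed

lemma mlin_contract: "mlin (Suc k) D \<Longrightarrow> mlin k (\<lambda>h. D (mcons a h))"
  using mlin_ins[of k D 0 a] by (simp add: ins_0)

lemma mlin_add:
  assumes "mlin k A" "mlin k B" shows "mlin k (\<lambda>h. A h + B h)"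
  unfolding mlin_def
proof (intro conjI allI impI)
  fix h h' :: "nat \<Rightarrow> 'a" assume "\<forall>i<k. h i = h' i"
  then show "A h + B h = A h' + B h'"
    using mlin_cong[OF assms(1), of h h'] mlin_cong[OF assms(2), of h h'] by simp
next
  fix h :: "nat \<Rightarrow> 'a" and i assume "i < k"
  then show "linear (\<lambda>v. A (h(i := v)) + B (h(i := v)))"
    by (intro linear_compose_add mlin_linear[OF assms(1)] mlin_linear[OF assms(2)])
next
  obtain C where C: "\<And>h. \<bar>A h\<bar> \<le> C * (\<Prod>i<k. norm (h i))"
    using mlin_bound[OF assms(1)] by blast
  obtain C' where C': "\<And>h. \<bar>B h\<bar> \<le> C' * (\<Prod>i<k. norm (h i))"
    using mlin_bound[OF assms(2)] by blast
  show "\<exists>C. \<forall>h. \<bar>A h + B h\<bar> \<le> C * (\<Prod>i<k. norm (h i))"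
  proof (intro exI allI)
    fix h show "\<bar>A h + B h\<bar> \<le> (C + C') * (\<Prod>i<k. norm (h i))"
      using C[of h] C'[of h] by (simp add: distrib_right)
  qed
qed

lemma mlin_scale:
  assumes "mlin k A" shows "mlin k (\<lambda>h. c * A h)"
  unfolding mlin_def
proof (intro conjI allI impI)
  fix h h' :: "nat \<Rightarrow> 'a" assume "\<forall>i<k. h i = h' i"
  then show "c * A h = c * A h'"
    using mlin_cong[OF assms(1), of h h'] by simp
next
  fix h :: "nat \<Rightarrow> 'a" and i assume "i < k"
  then show "linear (\<lambda>v. c * A (h(i := v)))"
    using linear_compose_scale_right[OF mlin_linear[OF assms], of i c h] by simp
next
  obtain C where C: "\<And>h. \<bar>A h\<bar> \<le> C * (\<Prod>i<k. norm (h i))"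
    using mlin_bound[OF assms(1)] by blast
  show "\<exists>C. \<forall>h. \<bar>c * A h\<bar> \<le> C * (\<Prod>i<k. norm (h i))"
  proof (intro exI allI)
    fix h show "\<bar>c * A h\<bar> \<le> (\<bar>c\<bar> * C) * (\<Prod>i<k. norm (h i))"
      using C[of h] by (simp add: abs_mult mult.assoc mult_left_mono)
  qed
qed

lemma mlin_0 [simp]: "mlin 0 (\<lambda>h. c)"
  unfolding mlin_def by auto

lemma mlin_const0 [simp]: "mlin k (\<lambda>h. 0)"
  unfolding mlin_def by (auto intro!: exI[of _ 0] linearI)

text \<open>The argument slots of a product \<open>A (h \<circ> \<sigma>) * B (h \<circ> \<tau>)\<close> are dealt out to the two factors. With arbitrary
  slot maps the derivative of such a product is again a sum of two such products.\<close>
definition splits :: "nat \<Rightarrow> nat \<Rightarrow> nat \<Rightarrow> (nat \<Rightarrow> nat) \<Rightarrow> (nat \<Rightarrow> nat) \<Rightarrow> bool" where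
  "splits j k m \<sigma> \<tau> \<longleftrightarrow> inj_on \<sigma> {..<j} \<and> inj_on \<tau> {..<k} \<and>
     \<sigma> ` {..<j} \<inter> \<tau> ` {..<k} = {} \<and> \<sigma> ` {..<j} \<union> \<tau> ` {..<k} = {..<m}"

lemma splits_less: "splits j k m \<sigma> \<tau> \<Longrightarrow> i < j \<Longrightarrow> \<sigma> i < m" "splits j k m \<sigma> \<tau> \<Longrightarrow> i < k \<Longrightarrow> \<tau> i < m"
  unfolding splits_def by blast+

lemma splits_sym: "splits j k m \<sigma> \<tau> \<Longrightarrow> splits k j m \<tau> \<sigma>"
  unfolding splits_def by blast

definition shiftx :: "(nat \<Rightarrow> nat) \<Rightarrow> nat \<Rightarrow> nat" where
  "shiftx \<sigma> i = (case i of 0 \<Rightarrow> 0 | Suc i' \<Rightarrow> Suc (\<sigma> i'))"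

lemma shiftx_simps [simp]: "shiftx \<sigma> 0 = 0" "shiftx \<sigma> (Suc i) = Suc (\<sigma> i)"
  by (auto simp: shiftx_def)

lemma shiftx_image: "shiftx \<sigma> ` {..<Suc j} = insert 0 (Suc ` \<sigma> ` {..<j})"
  by (simp add: lessThan_Suc_eq_insert_0 image_image)

lemma splits_shift:
  assumes "splits j k m \<sigma> \<tau>"
  shows "splits (Suc j) k (Suc m) (shiftx \<sigma>) (\<lambda>i. Suc (\<tau> i))"
proof -
  have i: "inj_on (shiftx \<sigma>) {..<Suc j}"
    using assms by (auto simp: splits_def inj_on_def shiftx_def split: nat.splits)
  have "(\<lambda>i. Suc (\<tau> i)) ` {..<k} = Suc ` \<tau> ` {..<k}" by auto
  then show ?thesis using assms i unfolding splits_def shiftx_image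
    by (auto simp: inj_on_def lessThan_Suc_eq_insert_0 image_Un[symmetric])
qed

lemma mcons_shiftx: "(\<lambda>i. mcons v h (shiftx \<sigma> i)) = mcons v (\<lambda>i. h (\<sigma> i))"
  by (auto simp: fun_eq_iff mcons_def shiftx_def split: nat.split)

text \<open>The images of \<open>\<sigma>\<close> and \<open>\<tau>\<close> are disjoint, so varying
  a slot of the first factor leaves the second constant. Slots of the second factor follow by
  exchanging the factors.\<close>

lemma mlin_tensor_linear:
  assumes "mlin j A" "mlin k B" "splits j k m \<sigma> \<tau>" "i \<in> \<sigma> ` {..<j}"
  shows "linear (\<lambda>v. A (\<lambda>l. (h(i := v)) (\<sigma> l)) * B (\<lambda>l. (h(i := v)) (\<tau> l)))"
proof -
  obtain l0 where l0: "l0 < j" "i = \<sigma> l0" using assms(4) by auto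
  have "A (\<lambda>l. (h(i := v)) (\<sigma> l)) = A ((\<lambda>l. h (\<sigma> l))(l0 := v))" for v
    using assms(3) l0 by (intro mlin_cong[OF assms(1)]) (auto simp: splits_def inj_on_def)
  moreover have "B (\<lambda>l. (h(i := v)) (\<tau> l)) = B (\<lambda>l. h (\<tau> l))" for v
    using assms(3) l0 by (intro mlin_cong[OF assms(2)]) (auto simp: splits_def)
  moreover have "linear (\<lambda>v. A ((\<lambda>l. h (\<sigma> l))(l0 := v)) * B (\<lambda>l. h (\<tau> l)))"
    using linear_compose_scale_right[OF mlin_linear[OF assms(1) l0(1)], of "B (\<lambda>l. h (\<tau> l))" "\<lambda>l. h (\<sigma> l)"]
    by (simp add: mult.commute)
  ultimately show ?thesis by simp
qed

lemma mlin_tensor: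
  assumes A: "mlin j A" and B: "mlin k B" and s: "splits j k m \<sigma> \<tau>"
  shows "mlin m (\<lambda>h. A (\<lambda>l. h (\<sigma> l)) * B (\<lambda>l. h (\<tau> l)))"
  unfolding mlin_def
proof (intro conjI allI impI)
  fix h h' :: "nat \<Rightarrow> 'a" assume h: "\<forall>i<m. h i = h' i"
  have "A (\<lambda>l. h (\<sigma> l)) = A (\<lambda>l. h' (\<sigma> l))" "B (\<lambda>l. h (\<tau> l)) = B (\<lambda>l. h' (\<tau> l))"
    using h splits_less[OF s] by (auto intro!: mlin_cong[OF A] mlin_cong[OF B])
  then show "A (\<lambda>l. h (\<sigma> l)) * B (\<lambda>l. h (\<tau> l)) = A (\<lambda>l. h' (\<sigma> l)) * B (\<lambda>l. h' (\<tau> l))" by simp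
next
  fix h :: "nat \<Rightarrow> 'a" and i assume "i < m"
  then have "i \<in> \<sigma> ` {..<j} \<or> i \<in> \<tau> ` {..<k}" using s by (auto simp: splits_def)
  then show "linear (\<lambda>v. A (\<lambda>l. (h(i := v)) (\<sigma> l)) * B (\<lambda>l. (h(i := v)) (\<tau> l)))"
    using mlin_tensor_linear[OF A B s] mlin_tensor_linear[OF B A splits_sym[OF s]]
    by (auto simp: mult.commute)
next
  obtain C where C: "C \<ge> 0" "\<And>h. \<bar>A h\<bar> \<le> C * (\<Prod>i<j. norm (h i))"
    using mlin_bound[OF A] by blast
  obtain C' where C': "C' \<ge> 0" "\<And>h. \<bar>B h\<bar> \<le> C' * (\<Prod>i<k. norm (h i))"
    using mlin_bound[OF B] by blast
  show "\<exists>C. \<forall>h. \<bar>A (\<lambda>l. h (\<sigma> l)) * B (\<lambda>l. h (\<tau> l))\<bar> \<le> C * (\<Prod>i<m. norm (h i))"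
  proof (intro exI allI)
    fix h :: "nat \<Rightarrow> 'a"
    have m: "{..<m} = \<sigma> ` {..<j} \<union> \<tau> ` {..<k}" using s by (simp add: splits_def)
    have "(\<Prod>i<m. norm (h i)) = (\<Prod>i\<in>\<sigma> ` {..<j}. norm (h i)) * (\<Prod>i\<in>\<tau> ` {..<k}. norm (h i))"
      unfolding m using s by (intro prod.union_disjoint) (auto simp: splits_def)
    also have "\<dots> = (\<Prod>i<j. norm (h (\<sigma> i))) * (\<Prod>i<k. norm (h (\<tau> i)))"
      using s by (simp add: splits_def prod.reindex)
    finally have e: "(\<Prod>i<m. norm (h i)) = (\<Prod>i<j. norm (h (\<sigma> i))) * (\<Prod>i<k. norm (h (\<tau> i)))" .
    have "\<bar>A (\<lambda>l. h (\<sigma> l))\<bar> * \<bar>B (\<lambda>l. h (\<tau> l))\<bar>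
       \<le> (C * (\<Prod>i<j. norm (h (\<sigma> i)))) * (C' * (\<Prod>i<k. norm (h (\<tau> i))))"
      by (intro mult_mono C(2) C'(2) mult_nonneg_nonneg C(1) prod_nonneg) auto
    then show "\<bar>A (\<lambda>l. h (\<sigma> l)) * B (\<lambda>l. h (\<tau> l))\<bar> \<le> (C * C') * (\<Prod>i<m. norm (h i))"
      unfolding e by (simp add: abs_mult mult_ac)
  qed
qed

section \<open>Continuity and derivatives of form-valued maps\<close>

lemma msmall_add:
  assumes "msmall k x R" "msmall k x R'" shows "msmall k x (\<lambda>y h. R y h + R' y h)"
  unfolding msmall_def
proof (intro allI impI)
  fix e :: real assume "e > 0"
  then have "e/2 > 0" by simp
  with assms have "\<forall>\<^sub>F y in nhds x. \<forall>h. (\<forall>i<k. norm (h i) \<le> 1) \<longrightarrow> \<bar>R y h\<bar> \<le> (e/2) * norm (y - x)"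
    "\<forall>\<^sub>F y in nhds x. \<forall>h. (\<forall>i<k. norm (h i) \<le> 1) \<longrightarrow> \<bar>R' y h\<bar> \<le> (e/2) * norm (y - x)"
    unfolding msmall_def by blast+
  then show "\<forall>\<^sub>F y in nhds x. \<forall>h. (\<forall>i<k. norm (h i) \<le> 1) \<longrightarrow> \<bar>R y h + R' y h\<bar> \<le> e * norm (y - x)"
  proof eventually_elim
    case (elim y)
    show ?case
    proof (intro allI impI)
      fix h :: "nat \<Rightarrow> 'a" assume "\<forall>i<k. norm (h i) \<le> 1"
      then show "\<bar>R y h + R' y h\<bar> \<le> e * norm (y - x)"
        using elim[rule_format, of h] by (auto simp: field_simps)
    qed
  qed
qed

text \<open>The comparison may use other unit arguments \<open>h'\<close> than the given
  \<open>h\<close>; this is what slots that are distributed or filled with a fixed vector call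
  for.\<close>

lemma msmall_mono:
  assumes R: "msmall j x R" and C: "C \<ge> 0"
    and ev: "\<forall>\<^sub>F y in nhds x. \<forall>h. (\<forall>i<k. norm (h i) \<le> 1) \<longrightarrow>
       (\<exists>h'. (\<forall>i<j. norm (h' i) \<le> 1) \<and> \<bar>R' y h\<bar> \<le> C * \<bar>R y h'\<bar>)"
  shows "msmall k x R'"
  unfolding msmall_def
proof (intro allI impI)
  fix e :: real assume e: "e > 0"
  then have "e/(C+1) > 0" using C by simp
  with R have "\<forall>\<^sub>F y in nhds x. \<forall>h. (\<forall>i<j. norm (h i) \<le> 1) \<longrightarrow> \<bar>R y h\<bar> \<le> (e/(C+1)) * norm (y - x)"
    unfolding msmall_def by blast
  with ev show "\<forall>\<^sub>F y in nhds x. \<forall>h. (\<forall>i<k. norm (h i) \<le> 1) \<longrightarrow> \<bar>R' y h\<bar> \<le> e * norm (y - x)"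
  proof eventually_elim
    case (elim y)
    show ?case
    proof (intro allI impI)
      fix h :: "nat \<Rightarrow> 'a" assume "\<forall>i<k. norm (h i) \<le> 1"
      then obtain h' where h': "\<forall>i<j. norm (h' i) \<le> 1" "\<bar>R' y h\<bar> \<le> C * \<bar>R y h'\<bar>" using elim(1) by blast
      have "C * \<bar>R y h'\<bar> \<le> C * ((e/(C+1)) * norm (y - x))"
        using elim(2) h'(1) C by (intro mult_left_mono) auto
      also have "\<dots> = (C/(C+1)) * (e * norm (y - x))" by (simp add: field_simps)
      also have "\<dots> \<le> 1 * (e * norm (y - x))"
        using C e by (intro mult_right_mono) auto
      finally show "\<bar>R' y h\<bar> \<le> e * norm (y - x)" using h'(2) by simp
    qed
  qed
qed

lemma msmall_cmult:
  assumes "msmall k x R" shows "msmall k x (\<lambda>y h. c * R y h)"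
  by (rule msmall_mono[OF assms, of "\<bar>c\<bar>"]) (auto simp: abs_mult intro!: always_eventually)

lemma mcont_bounded:
  assumes "mcont k F x" "mlin k (F x)"
  obtains M where "M > 0" "\<forall>\<^sub>F y in nhds x. \<forall>h. (\<forall>i<k. norm (h i) \<le> 1) \<longrightarrow> \<bar>F y h\<bar> \<le> M"
proof -
  obtain C where C: "C \<ge> 0" "\<And>h. (\<forall>i<k. norm (h i) \<le> 1) \<Longrightarrow> \<bar>F x h\<bar> \<le> C"
    using mlin_bound1[OF assms(2)] by blast
  have "\<forall>\<^sub>F y in nhds x. \<forall>h. (\<forall>i<k. norm (h i) \<le> 1) \<longrightarrow> \<bar>F y h - F x h\<bar> \<le> 1"
    using assms(1) unfolding mcont_iff using zero_less_one by blast
  then have "\<forall>\<^sub>F y in nhds x. \<forall>h. (\<forall>i<k. norm (h i) \<le> 1) \<longrightarrow> \<bar>F y h\<bar> \<le> C + 1"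
  proof eventually_elim
    case (elim y)
    show ?case
    proof (intro allI impI)
      fix h :: "nat \<Rightarrow> 'a" assume h: "\<forall>i<k. norm (h i) \<le> 1"
      show "\<bar>F y h\<bar> \<le> C + 1" using elim[THEN spec, THEN mp, OF h] C(2)[OF h] by linarith
    qed
  qed
  then show thesis using C(1) by (intro that[of "C+1"]) auto
qed

lemma mcont_prod_zero:
  fixes A B :: "'a::real_normed_vector \<Rightarrow> (nat \<Rightarrow> 'a) \<Rightarrow> real" and \<sigma> \<tau> :: "nat \<Rightarrow> nat"
  assumes A: "mcont j A x" and B: "\<forall>\<^sub>F y in nhds x. \<forall>h. (\<forall>i<k. norm (h i) \<le> 1) \<longrightarrow> \<bar>B y h\<bar> \<le> M" and M: "M > 0"
    and \<sigma>: "\<And>i. i < j \<Longrightarrow> \<sigma> i < m" and \<tau>: "\<And>i. i < k \<Longrightarrow> \<tau> i < m" and e: "e > 0"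
  shows "\<forall>\<^sub>F y in nhds x. \<forall>h. (\<forall>i<m. norm (h i) \<le> 1) \<longrightarrow>
    \<bar>(A y (\<lambda>l. h (\<sigma> l)) - A x (\<lambda>l. h (\<sigma> l))) * B y (\<lambda>l. h (\<tau> l))\<bar> \<le> e"
proof -
  have "\<forall>\<^sub>F y in nhds x. \<forall>h. (\<forall>i<j. norm (h i) \<le> 1) \<longrightarrow> \<bar>A y h - A x h\<bar> \<le> e / M"
    using A e M unfolding mcont_iff by simp
  with B show ?thesis
  proof eventually_elim
    case (elim y)
    show ?case
    proof (intro allI impI)
      fix h :: "nat \<Rightarrow> 'a" assume h: "\<forall>i<m. norm (h i) \<le> 1"
      have "\<bar>A y (\<lambda>l. h (\<sigma> l)) - A x (\<lambda>l. h (\<sigma> l))\<bar> * \<bar>B y (\<lambda>l. h (\<tau> l))\<bar> \<le> (e / M) * M"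
        using h \<sigma> \<tau> e M by (intro mult_mono elim(1)[rule_format] elim(2)[rule_format]) auto
      then show "\<bar>(A y (\<lambda>l. h (\<sigma> l)) - A x (\<lambda>l. h (\<sigma> l))) * B y (\<lambda>l. h (\<tau> l))\<bar> \<le> e"
        using M by (simp add: abs_mult)
    qed
  qed
qed

lemma mcont_add:
  assumes "mcont k F x" "mcont k G x" shows "mcont k (\<lambda>x h. F x h + G x h) x"
  unfolding mcont_iff
proof (intro allI impI)
  fix e :: real assume "e > 0"
  then have "e/2 > 0" by simp
  with assms have "\<forall>\<^sub>F y in nhds x. \<forall>h. (\<forall>i<k. norm (h i) \<le> 1) \<longrightarrow> \<bar>F y h - F x h\<bar> \<le> e/2"
    "\<forall>\<^sub>F y in nhds x. \<forall>h. (\<forall>i<k. norm (h i) \<le> 1) \<longrightarrow> \<bar>G y h - G x h\<bar> \<le> e/2"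
    unfolding mcont_iff by blast+
  then show "\<forall>\<^sub>F y in nhds x. \<forall>h. (\<forall>i<k. norm (h i) \<le> 1) \<longrightarrow> \<bar>F y h + G y h - (F x h + G x h)\<bar> \<le> e"
  proof eventually_elim
    case (elim y)
    show ?case
    proof (intro allI impI)
      fix h :: "nat \<Rightarrow> 'a" assume h: "\<forall>i<k. norm (h i) \<le> 1"
      show "\<bar>F y h + G y h - (F x h + G x h)\<bar> \<le> e"
        using elim(1)[THEN spec, THEN mp, OF h] elim(2)[THEN spec, THEN mp, OF h] by linarith
    qed
  qed
qed

lemma mcont_tensor:
  assumes A: "mcont j A x" "mlin j (A x)" and B: "mcont k B x" "mlin k (B x)"
    and s: "splits j k m \<sigma> \<tau>"
  shows "mcont m (\<lambda>x h. A x (\<lambda>l. h (\<sigma> l)) * B x (\<lambda>l. h (\<tau> l))) x"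
  unfolding mcont_iff
proof (intro allI impI)
  fix e :: real assume e: "e > 0"
  obtain M where M: "M > 0" "\<forall>\<^sub>F y in nhds x. \<forall>h. (\<forall>i<k. norm (h i) \<le> 1) \<longrightarrow> \<bar>B y h\<bar> \<le> M"
    using mcont_bounded[OF B] by blast
  obtain C where C: "C \<ge> 0" "\<And>h. (\<forall>i<j. norm (h i) \<le> 1) \<Longrightarrow> \<bar>A x h\<bar> \<le> C"
    using mlin_bound1[OF A(2)] by blast
  have C': "\<forall>\<^sub>F y in nhds x. \<forall>h. (\<forall>i<j. norm (h i) \<le> 1) \<longrightarrow> \<bar>A x h\<bar> \<le> C + 1"
  proof (intro always_eventually allI impI)
    fix h :: "nat \<Rightarrow> 'a" assume "\<forall>i<j. norm (h i) \<le> 1"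
    then show "\<bar>A x h\<bar> \<le> C + 1" using C(2)[of h] by simp
  qed
  note less = splits_less[OF s]
  have "e/2 > 0" "C + 1 > 0" using e C(1) by auto
  with mcont_prod_zero[OF A(1) M(2,1), where \<sigma> = \<sigma> and \<tau> = \<tau> and m = m and e = "e/2"]
    mcont_prod_zero[OF B(1) C' , where \<sigma> = \<tau> and \<tau> = \<sigma> and m = m and e = "e/2"] less
  have "\<forall>\<^sub>F y in nhds x. \<forall>h. (\<forall>i<m. norm (h i) \<le> 1) \<longrightarrow>
    \<bar>(A y (\<lambda>l. h (\<sigma> l)) - A x (\<lambda>l. h (\<sigma> l))) * B y (\<lambda>l. h (\<tau> l))\<bar> \<le> e/2"
   "\<forall>\<^sub>F y in nhds x. \<forall>h. (\<forall>i<m. norm (h i) \<le> 1) \<longrightarrow>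
    \<bar>(B y (\<lambda>l. h (\<tau> l)) - B x (\<lambda>l. h (\<tau> l))) * A x (\<lambda>l. h (\<sigma> l))\<bar> \<le> e/2" by blast+
  then show "\<forall>\<^sub>F y in nhds x. \<forall>h. (\<forall>i<m. norm (h i) \<le> 1) \<longrightarrow>
     \<bar>A y (\<lambda>l. h (\<sigma> l)) * B y (\<lambda>l. h (\<tau> l)) - A x (\<lambda>l. h (\<sigma> l)) * B x (\<lambda>l. h (\<tau> l))\<bar> \<le> e"
  proof eventually_elim
    case (elim y)
    show ?case
    proof (intro allI impI)
      fix h :: "nat \<Rightarrow> 'a" assume h: "\<forall>i<m. norm (h i) \<le> 1"
      have "A y (\<lambda>l. h (\<sigma> l)) * B y (\<lambda>l. h (\<tau> l)) - A x (\<lambda>l. h (\<sigma> l)) * B x (\<lambda>l. h (\<tau> l)) =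
        (A y (\<lambda>l. h (\<sigma> l)) - A x (\<lambda>l. h (\<sigma> l))) * B y (\<lambda>l. h (\<tau> l))
        + (B y (\<lambda>l. h (\<tau> l)) - B x (\<lambda>l. h (\<tau> l))) * A x (\<lambda>l. h (\<sigma> l))"
        by (simp add: algebra_simps)
      then show "\<bar>A y (\<lambda>l. h (\<sigma> l)) * B y (\<lambda>l. h (\<tau> l)) - A x (\<lambda>l. h (\<sigma> l)) * B x (\<lambda>l. h (\<tau> l))\<bar> \<le> e"
        using elim(1)[rule_format, of h] elim(2)[rule_format, of h] h by (auto simp: abs_le_iff)
    qed
  qed
qed

lemma has_mderiv_lipschitz:
  assumes "has_mderiv k F D x"
  obtains C where "C > 0" "\<forall>\<^sub>F y in nhds x. \<forall>h. (\<forall>i<k. norm (h i) \<le> 1) \<longrightarrow> \<bar>F y h - F x h\<bar> \<le> C * norm (y - x)"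
proof -
  have D: "mlin (Suc k) D" and sm: "msmall k x (\<lambda>y h. F y h - F x h - D (mcons (y - x) h))"
    using assms by (auto simp: has_mderiv_iff)
  obtain C where C: "C \<ge> 0" "\<And>v h. (\<forall>i<k. norm (h i) \<le> 1) \<Longrightarrow> \<bar>D (mcons v h)\<bar> \<le> C * norm v"
    using mlin_mcons_bound[OF D] by blast
  have "\<forall>\<^sub>F y in nhds x. \<forall>h. (\<forall>i<k. norm (h i) \<le> 1) \<longrightarrow> \<bar>F y h - F x h - D (mcons (y - x) h)\<bar> \<le> 1 * norm (y - x)"
    using sm unfolding msmall_def using zero_less_one by blast
  then have "\<forall>\<^sub>F y in nhds x. \<forall>h. (\<forall>i<k. norm (h i) \<le> 1) \<longrightarrow> \<bar>F y h - F x h\<bar> \<le> (C + 1) * norm (y - x)"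
  proof eventually_elim
    case (elim y)
    show ?case
    proof (intro allI impI)
      fix h :: "nat \<Rightarrow> 'a" assume h: "\<forall>i<k. norm (h i) \<le> 1"
      show "\<bar>F y h - F x h\<bar> \<le> (C + 1) * norm (y - x)"
        using elim[rule_format, of h] C(2)[of h "y - x"] h by (auto simp: algebra_simps abs_le_iff)
    qed
  qed
  then show thesis using C(1) by (intro that[of "C+1"]) auto
qed

lemma eventually_norm_less: "e > 0 \<Longrightarrow> \<forall>\<^sub>F y in nhds x. norm (y - x) < (e::real)"
  unfolding eventually_nhds_metric dist_norm by blast

lemma has_mderiv_mcont:
  assumes "has_mderiv k F D x" shows "mcont k F x"
  unfolding mcont_iff
proof (intro allI impI)
  fix e :: real assume e: "e > 0"
  obtain C where C: "C > 0" "\<forall>\<^sub>F y in nhds x. \<forall>h. (\<forall>i<k. norm (h i) \<le> 1) \<longrightarrow> \<bar>F y h - F x h\<bar> \<le> C * norm (y - x)"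
    using has_mderiv_lipschitz[OF assms] by blast
  have "\<forall>\<^sub>F y in nhds x. norm (y - x) < e / C" using e C(1) by (intro eventually_norm_less) simp
  with C(2) show "\<forall>\<^sub>F y in nhds x. \<forall>h. (\<forall>i<k. norm (h i) \<le> 1) \<longrightarrow> \<bar>F y h - F x h\<bar> \<le> e"
  proof eventually_elim
    case (elim y)
    then have "C * norm (y - x) \<le> e" using C(1) by (simp add: field_simps)
    then show ?case using elim(1) order_trans by blast
  qed
qed

text \<open>The difference of the two derivatives is homogeneous in its first slot, so a bound of
  order \<open>e * norm (y - x)\<close> near \<open>x\<close> holds at every scale, for every
  \<open>e\<close>. Uniqueness is what lets derivatives of local representatives be patched
  together.\<close>

lemma has_mderiv_unique:
  assumes "has_mderiv k F D x" "has_mderiv k F D' x"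
  shows "D = D'"
proof
  fix h :: "nat \<Rightarrow> 'a"
  have D: "mlin (Suc k) D" "mlin (Suc k) D'" using assms by (auto simp: has_mderiv_iff)
  let ?E = "\<lambda>h. D h + (-1) * D' h"
  have E: "mlin (Suc k) ?E" by (intro mlin_add mlin_scale D)
  have sm: "msmall k x (\<lambda>y h. ?E (mcons (y - x) h))"
  proof -
    have "msmall k x (\<lambda>y h. (F y h - F x h - D' (mcons (y - x) h)) + (-1) * (F y h - F x h - D (mcons (y - x) h)))"
      using assms unfolding has_mderiv_iff by (intro msmall_add msmall_cmult) auto
    then show ?thesis by (simp add: algebra_simps)
  qed
  have z: "?E (mcons v h) = 0" if h: "\<forall>i<k. norm (h i) \<le> 1" and v: "norm v \<le> 1" for v h
  proof -
    have "\<bar>?E (mcons v h)\<bar> \<le> e" if e: "e > 0" for e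
    proof -
      have "\<forall>\<^sub>F y in nhds x. \<forall>h. (\<forall>i<k. norm (h i) \<le> 1) \<longrightarrow> \<bar>?E (mcons (y - x) h)\<bar> \<le> e * norm (y - x)"
        using sm e unfolding msmall_def by blast
      then obtain d where d: "d > 0" "\<And>y h. norm (y - x) < d \<Longrightarrow> (\<forall>i<k. norm (h i) \<le> 1) \<Longrightarrow> \<bar>?E (mcons (y - x) h)\<bar> \<le> e * norm (y - x)"
        unfolding eventually_nhds_metric dist_norm by blast
      define t where "t = d / 2"
      have t: "t > 0" using d(1) by (simp add: t_def)
      have "norm (t *\<^sub>R v) \<le> t * 1" using v t by (simp add: mult_left_le)
      then have "norm ((x + t *\<^sub>R v) - x) < d" using d(1) by (simp add: t_def)
      then have "\<bar>?E (mcons (t *\<^sub>R v) h)\<bar> \<le> e * norm (t *\<^sub>R v)" using d(2)[of "x + t *\<^sub>R v" h] h by simp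
      moreover have "?E (mcons (t *\<^sub>R v) h) = t * ?E (mcons v h)"
        using linear_scale[OF mlin_mcons_linear[OF E]] by simp
      ultimately have "t * \<bar>?E (mcons v h)\<bar> \<le> t * (e * norm v)" using t by (simp add: abs_mult mult_ac)
      then have "\<bar>?E (mcons v h)\<bar> \<le> e * norm v" using t by simp
      also have "\<dots> \<le> e * 1" using v e by (intro mult_left_mono) auto
      finally show ?thesis by simp
    qed
    then show ?thesis using field_le_epsilon[of "\<bar>?E (mcons v h)\<bar>" 0] by simp
  qed
  \<comment> \<open>So far the arguments had norm at most 1. The slots are released one at a time:
    slot \<open>j\<close> is scaled into the unit ball and the factor pulled out by
    linearity.\<close>
  have step: "?E h = 0" if "\<forall>i\<in>{j..<Suc k}. norm (h i) \<le> 1" "j \<le> Suc k" for j h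
    using that
  proof (induction j arbitrary: h)
    case 0
    have "h = mcons (h 0) (\<lambda>i. h (Suc i))" by (auto simp: mcons_def fun_eq_iff split: nat.split)
    then show ?case using z[of "\<lambda>i. h (Suc i)" "h 0"] 0 by auto
  next
    case (Suc j)
    define c where "c = norm (h j) + 1"
    have c: "c > 0" unfolding c_def by (simp add: add_nonneg_pos)
    have "norm (inverse c *\<^sub>R h j) \<le> 1"
      using c by (simp add: c_def field_simps)
    then have 0: "?E (h(j := inverse c *\<^sub>R h j)) = 0"
      using Suc.prems by (intro Suc.IH) auto
    have "?E h = ?E (h(j := c *\<^sub>R (inverse c *\<^sub>R h j)))" using c by simp
    also have "\<dots> = c * ?E (h(j := inverse c *\<^sub>R h j))"
      using linear_scale[OF mlin_linear[OF E], of j h c "inverse c *\<^sub>R h j"] Suc.prems(2) by simp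
    finally show ?case using 0 by simp
  qed
  show "D h = D' h" using step[of "Suc k" h] by simp
qed

lemma has_mderiv_cong_eventually:
  assumes "has_mderiv k F D x" "\<forall>\<^sub>F y in nhds x. F y = G y"
  shows "has_mderiv k G D x"
proof -
  have x: "F x = G x" using eventually_nhds_x_imp_x[OF assms(2)] .
  show ?thesis unfolding has_mderiv_iff
  proof (intro conjI)
    show "mlin (Suc k) D" using assms by (simp add: has_mderiv_iff)
    have sm: "msmall k x (\<lambda>y h. F y h - F x h - D (mcons (y - x) h))"
      using assms by (simp add: has_mderiv_iff)
    show "msmall k x (\<lambda>y h. G y h - G x h - D (mcons (y - x) h))"
      by (rule msmall_mono[OF sm, of 1]) (use assms(2) x in \<open>auto elim!: eventually_mono\<close>)
  qed
qed

lemma has_mderiv_add: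
  assumes "has_mderiv k F D x" "has_mderiv k G E x"
  shows "has_mderiv k (\<lambda>x h. F x h + G x h) (\<lambda>h. D h + E h) x"
  unfolding has_mderiv_iff
proof (intro conjI)
  show "mlin (Suc k) (\<lambda>h. D h + E h)" using assms by (auto simp: has_mderiv_iff intro: mlin_add)
  have "msmall k x (\<lambda>y h. (F y h - F x h - D (mcons (y - x) h)) + (G y h - G x h - E (mcons (y - x) h)))"
    using assms by (auto simp: has_mderiv_iff intro: msmall_add)
  then show "msmall k x (\<lambda>y h. F y h + G y h - (F x h + G x h) - (D (mcons (y - x) h) + E (mcons (y - x) h)))"
    by (simp add: algebra_simps)
qed

lemma msmall_tensor_bounded:
  fixes R B :: "'a::real_normed_vector \<Rightarrow> (nat \<Rightarrow> 'a) \<Rightarrow> real" and \<sigma> \<tau> :: "nat \<Rightarrow> nat"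
  assumes R: "msmall j x R" and B: "\<forall>\<^sub>F y in nhds x. \<forall>h. (\<forall>i<k. norm (h i) \<le> 1) \<longrightarrow> \<bar>B y h\<bar> \<le> M" and M: "M > 0"
    and \<sigma>: "\<And>i. i < j \<Longrightarrow> \<sigma> i < m" and \<tau>: "\<And>i. i < k \<Longrightarrow> \<tau> i < m"
  shows "msmall m x (\<lambda>y h. R y (\<lambda>l. h (\<sigma> l)) * B y (\<lambda>l. h (\<tau> l)))"
proof (rule msmall_mono[OF R, of M])
  show "M \<ge> 0" using M by simp
  from B show "\<forall>\<^sub>F y in nhds x. \<forall>h. (\<forall>i<m. norm (h i) \<le> 1) \<longrightarrow>
            (\<exists>h'. (\<forall>i<j. norm (h' i) \<le> 1) \<and> \<bar>R y (\<lambda>l. h (\<sigma> l)) * B y (\<lambda>l. h (\<tau> l))\<bar> \<le> M * \<bar>R y h'\<bar>)"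
  proof eventually_elim
    case (elim y)
    show ?case
    proof (intro allI impI)
      fix h :: "nat \<Rightarrow> 'a" assume h: "\<forall>i<m. norm (h i) \<le> 1"
      have "\<bar>R y (\<lambda>l. h (\<sigma> l))\<bar> * \<bar>B y (\<lambda>l. h (\<tau> l))\<bar> \<le> \<bar>R y (\<lambda>l. h (\<sigma> l))\<bar> * M"
        using h \<tau> by (intro mult_left_mono elim[rule_format]) auto
      then show "\<exists>h'. (\<forall>i<j. norm (h' i) \<le> 1) \<and> \<bar>R y (\<lambda>l. h (\<sigma> l)) * B y (\<lambda>l. h (\<tau> l))\<bar> \<le> M * \<bar>R y h'\<bar>"
        using h \<sigma> by (intro exI[of _ "\<lambda>l. h (\<sigma> l)"]) (auto simp: abs_mult mult.commute)
    qed
  qed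
qed

text \<open>With \<open>v = y - x\<close> the remainder is (A y - A x - DA v) B y + (B y - B x - DB
  v) A x + DA v (B y - B x). The first two terms are small times bounded; the third is of order
  \<open>norm v\<close> times a factor tending to 0.\<close>

lemma has_mderiv_tensor:
  assumes A: "has_mderiv j A DA x" "mlin j (A x)" and B: "has_mderiv k B DB x" "mlin k (B x)"
    and s: "splits j k m \<sigma> \<tau>"
  shows "has_mderiv m (\<lambda>x h. A x (\<lambda>l. h (\<sigma> l)) * B x (\<lambda>l. h (\<tau> l)))
     (\<lambda>h. DA (\<lambda>l. h (shiftx \<sigma> l)) * B x (\<lambda>l. h (Suc (\<tau> l))) + A x (\<lambda>l. h (Suc (\<sigma> l))) * DB (\<lambda>l. h (shiftx \<tau> l))) x"
  unfolding has_mderiv_iff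
proof (intro conjI)
  have D: "mlin (Suc j) DA" "mlin (Suc k) DB" using A B by (auto simp: has_mderiv_iff)
  have s': "splits j (Suc k) (Suc m) (\<lambda>i. Suc (\<sigma> i)) (shiftx \<tau>)"
    by (intro splits_sym[OF splits_shift[OF splits_sym[OF s]]])
  show "mlin (Suc m) (\<lambda>h. DA (\<lambda>l. h (shiftx \<sigma> l)) * B x (\<lambda>l. h (Suc (\<tau> l))) + A x (\<lambda>l. h (Suc (\<sigma> l))) * DB (\<lambda>l. h (shiftx \<tau> l)))"
    by (rule mlin_add[OF mlin_tensor[OF D(1) B(2) splits_shift[OF s]] mlin_tensor[OF A(2) D(2) s']])
  obtain M where M: "M > 0" "\<forall>\<^sub>F y in nhds x. \<forall>h. (\<forall>i<k. norm (h i) \<le> 1) \<longrightarrow> \<bar>B y h\<bar> \<le> M"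
    using mcont_bounded[OF has_mderiv_mcont[OF B(1)] B(2)] by blast
  obtain C where C: "C \<ge> 0" "\<And>h. (\<forall>i<j. norm (h i) \<le> 1) \<Longrightarrow> \<bar>A x h\<bar> \<le> C"
    using mlin_bound1[OF A(2)] by blast
  have C': "\<forall>\<^sub>F y in nhds x. \<forall>h. (\<forall>i<j. norm (h i) \<le> 1) \<longrightarrow> \<bar>A x h\<bar> \<le> C + 1"
  proof (intro always_eventually allI impI)
    fix h :: "nat \<Rightarrow> 'a" assume "\<forall>i<j. norm (h i) \<le> 1"
    then show "\<bar>A x h\<bar> \<le> C + 1" using C(2)[of h] by simp
  qed
  obtain K where K: "K \<ge> 0" "\<And>v h. (\<forall>i<j. norm (h i) \<le> 1) \<Longrightarrow> \<bar>DA (mcons v h)\<bar> \<le> K * norm v"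
    using mlin_mcons_bound[OF D(1)] by blast
  note less = splits_less[OF s]
  have RA: "msmall j x (\<lambda>y h. A y h - A x h - DA (mcons (y - x) h))"
    and RB: "msmall k x (\<lambda>y h. B y h - B x h - DB (mcons (y - x) h))"
    using A B by (auto simp: has_mderiv_iff)
  have t1: "msmall m x (\<lambda>y h. (A y (\<lambda>l. h (\<sigma> l)) - A x (\<lambda>l. h (\<sigma> l)) - DA (mcons (y - x) (\<lambda>l. h (\<sigma> l)))) * B y (\<lambda>l. h (\<tau> l)))"
    by (rule msmall_tensor_bounded[OF RA M(2,1)]) (use less in auto)
  have t2: "msmall m x (\<lambda>y h. (B y (\<lambda>l. h (\<tau> l)) - B x (\<lambda>l. h (\<tau> l)) - DB (mcons (y - x) (\<lambda>l. h (\<tau> l)))) * A x (\<lambda>l. h (\<sigma> l)))"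
    by (rule msmall_tensor_bounded[OF RB C']) (use less C in auto)
  have t3: "msmall m x (\<lambda>y h. DA (mcons (y - x) (\<lambda>l. h (\<sigma> l))) * (B y (\<lambda>l. h (\<tau> l)) - B x (\<lambda>l. h (\<tau> l))))"
    unfolding msmall_def
  proof (intro allI impI)
    fix e :: real assume e: "e > 0"
    then have "e / (K + 1) > 0" using K by simp
    then have "\<forall>\<^sub>F y in nhds x. \<forall>h. (\<forall>i<k. norm (h i) \<le> 1) \<longrightarrow> \<bar>B y h - B x h\<bar> \<le> e / (K + 1)"
      using has_mderiv_mcont[OF B(1)] unfolding mcont_iff by blast
    then show "\<forall>\<^sub>F y in nhds x. \<forall>h. (\<forall>i<m. norm (h i) \<le> 1) \<longrightarrow>
        \<bar>DA (mcons (y - x) (\<lambda>l. h (\<sigma> l))) * (B y (\<lambda>l. h (\<tau> l)) - B x (\<lambda>l. h (\<tau> l)))\<bar> \<le> e * norm (y - x)"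
    proof eventually_elim
      case (elim y)
      show ?case
      proof (intro allI impI)
        fix h :: "nat \<Rightarrow> 'a" assume h: "\<forall>i<m. norm (h i) \<le> 1"
        have "\<bar>DA (mcons (y - x) (\<lambda>l. h (\<sigma> l)))\<bar> * \<bar>B y (\<lambda>l. h (\<tau> l)) - B x (\<lambda>l. h (\<tau> l))\<bar> \<le> (K * norm (y - x)) * (e / (K + 1))"
          using h less K e by (intro mult_mono K(2) elim[rule_format]) auto
        also have "\<dots> = (K / (K + 1)) * (e * norm (y - x))" by (simp add: field_simps)
        also have "\<dots> \<le> 1 * (e * norm (y - x))"
          using K e by (intro mult_right_mono) auto
        finally show "\<bar>DA (mcons (y - x) (\<lambda>l. h (\<sigma> l))) * (B y (\<lambda>l. h (\<tau> l)) - B x (\<lambda>l. h (\<tau> l)))\<bar> \<le> e * norm (y - x)"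
          by (simp add: abs_mult)
      qed
    qed
  qed
  show "msmall m x (\<lambda>y h. A y (\<lambda>l. h (\<sigma> l)) * B y (\<lambda>l. h (\<tau> l)) - A x (\<lambda>l. h (\<sigma> l)) * B x (\<lambda>l. h (\<tau> l)) -
      (DA (\<lambda>l. mcons (y - x) h (shiftx \<sigma> l)) * B x (\<lambda>l. mcons (y - x) h (Suc (\<tau> l)))
       + A x (\<lambda>l. mcons (y - x) h (Suc (\<sigma> l))) * DB (\<lambda>l. mcons (y - x) h (shiftx \<tau> l))))"
    using msmall_add[OF msmall_add[OF t1 t2] t3]
    by (simp add: mcons_shiftx algebra_simps)
qed

text \<open>Remainders and continuity are tested on unit arguments only, so a vector placed in a
  slot must first be scaled into the unit ball.\<close>

lemma ball_scale:
  obtains c and b :: "'a::real_normed_vector" where "c > 0" "a = c *\<^sub>R b" "norm b \<le> 1"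
proof -
  define c where "c = norm a + 1"
  have c: "c > 0" "norm a \<le> c" unfolding c_def by (auto simp: add_nonneg_pos)
  show thesis by (rule that[of c "inverse c *\<^sub>R a"]) (use c in \<open>auto simp: field_simps\<close>)
qed

lemma mlin_ins_scale: "mlin (Suc k) D \<Longrightarrow> p \<le> k \<Longrightarrow> D (ins p (c *\<^sub>R b) h) = c * D (ins p b h)"
  using linear_scale[OF mlin_ins_linear] by fastforce

lemma norm_ins_le: "norm b \<le> 1 \<Longrightarrow> \<forall>i<k. norm (h i) \<le> 1 \<Longrightarrow> p \<le> k \<Longrightarrow> \<forall>i<Suc k. norm (ins p b h i) \<le> 1"
  by (auto simp: ins_def)

lemma has_mderiv_ins:
  assumes F: "has_mderiv (Suc k) F D x" "\<And>y. mlin (Suc k) (F y)" and p: "p \<le> k"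
  shows "has_mderiv k (\<lambda>x h. F x (ins p a h)) (\<lambda>h. D (ins (Suc p) a h)) x"
  unfolding has_mderiv_iff
proof
  have D: "mlin (Suc (Suc k)) D" and sm: "msmall (Suc k) x (\<lambda>y h. F y h - F x h - D (mcons (y - x) h))"
    using F(1) by (auto simp: has_mderiv_iff)
  show "mlin (Suc k) (\<lambda>h. D (ins (Suc p) a h))" using p by (intro mlin_ins[OF D]) simp
  have p': "Suc p \<le> Suc k" using p by simp
  obtain c b where b: "c > 0" "a = c *\<^sub>R b" "norm b \<le> 1" by (rule ball_scale)
  have "\<exists>h'. (\<forall>i<Suc k. norm (h' i) \<le> 1) \<and>
      \<bar>F y (ins p a h) - F x (ins p a h) - D (ins (Suc p) a (mcons (y - x) h))\<bar> \<le> c * \<bar>F y h' - F x h' - D (mcons (y - x) h')\<bar>"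
    if h: "\<forall>i<k. norm (h i) \<le> 1" for h y
  proof (intro exI conjI)
    show "\<forall>i<Suc k. norm (ins p b h i) \<le> 1" by (rule norm_ins_le[OF b(3) h p])
    have "F y (ins p a h) - F x (ins p a h) - D (ins (Suc p) a (mcons (y - x) h)) =
      c * (F y (ins p b h) - F x (ins p b h) - D (mcons (y - x) (ins p b h)))"
      unfolding b(2) mlin_ins_scale[OF F(2) p] mcons_ins mlin_ins_scale[OF D p'] by (simp add: algebra_simps)
    then show "\<bar>F y (ins p a h) - F x (ins p a h) - D (ins (Suc p) a (mcons (y - x) h))\<bar> \<le> c * \<bar>F y (ins p b h) - F x (ins p b h) - D (mcons (y - x) (ins p b h))\<bar>"
      using b(1) by (simp add: abs_mult)
  qed
  then show "msmall k x (\<lambda>y h. F y (ins p a h) - F x (ins p a h) - D (ins (Suc p) a (mcons (y - x) h)))"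
    by (intro msmall_mono[OF sm, of c] always_eventually) (use b(1) in auto)
qed

lemma mcont_ins:
  assumes F: "mcont (Suc k) F x" "\<And>y. mlin (Suc k) (F y)" and p: "p \<le> k"
  shows "mcont k (\<lambda>x h. F x (ins p a h)) x"
  unfolding mcont_iff
proof (intro allI impI)
  fix e :: real assume e: "e > 0"
  obtain c b where b: "c > 0" "a = c *\<^sub>R b" "norm b \<le> 1" by (rule ball_scale)
  have "\<forall>\<^sub>F y in nhds x. \<forall>h. (\<forall>i<Suc k. norm (h i) \<le> 1) \<longrightarrow> \<bar>F y h - F x h\<bar> \<le> e / c"
    using F(1) e b(1) unfolding mcont_iff by simp
  then show "\<forall>\<^sub>F y in nhds x. \<forall>h. (\<forall>i<k. norm (h i) \<le> 1) \<longrightarrow> \<bar>F y (ins p a h) - F x (ins p a h)\<bar> \<le> e"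
  proof eventually_elim
    case (elim y)
    show ?case
    proof (intro allI impI)
      fix h :: "nat \<Rightarrow> 'a" assume h: "\<forall>i<k. norm (h i) \<le> 1"
      then have "\<bar>F y (ins p b h) - F x (ins p b h)\<bar> \<le> e / c"
        using elim norm_ins_le[OF b(3) h p] by blast
      then have "c * \<bar>F y (ins p b h) - F x (ins p b h)\<bar> \<le> e" using b(1) by (simp add: field_simps)
      moreover have "F y (ins p a h) - F x (ins p a h) = c * (F y (ins p b h) - F x (ins p b h))"
        unfolding b(2) mlin_ins_scale[OF F(2) p] by (simp add: algebra_simps)
      ultimately show "\<bar>F y (ins p a h) - F x (ins p a h)\<bar> \<le> e" using b(1) by (simp add: abs_mult)
    qed
  qed
qed

text \<open>Precomposition with the maps \<open>x \<mapsto> l x + s(x) a\<close>; translations, homotheties and shears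
  along one vector are all of this form.\<close>

lemma has_mderiv_shear_continuous:
  assumes s: "has_mderiv 0 (\<lambda>x h. s x) Ds x"
  obtains M where "M > 0" "\<forall>\<^sub>F y in nhds x. norm ((l *\<^sub>R y + s y *\<^sub>R a) - (l *\<^sub>R x + s x *\<^sub>R a)) \<le> M * norm (y - x)"
proof -
  obtain C where C: "C > 0" "\<forall>\<^sub>F y in nhds x. \<forall>h::nat \<Rightarrow> 'a. (\<forall>i<0. norm (h i) \<le> 1) \<longrightarrow> \<bar>s y - s x\<bar> \<le> C * norm (y - x)"
    using has_mderiv_lipschitz[OF s] by blast
  show thesis
  proof (rule that[of "\<bar>l\<bar> + C * norm a + 1"])
    show "\<bar>l\<bar> + C * norm a + 1 > 0" using C(1) by (intro add_nonneg_pos) auto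
    from C(2) show "\<forall>\<^sub>F y in nhds x. norm ((l *\<^sub>R y + s y *\<^sub>R a) - (l *\<^sub>R x + s x *\<^sub>R a)) \<le> (\<bar>l\<bar> + C * norm a + 1) * norm (y - x)"
    proof eventually_elim
      case (elim y)
      have "norm ((l *\<^sub>R y + s y *\<^sub>R a) - (l *\<^sub>R x + s x *\<^sub>R a)) = norm (l *\<^sub>R (y - x) + (s y - s x) *\<^sub>R a)"
        by (simp add: algebra_simps)
      also have "\<dots> \<le> \<bar>l\<bar> * norm (y - x) + \<bar>s y - s x\<bar> * norm a"
        by (rule order_trans[OF norm_triangle_ineq]) simp
      also have "\<dots> \<le> \<bar>l\<bar> * norm (y - x) + (C * norm (y - x)) * norm a"
        using elim by (intro add_left_mono mult_right_mono) auto
      also have "\<dots> \<le> (\<bar>l\<bar> + C * norm a + 1) * norm (y - x)" by (simp add: algebra_simps)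
      finally show ?case .
    qed
  qed
qed

lemma filterlim_of_norm_le:
  fixes \<Phi> :: "'a::real_normed_vector \<Rightarrow> 'b::real_normed_vector"
  assumes "M > 0" "\<forall>\<^sub>F y in nhds x. norm (\<Phi> y - \<Phi> x) \<le> M * norm (y - x)"
  shows "filterlim \<Phi> (nhds (\<Phi> x)) (nhds x)"
  unfolding tendsto_iff
proof (intro allI impI)
  fix e :: real assume e: "e > 0"
  have "\<forall>\<^sub>F y in nhds x. norm (y - x) < e / M" using e assms(1) by (intro eventually_norm_less) simp
  with assms(2) show "\<forall>\<^sub>F y in nhds x. dist (\<Phi> y) (\<Phi> x) < e"
  proof eventually_elim
    case (elim y)
    then have "M * norm (y - x) < e" using assms(1) by (simp add: field_simps)
    then show ?case using elim(1) by (simp add: dist_norm)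
  qed
qed

lemma mcont_0_iff: "mcont 0 (\<lambda>x h. f x) x \<longleftrightarrow> filterlim f (nhds (f x)) (nhds x)"
proof
  assume m: "mcont 0 (\<lambda>x h. f x) x"
  show "filterlim f (nhds (f x)) (nhds x)"
    unfolding tendsto_iff
  proof (intro allI impI)
    fix e :: real assume "e > 0"
    then have "e / 2 > 0" by simp
    then have "\<forall>\<^sub>F y in nhds x. \<bar>f y - f x\<bar> \<le> e / 2"
      using m[unfolded mcont_iff, THEN spec, THEN mp, of "e / 2"] by simp
    then show "\<forall>\<^sub>F y in nhds x. dist (f y) (f x) < e"
      by eventually_elim (use \<open>e > 0\<close> in \<open>auto simp: dist_real_def\<close>)
  qed
next
  assume "filterlim f (nhds (f x)) (nhds x)"
  then show "mcont 0 (\<lambda>x h. f x) x"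
    unfolding tendsto_iff mcont_iff dist_real_def by (auto elim!: eventually_mono dest: less_imp_le)
qed

lemma mcont_shear:
  assumes s: "filterlim s (nhds (s x)) (nhds x)" and F: "mcont k F (l *\<^sub>R x + s x *\<^sub>R a)"
  shows "mcont k (\<lambda>x. F (l *\<^sub>R x + s x *\<^sub>R a)) x"
proof -
  have fl: "filterlim (\<lambda>y. l *\<^sub>R y + s y *\<^sub>R a) (nhds (l *\<^sub>R x + s x *\<^sub>R a)) (nhds x)"
    by (intro tendsto_add tendsto_scaleR s tendsto_const filterlim_ident)
  show ?thesis unfolding mcont_iff
  proof (intro allI impI)
    fix e :: real assume "e > 0"
    then have "\<forall>\<^sub>F z in nhds (l *\<^sub>R x + s x *\<^sub>R a). \<forall>h. (\<forall>i<k. norm (h i) \<le> 1) \<longrightarrow> \<bar>F z h - F (l *\<^sub>R x + s x *\<^sub>R a) h\<bar> \<le> e"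
      using F unfolding mcont_iff by blast
    from eventually_compose_filterlim[OF this fl]
    show "\<forall>\<^sub>F y in nhds x. \<forall>h. (\<forall>i<k. norm (h i) \<le> 1) \<longrightarrow> \<bar>F (l *\<^sub>R y + s y *\<^sub>R a) h - F (l *\<^sub>R x + s x *\<^sub>R a) h\<bar> \<le> e" .
  qed
qed

lemma has_mderiv_shear:
  assumes s: "has_mderiv 0 (\<lambda>x h. s x) Ds x" and F: "has_mderiv k F D (l *\<^sub>R x + s x *\<^sub>R a)"
  shows "has_mderiv k (\<lambda>x. F (l *\<^sub>R x + s x *\<^sub>R a))
    (\<lambda>h. l * D h + Ds (\<lambda>i. h 0) * D (mcons a (\<lambda>i. h (Suc i)))) x"
  unfolding has_mderiv_iff
proof
  let ?P = "\<lambda>x. l *\<^sub>R x + s x *\<^sub>R a"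
  have D: "mlin (Suc k) D" and sm: "msmall k (?P x) (\<lambda>y h. F y h - F (?P x) h - D (mcons (y - ?P x) h))"
    using F by (auto simp: has_mderiv_iff)
  have Ds: "mlin (Suc 0) Ds" and sms: "msmall 0 x (\<lambda>y h. s y - s x - Ds (mcons (y - x) h))"
    using s by (auto simp: has_mderiv_iff)
  have "splits (Suc 0) k (Suc k) (\<lambda>i. 0) Suc"
    by (auto simp: splits_def inj_on_def image_iff less_Suc_eq_0_disj)
  from mlin_tensor[OF Ds mlin_contract[OF D] this]
  show "mlin (Suc k) (\<lambda>h. l * D h + Ds (\<lambda>i. h 0) * D (mcons a (\<lambda>i. h (Suc i))))"
    by (intro mlin_add mlin_scale D)
  obtain M where M: "M > 0" "\<forall>\<^sub>F y in nhds x. norm (?P y - ?P x) \<le> M * norm (y - x)"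
    using has_mderiv_shear_continuous[OF s] by blast
  have fl: "filterlim ?P (nhds (?P x)) (nhds x)" using filterlim_of_norm_le[OF M] .
  have t1: "msmall k x (\<lambda>y h. F (?P y) h - F (?P x) h - D (mcons (?P y - ?P x) h))"
    unfolding msmall_def
  proof (intro allI impI)
    fix e :: real assume e: "e > 0"
    then have "e / M > 0" using M(1) by simp
    then have "\<forall>\<^sub>F z in nhds (?P x). \<forall>h. (\<forall>i<k. norm (h i) \<le> 1) \<longrightarrow> \<bar>F z h - F (?P x) h - D (mcons (z - ?P x) h)\<bar> \<le> (e / M) * norm (z - ?P x)"
      using sm unfolding msmall_def by blast
    from eventually_compose_filterlim[OF this fl] M(2)
    show "\<forall>\<^sub>F y in nhds x. \<forall>h. (\<forall>i<k. norm (h i) \<le> 1) \<longrightarrow> \<bar>F (?P y) h - F (?P x) h - D (mcons (?P y - ?P x) h)\<bar> \<le> e * norm (y - x)"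
    proof eventually_elim
      case (elim y)
      have "(e / M) * norm (?P y - ?P x) \<le> (e / M) * (M * norm (y - x))"
        using elim(2) e M(1) by (intro mult_left_mono) auto
      also have "\<dots> = e * norm (y - x)" using M(1) by simp
      finally show ?case using elim(1) order_trans by blast
    qed
  qed
  obtain C where C: "C \<ge> 0" "\<And>h. (\<forall>i<k. norm (h i) \<le> 1) \<Longrightarrow> \<bar>D (mcons a h)\<bar> \<le> C"
    using mlin_bound1[OF mlin_contract[OF D]] by blast
  have t2: "msmall k x (\<lambda>y h. (s y - s x - Ds (mcons (y - x) (\<lambda>i. 0))) * D (mcons a h))"
  proof (rule msmall_mono[OF sms C(1)], intro always_eventually allI impI exI conjI)
    fix y and h :: "nat \<Rightarrow> 'a" assume h: "\<forall>i<k. norm (h i) \<le> 1"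
    show "\<bar>(s y - s x - Ds (mcons (y - x) (\<lambda>i. 0))) * D (mcons a h)\<bar> \<le> C * \<bar>s y - s x - Ds (mcons (y - x) (\<lambda>i. 0))\<bar>"
      using C(2)[OF h] by (simp add: abs_mult mult.commute mult_right_mono)
  qed auto
  \<comment> \<open>The remainder splits into that of \<open>F\<close> at the displaced point,
    controlled by the Lipschitz bound \<open>M\<close> on the displacement, and that of
    \<open>s\<close> times the bounded quantity \<open>D (mcons a h)\<close>.\<close>
  have e: "F (?P y) h - F (?P x) h - (l * D (mcons (y - x) h) + Ds (\<lambda>i. y - x) * D (mcons a h)) =
     (F (?P y) h - F (?P x) h - D (mcons (?P y - ?P x) h)) + (s y - s x - Ds (mcons (y - x) (\<lambda>i. 0))) * D (mcons a h)" for y h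
  proof -
    have "?P y - ?P x = l *\<^sub>R (y - x) + (s y - s x) *\<^sub>R a" by (simp add: algebra_simps)
    then have "D (mcons (?P y - ?P x) h) = l * D (mcons (y - x) h) + (s y - s x) * D (mcons a h)"
      using linear_add[OF mlin_mcons_linear[OF D]] linear_scale[OF mlin_mcons_linear[OF D]] by simp
    moreover have "Ds (\<lambda>i. y - x) = Ds (mcons (y - x) (\<lambda>i. 0))" by (intro mlin_cong[OF Ds]) auto
    ultimately show ?thesis by (simp add: algebra_simps)
  qed
  show "msmall k x (\<lambda>y h. F (?P y) h - F (?P x) h -
     (l * D (mcons (y - x) h) + Ds (\<lambda>i. mcons (y - x) h 0) * D (mcons a (\<lambda>i. mcons (y - x) h (Suc i)))))"
    using msmall_add[OF t1 t2] unfolding mcons_simps e .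
qed

section \<open>Classes of n times continuously differentiable maps into k-linear forms\<close>

primrec CF :: "nat \<Rightarrow> nat \<Rightarrow> ('a::real_normed_vector \<Rightarrow> (nat \<Rightarrow> 'a) \<Rightarrow> real) \<Rightarrow> bool" where
  "CF 0 k F \<longleftrightarrow> (\<forall>x. mlin k (F x)) \<and> (\<forall>x. mcont k F x)"
| "CF (Suc n) k F \<longleftrightarrow> (\<forall>x. mlin k (F x)) \<and> (\<exists>D. (\<forall>x. has_mderiv k F (D x) x) \<and> CF n (Suc k) D)"

lemma CF_mlin: "CF n k F \<Longrightarrow> mlin k (F x)"
  by (cases n) auto

lemma CF_SucI:
  "(\<And>x. mlin k (F x)) \<Longrightarrow> (\<And>x. has_mderiv k F (D x) x) \<Longrightarrow> CF n (Suc k) D \<Longrightarrow> CF (Suc n) k F"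
  by auto

text \<open>In the product rule one factor stays undifferentiated; it has to be lowered by one order
  before the induction hypothesis applies.\<close>

lemma CF_SucD: "CF (Suc n) k F \<Longrightarrow> CF n k F"
proof (induction n arbitrary: k F)
  case 0
  then show ?case using has_mderiv_mcont by (auto simp del: split_paired_Ex) blast
next
  case (Suc n)
  then show ?case by (metis CF.simps(2))
qed

text \<open>Recursion on the order, with degree and map both free, suits the inductions on products
  and compositions, while \<open>Cn\<close> asks for the whole tower of derivatives at once.
  Prepending \<open>F\<close> to a tower for its derivative, or dropping the first entry, passes
  between the two.\<close>

lemma CF_iff_Ds:
  "CF n k F \<longleftrightarrow> (\<forall>x. mlin k (F x)) \<and> (\<exists>Ds. Ds 0 = F \<and>
     (\<forall>i<n. \<forall>x. has_mderiv (k + i) (Ds i) (Ds (Suc i) x) x) \<and> (\<forall>x. mcont (k + n) (Ds n) x))"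
proof (induction n arbitrary: k F)
  case 0
  then show ?case by auto
next
  case (Suc n)
  show ?case
  proof (intro iffI conjI; (elim conjE)?)
    assume "CF (Suc n) k F"
    then obtain D where D: "\<And>x. mlin k (F x)" "\<And>x. has_mderiv k F (D x) x" "CF n (Suc k) D" by auto
    then show "\<forall>x. mlin k (F x)" by simp
    obtain Ds where Ds: "Ds 0 = D" "\<And>i x. i < n \<Longrightarrow> has_mderiv (Suc k + i) (Ds i) (Ds (Suc i) x) x"
      "\<And>x. mcont (Suc k + n) (Ds n) x"
      using D(3) unfolding Suc.IH by blast
    show "\<exists>Ds. Ds 0 = F \<and> (\<forall>i<Suc n. \<forall>x. has_mderiv (k + i) (Ds i) (Ds (Suc i) x) x) \<and> (\<forall>x. mcont (k + Suc n) (Ds (Suc n)) x)"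
    proof (intro exI conjI allI impI)
      fix i x assume "i < Suc n"
      then show "has_mderiv (k + i) (case_nat F Ds i) (case_nat F Ds (Suc i) x) x"
        using Ds(1,2) D(2) by (cases i) auto
    qed (use Ds(3) in auto)
  next
    assume F: "\<forall>x. mlin k (F x)"
    assume "\<exists>Ds. Ds 0 = F \<and> (\<forall>i<Suc n. \<forall>x. has_mderiv (k + i) (Ds i) (Ds (Suc i) x) x) \<and> (\<forall>x. mcont (k + Suc n) (Ds (Suc n)) x)"
    then obtain Ds where Ds: "Ds 0 = F" "\<And>i x. i < Suc n \<Longrightarrow> has_mderiv (k + i) (Ds i) (Ds (Suc i) x) x"
      "\<And>x. mcont (k + Suc n) (Ds (Suc n)) x" by blast
    have d: "has_mderiv k F (Ds 1 x) x" for x using Ds(2)[of 0 x] Ds(1) by simp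
    have "CF n (Suc k) (Ds 1)" unfolding Suc.IH
    proof (intro conjI exI[of _ "\<lambda>i. Ds (Suc i)"] allI impI)
      show "mlin (Suc k) (Ds 1 x)" for x using d[of x] by (simp add: has_mderiv_iff)
      show "has_mderiv (Suc k + i) (Ds (Suc i)) (Ds (Suc (Suc i)) x) x" if "i < n" for i x
        using Ds(2)[of "Suc i" x] that by simp
    qed (use Ds(3) in auto)
    then show "CF (Suc n) k F" using F d by auto
  qed
qed

lemma Cn_iff_CF: "Cn n f \<longleftrightarrow> CF n 0 (\<lambda>x h. f x)"
  unfolding Cn_def CF_iff_Ds by (simp add: fun_eq_iff)

lemma CF_add: "CF n k F \<Longrightarrow> CF n k G \<Longrightarrow> CF n k (\<lambda>x h. F x h + G x h)"
proof (induction n arbitrary: k F G)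
  case 0
  then show ?case by (auto intro: mcont_add mlin_add)
next
  case (Suc n)
  then obtain D E where "\<And>x. has_mderiv k F (D x) x" "CF n (Suc k) D"
    "\<And>x. has_mderiv k G (E x) x" "CF n (Suc k) E" by auto
  then show ?case using Suc.IH[of "Suc k" D E] Suc.prems
    by (auto intro!: mlin_add exI[of _ "\<lambda>x h. D x h + E x h"] has_mderiv_add)
qed

lemma CF_tensor:
  "CF n j A \<Longrightarrow> CF n k B \<Longrightarrow> splits j k m \<sigma> \<tau> \<Longrightarrow> CF n m (\<lambda>x h. A x (\<lambda>l. h (\<sigma> l)) * B x (\<lambda>l. h (\<tau> l)))"
proof (induction n arbitrary: j k m \<sigma> \<tau> A B)
  case 0
  then show ?case by (auto intro: mcont_tensor mlin_tensor)
next
  case (Suc n)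
  then obtain D E where DE: "\<And>x. has_mderiv j A (D x) x" "CF n (Suc j) D"
    "\<And>x. has_mderiv k B (E x) x" "CF n (Suc k) E" by auto
  have lin: "mlin j (A x)" "mlin k (B x)" for x using Suc.prems CF_mlin by blast+
  note s = splits_shift[OF Suc.prems(3)] splits_sym[OF splits_shift[OF splits_sym[OF Suc.prems(3)]]]
  have "CF n (Suc m) (\<lambda>x h. D x (\<lambda>l. h (shiftx \<sigma> l)) * B x (\<lambda>l. h (Suc (\<tau> l)))
      + A x (\<lambda>l. h (Suc (\<sigma> l))) * E x (\<lambda>l. h (shiftx \<tau> l)))"
    by (intro CF_add Suc.IH[OF DE(2) CF_SucD[OF Suc.prems(2)] s(1)] Suc.IH[OF CF_SucD[OF Suc.prems(1)] DE(4) s(2)])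
  moreover have "has_mderiv m (\<lambda>x h. A x (\<lambda>l. h (\<sigma> l)) * B x (\<lambda>l. h (\<tau> l)))
     (\<lambda>h. D x (\<lambda>l. h (shiftx \<sigma> l)) * B x (\<lambda>l. h (Suc (\<tau> l))) + A x (\<lambda>l. h (Suc (\<sigma> l))) * E x (\<lambda>l. h (shiftx \<tau> l))) x" for x
    by (rule has_mderiv_tensor[OF DE(1) lin(1) DE(3) lin(2) Suc.prems(3)])
  ultimately show ?case by (intro CF_SucI[OF mlin_tensor[OF lin Suc.prems(3)]])
qed

lemma CF_ins: "CF n (Suc k) F \<Longrightarrow> p \<le> k \<Longrightarrow> CF n k (\<lambda>x h. F x (ins p a h))"
proof (induction n arbitrary: k p F)
  case 0
  then show ?case by (auto intro: mcont_ins mlin_ins)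
next
  case (Suc n)
  then obtain D where D: "\<And>x. has_mderiv (Suc k) F (D x) x" "CF n (Suc (Suc k)) D" by auto
  have lin: "mlin (Suc k) (F x)" for x using Suc.prems CF_mlin by blast
  show ?case using Suc.prems(2)
    by (intro CF_SucI[OF mlin_ins[OF lin Suc.prems(2)] has_mderiv_ins[OF D(1) lin Suc.prems(2)] Suc.IH[OF D(2)]]) simp
qed

lemma CF_mcons: "CF n (Suc k) F \<Longrightarrow> CF n k (\<lambda>x h. F x (mcons a h))"
  using CF_ins[of n k F 0 a] by (simp add: ins_0)

lemma CF_zero: "CF n k (\<lambda>x h. 0)"
proof (induction n arbitrary: k)
  case 0
  then show ?case by (auto simp: mcont_def intro!: exI[of _ 1])
next
  case (Suc n)
  then show ?case by (auto simp: has_mderiv_def intro!: exI[of _ "\<lambda>x h. 0"] exI[of _ 1])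
qed

lemma CF_of_const_deriv:
  assumes "\<And>x. mlin k (F x)" "mlin (Suc k) D" "\<And>x. has_mderiv k F D x"
  shows "CF n k F"
proof -
  have 1: "CF n (Suc k) (\<lambda>x. D)" for n
  proof (cases n)
    case 0
    then show ?thesis using assms(2) by (auto simp: mcont_def intro!: exI[of _ 1])
  next
    case (Suc n')
    have "has_mderiv (Suc k) (\<lambda>x. D) (\<lambda>h. 0) x" for x by (auto simp: has_mderiv_def intro!: exI[of _ 1])
    then show ?thesis unfolding Suc by (rule CF_SucI[OF assms(2) _ CF_zero])
  qed
  have "CF (Suc n) k F" by (rule CF_SucI[OF assms(1,3) 1])
  then show ?thesis by (rule CF_SucD)
qed

lemma CF_const: "CF n 0 (\<lambda>x h. c)"
proof (rule CF_of_const_deriv)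
  show "has_mderiv 0 (\<lambda>x h. c) (\<lambda>h. 0) x" for x :: 'a by (auto simp: has_mderiv_def intro!: exI[of _ 1])
qed auto

lemma mlin_bounded_linear: "bounded_linear f \<Longrightarrow> mlin (Suc 0) (\<lambda>h. f (h 0))"
  using bounded_linear.bounded[of f]
  by (auto simp: mlin_def bounded_linear.linear mult.commute)

lemma CF_bounded_linear:
  assumes f: "bounded_linear f" shows "CF n 0 (\<lambda>x h. f x)"
proof (rule CF_of_const_deriv)
  show "mlin (Suc 0) (\<lambda>h. f (h 0))" by (rule mlin_bounded_linear[OF f])
  then show "has_mderiv 0 (\<lambda>x h. f x) (\<lambda>h. f (h 0)) x" for x
    using f by (auto simp: has_mderiv_def linear_diff bounded_linear.linear intro!: exI[of _ 1])
qed auto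

lemma CF_cmult: "CF n k F \<Longrightarrow> CF n k (\<lambda>x h. c * F x h)"
  using CF_tensor[OF CF_const[of n c], of k F k "\<lambda>i. i" "\<lambda>i. i"] by (simp add: splits_def)

lemma CF_mult: "CF n 0 (\<lambda>x h. f x) \<Longrightarrow> CF n 0 (\<lambda>x h. g x) \<Longrightarrow> CF n 0 (\<lambda>x h. f x * g x)"
  using CF_tensor[of n 0 "\<lambda>x h. f x" 0 "\<lambda>x h. g x" 0 "\<lambda>i. i" "\<lambda>i. i"] by (simp add: splits_def)

lemma CF_diff: "CF n 0 (\<lambda>x h. f x) \<Longrightarrow> CF n 0 (\<lambda>x h. g x) \<Longrightarrow> CF n 0 (\<lambda>x h. f x - g x)"
  using CF_add[of n 0 "\<lambda>x h. f x" "\<lambda>x h. (-1) * g x"] CF_cmult[of n 0 "\<lambda>x h. g x" "-1"] by simp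

text \<open>Only the base point is moved, not the arguments of the form. The derivative is thus
  built from \<open>D\<close>, composed with the same map and contracted with the fixed vector
  \<open>a\<close>, and from the derivative of \<open>s\<close>; the induction closes under sums and
  products.\<close>

lemma CF_shear:
  "CF n 0 (\<lambda>x h. s x) \<Longrightarrow> CF n k F \<Longrightarrow> CF n k (\<lambda>x. F (l *\<^sub>R x + s x *\<^sub>R a))"
proof (induction n arbitrary: k F)
  case 0
  then show ?case using mcont_shear[of s _ k F l a] by (simp add: mcont_0_iff)
next
  case (Suc n)
  from Suc.prems obtain D Ds where D: "\<And>x. has_mderiv k F (D x) x" "CF n (Suc k) D"
    and Ds: "\<And>x. has_mderiv 0 (\<lambda>x h. s x) (Ds x) x" "CF n (Suc 0) Ds" by auto
  let ?P = "\<lambda>x. l *\<^sub>R x + s x *\<^sub>R a"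
  have IH: "CF n (Suc k) (\<lambda>x. D (?P x))" by (rule Suc.IH[OF CF_SucD[OF Suc.prems(1)] D(2)])
  have "splits (Suc 0) k (Suc k) (\<lambda>i. 0) Suc"
    by (auto simp: splits_def inj_on_def image_iff less_Suc_eq_0_disj)
  from CF_tensor[OF Ds(2) CF_mcons[OF IH, of a] this]
  have "CF n (Suc k) (\<lambda>x h. l * D (?P x) h + Ds x (\<lambda>i. h 0) * D (?P x) (mcons a (\<lambda>i. h (Suc i))))"
    by (intro CF_add CF_cmult IH)
  then show ?case
    by (rule CF_SucI[OF CF_mlin[OF Suc.prems(2)] has_mderiv_shear[OF Ds(1) D(1)]])
qed

lemma has_mderiv_0_iff:
  "has_mderiv 0 (\<lambda>x h. f x) D x \<longleftrightarrow> mlin (Suc 0) D \<and> (f has_derivative (\<lambda>v. D (mcons v (\<lambda>i. 0)))) (at x)"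
proof (cases "mlin (Suc 0) D")
  case True
  have e: "D (mcons v h) = D (mcons v (\<lambda>i. 0))" for v h by (intro mlin_cong[OF True]) auto
  have q: "(\<forall>h. \<bar>r - D (mcons v h)\<bar> \<le> c) \<longleftrightarrow> \<bar>r - D (mcons v (\<lambda>i. 0))\<bar> \<le> c" for r v c
    by (metis e)
  obtain C where C: "\<And>v h. (\<forall>i<0. norm (h i) \<le> 1) \<Longrightarrow> \<bar>D (mcons v h)\<bar> \<le> C * norm v"
    using mlin_mcons_bound[OF True] by blast
  have "bounded_linear (\<lambda>v. D (mcons v (\<lambda>i. 0)))"
    using linear_add[OF mlin_mcons_linear[OF True]] linear_scale[OF mlin_mcons_linear[OF True]] C
    by (intro bounded_linear_intro[of _ C]) (auto simp: mult.commute)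
  moreover have "has_mderiv 0 (\<lambda>x h. f x) D x \<longleftrightarrow> (\<forall>e>0. \<exists>d>0. \<forall>y. norm (y - x) < d \<longrightarrow>
      \<bar>f y - f x - D (mcons (y - x) (\<lambda>i. 0))\<bar> \<le> e * norm (y - x))"
    unfolding has_mderiv_def using True by (simp add: q)
  ultimately show ?thesis using True unfolding has_derivative_at_alt by simp
qed (simp add: has_mderiv_def)

lemma has_mderiv_comp_real:
  assumes g: "(g has_real_derivative g') (at (s x))" and s: "has_mderiv 0 (\<lambda>x h. s x) Ds x"
  shows "has_mderiv 0 (\<lambda>x h. g (s x)) (\<lambda>h. g' * Ds h) x"
proof -
  have "(s has_derivative (\<lambda>v. Ds (mcons v (\<lambda>i. 0)))) (at x)" using s by (simp add: has_mderiv_0_iff)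
  from has_derivative_compose[OF this, of g "\<lambda>t. g' * t"] g s show ?thesis
    by (simp add: has_mderiv_0_iff has_field_derivative_def mlin_scale)
qed

text \<open>The outer function comes with its full sequence of derivatives, and \<open>i\<close> is
  general because differentiating once replaces \<open>G i\<close> by
  \<open>G (Suc i)\<close>.\<close>

lemma CF_compose_real:
  assumes G: "\<And>i t. (G i has_real_derivative G (Suc i) t) (at t)"
  shows "CF n 0 (\<lambda>x h. s x) \<Longrightarrow> CF n 0 (\<lambda>x h. G i (s x))"
proof (induction n arbitrary: i)
  case 0
  have c: "isCont (G i) t" for t using G[of i t] by (rule DERIV_isCont)
  have "((\<lambda>x. G i (s x)) \<longlongrightarrow> G i (s x)) (nhds x)" for x
    using 0 isCont_tendsto_compose[OF c, of s "s x" "nhds x"] by (simp add: mcont_0_iff)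
  then show ?case by (simp add: mcont_0_iff)
next
  case (Suc n)
  from Suc.prems obtain Ds where Ds: "\<And>x. has_mderiv 0 (\<lambda>x h. s x) (Ds x) x" "CF n (Suc 0) Ds" by auto
  have "splits 0 (Suc 0) (Suc 0) (\<lambda>i. i) (\<lambda>i. i)" by (simp add: splits_def)
  from CF_tensor[OF Suc.IH[OF CF_SucD[OF Suc.prems]] Ds(2) this]
  have "CF n (Suc 0) (\<lambda>x h. G (Suc i) (s x) * Ds x h)" .
  then show ?case by (rule CF_SucI[OF mlin_0 has_mderiv_comp_real[OF G Ds(1)]])
qed

section \<open>Smoothness is a local property\<close>

lemma Ds_local_unique:
  assumes "open N" "\<And>y. y \<in> N \<Longrightarrow> f y = g y"
    and D: "\<And>x. Ds 0 x = (\<lambda>h. f x)" "\<And>k x. k < n \<Longrightarrow> has_mderiv k (Ds k) (Ds (Suc k) x) x"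
    and E: "\<And>x. Es 0 x = (\<lambda>h. g x)" "\<And>k x. k < n \<Longrightarrow> has_mderiv k (Es k) (Es (Suc k) x) x"
    and "k \<le> n" "y \<in> N"
  shows "Ds k y = Es k y"
  using assms(7,8)
proof (induction k arbitrary: y)
  case 0
  then show ?case using assms(2) D(1) E(1) by simp
next
  case (Suc k)
  have "\<forall>\<^sub>F z in nhds y. Es k z = Ds k z"
    using eventually_nhds_in_open[OF assms(1) Suc.prems(2)] by eventually_elim (use Suc in auto)
  then have "has_mderiv k (Ds k) (Es (Suc k) y) y"
    using has_mderiv_cong_eventually[OF E(2)] Suc.prems by simp
  from has_mderiv_unique[OF D(2) this] show ?case using Suc.prems by simp
qed

lemma mcont_cong_eventually:
  assumes "mcont k F x" "\<forall>\<^sub>F y in nhds x. F y = G y" shows "mcont k G x"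
proof -
  have x: "F x = G x" using eventually_nhds_x_imp_x[OF assms(2)] .
  show ?thesis unfolding mcont_iff
  proof (intro allI impI)
    fix e :: real assume "e > 0"
    then have "\<forall>\<^sub>F y in nhds x. \<forall>h. (\<forall>i<k. norm (h i) \<le> 1) \<longrightarrow> \<bar>F y h - F x h\<bar> \<le> e"
      using assms(1) unfolding mcont_iff by blast
    with assms(2) show "\<forall>\<^sub>F y in nhds x. \<forall>h. (\<forall>i<k. norm (h i) \<le> 1) \<longrightarrow> \<bar>G y h - G x h\<bar> \<le> e"
      by eventually_elim (use x in auto)
  qed
qed

text \<open>Each point \<open>x\<close> brings its own tower \<open>Ds x\<close>. The diagonal
  \<open>E k x = Ds x k x\<close> is again a tower: the towers of \<open>x\<close> and
  \<open>y\<close> agree on \<open>N x \<inter> N y\<close>, so near \<open>x\<close> the diagonal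
  equals \<open>Ds x\<close>.\<close>

lemma Cn_local:
  assumes "\<And>x. \<exists>N g. open N \<and> x \<in> N \<and> Cn n g \<and> (\<forall>y\<in>N. f y = g y)"
  shows "Cn n f"
proof -
  have "\<forall>x. \<exists>N g. open N \<and> x \<in> N \<and> Cn n g \<and> (\<forall>y\<in>N. f y = g y)" using assms by blast
  then obtain N g where "\<forall>x. open (N x) \<and> x \<in> N x \<and> Cn n (g x) \<and> (\<forall>y\<in>N x. f y = g x y)"
    unfolding choice_iff by blast
  then have Ng: "\<And>x. open (N x)" "\<And>x. x \<in> N x" "\<And>x. Cn n (g x)" "\<And>x y. y \<in> N x \<Longrightarrow> f y = g x y"
    by auto
  have "\<forall>x. \<exists>D. (\<forall>z. D 0 z = (\<lambda>h. g x z)) \<and> (\<forall>k<n. \<forall>z. has_mderiv k (D k) (D (Suc k) z) z) \<and> (\<forall>z. mcont n (D n) z)"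
    using Ng(3) unfolding Cn_def by blast
  then obtain Ds where "\<forall>x. (\<forall>z. Ds x 0 z = (\<lambda>h. g x z)) \<and> (\<forall>k<n. \<forall>z. has_mderiv k (Ds x k) (Ds x (Suc k) z) z) \<and> (\<forall>z. mcont n (Ds x n) z)"
    unfolding choice_iff by blast
  then have Ds: "\<And>x z. Ds x 0 z = (\<lambda>h. g x z)"
     "\<And>x k z. k < n \<Longrightarrow> has_mderiv k (Ds x k) (Ds x (Suc k) z) z" "\<And>x z. mcont n (Ds x n) z"
    by auto
  define E where "E = (\<lambda>k x. Ds x k x)"
  have loc: "\<forall>\<^sub>F y in nhds x. Ds x k y = E k y" if k: "k \<le> n" for x k
    using eventually_nhds_in_open[OF Ng(1) Ng(2)[of x]]
  proof eventually_elim
    case (elim y)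
    have "Ds x k y = Ds y k y"
    proof (rule Ds_local_unique[OF _ _ Ds(1) Ds(2) Ds(1) Ds(2) k])
      show "open (N x \<inter> N y)" using Ng(1) by auto
      show "g x z = g y z" if "z \<in> N x \<inter> N y" for z
        using that Ng(4)[of z x] Ng(4)[of z y] by simp
      show "y \<in> N x \<inter> N y" using elim Ng(2) by simp
    qed
    then show ?case by (simp add: E_def)
  qed
  show ?thesis unfolding Cn_def
  proof (intro exI[of _ E] conjI allI impI)
    show "E 0 x = (\<lambda>h. f x)" for x using Ds(1) Ng(4)[OF Ng(2), of x] by (simp add: E_def)
    show "has_mderiv k (E k) (E (Suc k) x) x" if "k < n" for k x
      using has_mderiv_cong_eventually[OF Ds(2)[OF that] loc] that by (simp add: E_def)
    show "mcont n (E n) x" for x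
      using mcont_cong_eventually[OF Ds(3) loc] by simp
  qed
qed

lemma Cn_differentiable:
  assumes "Cn n f" "n \<ge> 1"
  obtains D where "(f has_derivative D) (at x)"
proof -
  obtain n' where "n = Suc n'" using assms(2) by (cases n) auto
  with assms(1) obtain D' where "\<forall>x. has_mderiv 0 (\<lambda>x h. f x) (D' x) x" by (auto simp: Cn_iff_CF)
  then show thesis by (intro that[of "\<lambda>v. D' x (mcons v (\<lambda>i. 0))"]) (simp add: has_mderiv_0_iff)
qed

section \<open>Smooth real functions\<close>

text \<open>A family closed under differentiation: with s = 1/t, differentiating p(s) exp(-s) in t
  gives s^2 (p(s) - p'(s)) exp(-s). All derivatives of \<open>eta\<close> lie in it.\<close>

definition eta_poly :: "real poly \<Rightarrow> real \<Rightarrow> real" where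
  "eta_poly p t = (if t > 0 then poly p (1 / t) * exp (- 1 / t) else 0)"

lemma poly_exp_tendsto_0: "((\<lambda>s::real. poly q s * exp (- s)) \<longlongrightarrow> 0) at_top"
proof -
  have "((\<lambda>s::real. \<Sum>i\<le>degree q. coeff q i * (s ^ i / exp s)) \<longlongrightarrow> 0) at_top"
    by (intro tendsto_null_sum tendsto_mult_right_zero tendsto_power_div_exp_0)
  then show ?thesis by (simp add: poly_altdef sum_distrib_right exp_minus sum_divide_distrib field_simps)
qed

lemma eta_poly_deriv:
  "(eta_poly p has_real_derivative eta_poly ([:0, 0, 1:] * (p - pderiv p)) t) (at t)"
proof -
  consider "t > 0" | "t < 0" | "t = 0" by linarith
  then show ?thesis
  proof cases
    case 1
    have "((\<lambda>t. poly p (1 / t) * exp (- 1 / t)) has_real_derivative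
        eta_poly ([:0, 0, 1:] * (p - pderiv p)) t) (at t)"
      using 1 by (auto intro!: derivative_eq_intros DERIV_chain'[OF _ poly_DERIV]
          simp: eta_poly_def field_simps power2_eq_square)
    moreover have "\<forall>\<^sub>F s in nhds t. (0::real) < s"
      using eventually_nhds_in_open[of "{0<..}" t] 1 by simp
    then have "\<forall>\<^sub>F s in nhds t. eta_poly p s = poly p (1 / s) * exp (- 1 / s)"
      by eventually_elim (simp add: eta_poly_def)
    ultimately show ?thesis using DERIV_cong_ev[OF refl _ refl] by metis
  next
    case 2
    have "\<forall>\<^sub>F s in nhds t. s < (0::real)"
      using eventually_nhds_in_open[of "{..<0}" t] 2 by simp
    then have "\<forall>\<^sub>F s in nhds t. eta_poly p s = 0"
      by eventually_elim (simp add: eta_poly_def)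
    then have "(eta_poly p has_real_derivative 0) (at t)"
      using DERIV_cong_ev[of t t "eta_poly p" "\<lambda>_. 0"] by simp
    then show ?thesis using 2 by (simp add: eta_poly_def)
  next
    case 3
    \<comment> \<open>With s = 1/h the difference quotient at 0 from the right is s p(s) exp(-s),
      whose polynomial factor is \<open>pCons 0 p\<close>.\<close>
    have r: "((\<lambda>h. eta_poly p h / h) \<longlongrightarrow> 0) (at_right 0)"
      unfolding filterlim_at_right_to_top
    proof (rule Lim_transform_eventually[OF poly_exp_tendsto_0[of "pCons 0 p"]])
      show "\<forall>\<^sub>F x in at_top. poly (pCons 0 p) x * exp (- x) = eta_poly p (inverse x) / inverse x"
        using eventually_gt_at_top[of 0] by eventually_elim (simp add: eta_poly_def field_simps)
    qed
    have l: "((\<lambda>h. eta_poly p h / h) \<longlongrightarrow> 0) (at_left 0)"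
      by (rule tendsto_eventually) (auto simp: eta_poly_def eventually_at_filter)
    have "((\<lambda>h. eta_poly p h / h) \<longlongrightarrow> 0) (at 0)" using filterlim_split_at[OF l r] .
    then show ?thesis using 3 by (simp add: DERIV_def eta_poly_def)
  qed
qed

definition eta :: "real \<Rightarrow> real" where
  "eta t = (if t > 0 then exp (- 1 / t) else 0)"

definition eta' :: "real \<Rightarrow> real" where
  "eta' t = (if t > 0 then exp (- 1 / t) / t\<^sup>2 else 0)"

lemma CF_eta:
  assumes "CF n 0 (\<lambda>x h. s x)" shows "CF n 0 (\<lambda>x h. eta (s x))"
proof -
  define G where "G i = eta_poly (((\<lambda>p. [:0, 0, 1:] * (p - pderiv p)) ^^ i) 1)" for i
  have "(G i has_real_derivative G (Suc i) t) (at t)" for i t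
    unfolding G_def using eta_poly_deriv by simp
  from CF_compose_real[of G, OF this assms, of 0] show ?thesis
    by (simp add: G_def eta_poly_def eta_def cong: if_cong)
qed

lemma eta_deriv: "(eta has_real_derivative eta' t) (at t)"
proof -
  have "eta = eta_poly 1" "eta' t = eta_poly ([:0, 0, 1:] * (1 - pderiv 1)) t"
    by (auto simp: eta_def eta'_def eta_poly_def fun_eq_iff field_simps power2_eq_square)
  then show ?thesis using eta_poly_deriv by metis
qed

lemma eta_nonpos [simp]: "t \<le> 0 \<Longrightarrow> eta t = 0" "t \<le> 0 \<Longrightarrow> eta' t = 0"
  by (auto simp: eta_def eta'_def)

lemma eta_pos: "t > 0 \<Longrightarrow> eta t > 0" "t > 0 \<Longrightarrow> eta' t > 0"
  by (auto simp: eta_def eta'_def)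

lemma eta_nonneg: "eta t \<ge> 0" "eta' t \<ge> 0"
  by (auto simp: eta_def eta'_def)

lemma eta_less_1: "eta t < 1"
  by (auto simp: eta_def)

lemma eta_mono: "s \<le> t \<Longrightarrow> eta s \<le> eta t"
  by (auto simp: eta_def field_simps)

lemma eta_strict: "0 < t \<Longrightarrow> s < t \<Longrightarrow> eta s < eta t"
  by (auto simp: eta_def field_simps)

text \<open>For x = 1/t this says x^2 exp(-x) \<le> 4, which is the square of x/2 \<le>
  exp(x/2).\<close>

lemma eta'_le_4: "eta' t \<le> 4"
proof (cases "t > 0")
  case True
  define x where "x = 1 / t"
  have x: "x > 0" using True by (simp add: x_def)
  have "x / 2 \<le> exp (x / 2)" using exp_ge_add_one_self[of "x/2"] by linarith
  then have "(x / 2)\<^sup>2 \<le> (exp (x / 2))\<^sup>2"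
    using x by (intro power_mono) auto
  then have "x\<^sup>2 \<le> 4 * exp x" by (simp add: power2_eq_square exp_add[symmetric] field_simps)
  then have "x\<^sup>2 * exp (- x) \<le> 4" by (simp add: exp_minus field_simps)
  then show ?thesis using True by (simp add: x_def eta'_def power_one_over field_simps)
qed simp

text \<open>A smooth step from \<open>0\<close> (on \<open>t \<le> 0\<close>) to \<open>1\<close> (on \<open>t \<ge> 1\<close>), written without a quotient
  of functions so that smoothness only needs composition.\<close>
definition step :: "real \<Rightarrow> real" where
  "step t = 1 - eta (eta 1 - eta t) / eta (eta 1)"

definition step' :: "real \<Rightarrow> real" where
  "step' t = eta' (eta 1 - eta t) * eta' t / eta (eta 1)"

lemma eta_eta_1_pos: "eta (eta 1) > 0"
  by (intro eta_pos) simp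

lemma step_deriv: "(step has_real_derivative step' t) (at t)"
  unfolding step_def[abs_def] step'_def
  by (auto intro!: derivative_eq_intros DERIV_chain2[OF eta_deriv] eta_deriv simp: less_imp_neq[OF eta_eta_1_pos, symmetric])

lemma CF_step: "CF n 0 (\<lambda>x h. s x) \<Longrightarrow> CF n 0 (\<lambda>x h. step (s x))"
  unfolding step_def divide_inverse
  using CF_diff[OF CF_const CF_cmult[OF CF_eta[OF CF_diff[OF CF_const CF_eta]]], of n s 1 "inverse (eta (eta 1))" "eta 1"]
  by (simp add: mult.commute)

lemma step_0: "t \<le> 0 \<Longrightarrow> step t = 0"
  using eta_eta_1_pos by (auto simp: step_def)

lemma step_1: "1 \<le> t \<Longrightarrow> step t = 1"
  using eta_mono[of 1 t] by (simp add: step_def)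

lemma step_mono: "s \<le> t \<Longrightarrow> step s \<le> step t"
  unfolding step_def using eta_eta_1_pos
  by (intro diff_left_mono divide_right_mono eta_mono) (auto intro: eta_mono)

lemma step_range: "0 \<le> step t" "step t \<le> 1"
  using step_mono[of "min t 0" t] step_mono[of t "max t 1"] step_0[of "min t 0"] step_1[of "max t 1"] by auto

lemma step'_pos: "0 < t \<Longrightarrow> t < 1 \<Longrightarrow> step' t > 0"
  unfolding step'_def using eta_strict[of 1 t] eta_eta_1_pos
  by (intro divide_pos_pos mult_pos_pos eta_pos) auto

lemma step'_nonneg: "step' t \<ge> 0"
  unfolding step'_def using eta_eta_1_pos eta_nonneg by (intro divide_nonneg_pos mult_nonneg_nonneg) auto

lemma step'_outside: "t \<le> 0 \<or> 1 \<le> t \<Longrightarrow> step' t = 0"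
  using eta_mono[of 1 t] by (auto simp: step'_def)

text \<open>A bound for \<open>step'\<close>: two factors \<open>eta'\<close>, each at most 4, over
  \<open>eta (eta 1)\<close>.\<close>

definition K0 :: real where "K0 = 16 / eta (eta 1)"

lemma step'_le: "step' t \<le> K0"
proof -
  have "eta' (eta 1 - eta t) * eta' t \<le> 4 * 4"
    by (intro mult_mono eta'_le_4 eta_nonneg) auto
  then show ?thesis unfolding step'_def K0_def using eta_eta_1_pos by (simp add: divide_right_mono)
qed

section \<open>The symmetric step and the turning profile\<close>

definition hstep :: "real \<Rightarrow> real" where
  "hstep t = (step (2 * t - 1/2) + 1 - step (3/2 - 2 * t)) / 2"

definition hstep' :: "real \<Rightarrow> real" where
  "hstep' t = step' (2 * t - 1/2) + step' (3/2 - 2 * t)"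

lemma hstep_deriv: "(hstep has_real_derivative hstep' t) (at t)"
  unfolding hstep_def[abs_def] hstep'_def
  by (auto intro!: derivative_eq_intros DERIV_chain2[OF step_deriv])

lemma hstep_0: "t \<le> 1/4 \<Longrightarrow> hstep t = 0"
  by (simp add: hstep_def step_0 step_1)

lemma hstep_1: "3/4 \<le> t \<Longrightarrow> hstep t = 1"
  by (simp add: hstep_def step_0 step_1)

lemma hstep_range: "0 \<le> hstep t" "hstep t \<le> 1"
  using step_range[of "2 * t - 1/2"] step_range[of "3/2 - 2 * t"] by (auto simp: hstep_def)

text \<open>\<open>hstep t - 1/2\<close> is half the difference of \<open>step\<close> at
  \<open>2 * t - 1/2\<close> and at \<open>3/2 - 2 * t\<close>, so by monotonicity it has the sign
  of \<open>t - 1/2\<close>. The symmetric form of \<open>hstep\<close> serves this purpose.\<close>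

lemma hstep_sign: "0 \<le> (1 - 2 * t) * (1 - 2 * hstep t)"
proof (cases "t \<le> 1/2")
  case True
  then show ?thesis using step_mono[of "2 * t - 1/2" "3/2 - 2 * t"]
    by (intro mult_nonneg_nonneg) (auto simp: hstep_def)
next
  case False
  then show ?thesis using step_mono[of "3/2 - 2 * t" "2 * t - 1/2"]
    by (intro mult_nonpos_nonpos) (auto simp: hstep_def)
qed

lemma hstep'_nonneg: "hstep' t \<ge> 0"
  by (simp add: hstep'_def step'_nonneg)

lemma hstep'_half: "hstep t = 1/2 \<Longrightarrow> hstep' t > 0"
  using hstep_0[of t] hstep_1[of t] step'_pos[of "2 * t - 1/2"] step'_nonneg[of "3/2 - 2 * t"]
  unfolding hstep'_def by (cases "1/4 < t \<and> t < 3/4") (auto simp: not_less)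

lemma hstep'_outside: "t \<le> 1/4 \<or> 3/4 \<le> t \<Longrightarrow> hstep' t = 0"
  by (auto simp: hstep'_def step'_outside)

lemma hstep'_le: "hstep' t \<le> 2 * K0"
  using step'_le[of "2 * t - 1/2"] step'_le[of "3/2 - 2 * t"] by (simp add: hstep'_def)

text \<open>The profile \<open>tau\<close> goes up from \<open>0\<close> along \<open>t\<close> and comes back along \<open>1 - t\<close>.\<close>
definition tau :: "real \<Rightarrow> real" where
  "tau t = t + hstep t * (1 - 2 * t)"

definition tau' :: "real \<Rightarrow> real" where
  "tau' t = 1 - 2 * hstep t + hstep' t * (1 - 2 * t)"

lemma tau_deriv: "(tau has_real_derivative tau' t) (at t)"
  unfolding tau_def[abs_def] tau'_def
  by (auto intro!: derivative_eq_intros hstep_deriv)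

lemma tau_left: "t \<le> 1/4 \<Longrightarrow> tau t = t"
  by (simp add: tau_def hstep_0)

lemma tau_right: "3/4 \<le> t \<Longrightarrow> tau t = 1 - t"
  by (simp add: tau_def hstep_1)

text \<open>\<open>tau t\<close> is the convex combination of \<open>t\<close> and
  \<open>1 - t\<close> with weight \<open>hstep t\<close>.\<close>

lemma tau_mid:
  assumes "1/4 \<le> t" "t \<le> 3/4" shows "1/4 \<le> tau t" "tau t \<le> 3/4"
proof -
  have e: "tau t = (1 - hstep t) * t + hstep t * (1 - t)" by (simp add: tau_def algebra_simps)
  have "(1 - hstep t) * (1/4) + hstep t * (1/4) \<le> tau t" unfolding e
    using assms hstep_range[of t] by (intro add_mono mult_left_mono) auto
  then show "1/4 \<le> tau t" by argo
  have "tau t \<le> (1 - hstep t) * (3/4) + hstep t * (3/4)" unfolding e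
    using assms hstep_range[of t] by (intro add_mono mult_left_mono) auto
  then show "tau t \<le> 3/4" by argo
qed

text \<open>Staying clear of the value 1 of \<open>step\<close> is what forces the tube to turn
  around.\<close>

lemma tau_le: "tau t \<le> 3/4"
  using tau_left[of t] tau_right[of t] tau_mid[of t] by (cases "t < 1/4"; cases "t > 3/4") auto

lemma tau_half: "hstep t = 1/2 \<Longrightarrow> tau t = 1/2"
  by (simp only: tau_def) argo

text \<open>\<open>tau'\<close> governs the motion in \<open>v\<close>, and
  \<open>1 - 2 * hstep\<close> is the sign with which \<open>v\<close> enters the time. That the two
  agree makes the time grow on both legs of the U-turn.\<close>

lemma tau'_hstep: "tau' t * (1 - 2 * hstep t) \<ge> (1 - 2 * hstep t)\<^sup>2"
proof -
  have "tau' t * (1 - 2 * hstep t) = (1 - 2 * hstep t)\<^sup>2 + hstep' t * ((1 - 2 * t) * (1 - 2 * hstep t))"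
    by (simp add: tau'_def algebra_simps power2_eq_square)
  then show ?thesis using mult_nonneg_nonneg[OF hstep'_nonneg hstep_sign] by simp
qed

lemma hstep'_bound: "\<bar>hstep' t\<bar> \<le> 2 * K0"
  using hstep'_nonneg[of t] hstep'_le[of t] by simp

lemma tau'_bound: "\<bar>tau' t\<bar> \<le> 1 + 2 * K0"
proof -
  have "\<bar>hstep' t * (1 - 2 * t)\<bar> \<le> 2 * K0"
  \<comment> \<open>\<open>hstep'\<close> vanishes outside (1/4, 3/4), and inside this interval
    \<open>1 - 2 * t\<close> is at most 1 in absolute value.\<close>
  proof (cases "t \<le> 1/4 \<or> 3/4 \<le> t")
    case True
    then show ?thesis using hstep'_outside[of t] hstep'_bound[of t] by auto
  next
    case False
    then have "\<bar>hstep' t\<bar> * \<bar>1 - 2 * t\<bar> \<le> (2 * K0) * 1"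
      by (intro mult_mono hstep'_bound) (use hstep'_bound[of t] in auto)
    then show ?thesis by (simp add: abs_mult)
  qed
  then show ?thesis using hstep_range[of t] unfolding tau'_def abs_le_iff by (auto simp: abs_le_iff)
qed

lemma K0_pos: "K0 > 0"
  using eta_eta_1_pos by (simp add: K0_def)

lemma CF_hstep:
  assumes "CF n 0 (\<lambda>x h. s x)" shows "CF n 0 (\<lambda>x h. hstep (s x))"
proof -
  have "CF n 0 (\<lambda>x h. 2 * s x - 1/2)" "CF n 0 (\<lambda>x h. 3/2 - 2 * s x)"
    by (intro CF_diff CF_cmult CF_const assms)+
  note a = this[THEN CF_step]
  have "CF n 0 (\<lambda>x h. (1/2) * (step (2 * s x - 1/2) - (step (3/2 - 2 * s x) - 1)))"
    by (rule CF_cmult[OF CF_diff[OF a(1) CF_diff[OF a(2) CF_const]]])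
  moreover have "hstep t = (1/2) * (step (2 * t - 1/2) - (step (3/2 - 2 * t) - 1))" for t
    by (simp add: hstep_def field_simps)
  ultimately show ?thesis by (simp only:)
qed

lemma CF_tau:
  assumes "CF n 0 (\<lambda>x h. s x)" shows "CF n 0 (\<lambda>x h. tau (s x))"
  unfolding tau_def by (intro CF_add CF_mult CF_diff CF_cmult CF_const CF_hstep assms)

lemma CF_exp:
  assumes "CF n 0 (\<lambda>x h. s x)" shows "CF n 0 (\<lambda>x h. exp (s x))"
  using CF_compose_real[of "\<lambda>i. exp", OF DERIV_exp assms] by simp

section \<open>Functionals\<close>

definition sublin :: "('a::real_vector \<Rightarrow> real) \<Rightarrow> bool" where
  "sublin p \<longleftrightarrow> (\<forall>x y. p (x + y) \<le> p x + p y) \<and> (\<forall>x t. t \<ge> 0 \<longrightarrow> p (t *\<^sub>R x) = t * p x)"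

lemma sublinD:
  assumes "sublin p"
  shows "p (x + y) \<le> p x + p y" "t \<ge> 0 \<Longrightarrow> p (t *\<^sub>R x) = t * p x" "p 0 = 0" "- p (- x) \<le> p x"
proof -
  show s: "p (x + y) \<le> p x + p y" "t \<ge> 0 \<Longrightarrow> p (t *\<^sub>R x) = t * p x" for x y t
    using assms by (auto simp: sublin_def)
  show z: "p 0 = 0" using s(2)[of 0 0] by simp
  show "- p (- x) \<le> p x" using s(1)[of x "- x"] z by simp
qed

text \<open>A minimal sublinear functional equals its lowering in every direction, and this makes it additive.\<close>
definition lower :: "('a::real_vector \<Rightarrow> real) \<Rightarrow> 'a \<Rightarrow> 'a \<Rightarrow> real" where
  "lower p y x = (INF t\<in>{0..}. p (x + t *\<^sub>R y) - t * p y)"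

lemma lower_bdd:
  assumes "sublin p" shows "bdd_below ((\<lambda>t. p (x + t *\<^sub>R y) - t * p y) ` {0..})"
proof (rule bdd_belowI2)
  fix t :: real assume t: "t \<in> {0..}"
  have "p (t *\<^sub>R y) \<le> p (x + t *\<^sub>R y) + p (- x)" using sublinD(1)[OF assms, of "x + t *\<^sub>R y" "- x"] by simp
  then show "- p (- x) \<le> p (x + t *\<^sub>R y) - t * p y" using t sublinD(2)[OF assms, of t y] by simp
qed

lemma lower_le:
  assumes "sublin p" "t \<ge> 0" shows "lower p y x \<le> p (x + t *\<^sub>R y) - t * p y"
  unfolding lower_def using assms by (intro cINF_lower lower_bdd) auto

lemma lower_greatest:
  assumes "\<And>t. t \<ge> 0 \<Longrightarrow> c \<le> p (x + t *\<^sub>R y) - t * p y" shows "c \<le> lower p y x"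
  unfolding lower_def using assms by (intro cINF_greatest) auto

lemma sublin_lower:
  assumes p: "sublin p" shows "sublin (lower p y)"
  unfolding sublin_def
proof (intro conjI allI impI)
  fix x z
  have "lower p y (x + z) - (p (x + t *\<^sub>R y) - t * p y) \<le> lower p y z" if t: "t \<ge> 0" for t
  proof (rule lower_greatest)
    fix s :: real assume s: "s \<ge> 0"
    have "lower p y (x + z) \<le> p ((x + t *\<^sub>R y) + (z + s *\<^sub>R y)) - (t + s) * p y"
      using lower_le[OF p, of "t + s" y "x + z"] s t by (simp add: algebra_simps)
    also have "\<dots> \<le> p (x + t *\<^sub>R y) + p (z + s *\<^sub>R y) - (t + s) * p y" using sublinD(1)[OF p] by simp
    finally show "lower p y (x + z) - (p (x + t *\<^sub>R y) - t * p y) \<le> p (z + s *\<^sub>R y) - s * p y"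
      by (simp add: algebra_simps)
  qed
  then have "lower p y (x + z) - lower p y z \<le> lower p y x"
    by (intro lower_greatest) (simp add: algebra_simps)
  then show "lower p y (x + z) \<le> lower p y x + lower p y z" by simp
next
  fix x and c :: real assume c: "c \<ge> 0"
  show "lower p y (c *\<^sub>R x) = c * lower p y x"
  proof (cases "c = 0")
    case True
    have "lower p y 0 = 0"
    proof (rule antisym)
      show "lower p y 0 \<le> 0" using lower_le[OF p, of 0 y 0] sublinD(3)[OF p] by simp
      show "0 \<le> lower p y 0" by (rule lower_greatest) (simp add: sublinD(2)[OF p])
    qed
    then show ?thesis using True by simp
  next
    case False
    then have c: "c > 0" using c by simp
    have le: "lower p y (c *\<^sub>R x) \<le> c * lower p y x" if c: "c > 0" for c x
    proof -
      have "lower p y (c *\<^sub>R x) / c \<le> lower p y x"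
      proof (rule lower_greatest)
        fix t :: real assume t: "t \<ge> 0"
        have "lower p y (c *\<^sub>R x) \<le> p (c *\<^sub>R x + (c * t) *\<^sub>R y) - (c * t) * p y"
          using lower_le[OF p, of "c * t" y "c *\<^sub>R x"] c t by simp
        also have "c *\<^sub>R x + (c * t) *\<^sub>R y = c *\<^sub>R (x + t *\<^sub>R y)" by (simp add: algebra_simps)
        also have "p \<dots> = c * p (x + t *\<^sub>R y)" using sublinD(2)[OF p] c by simp
        finally show "lower p y (c *\<^sub>R x) / c \<le> p (x + t *\<^sub>R y) - t * p y" using c by (simp add: field_simps)
      qed
      then show ?thesis using c by (simp add: field_simps)
    qed
    have "lower p y (inverse c *\<^sub>R (c *\<^sub>R x)) \<le> inverse c * lower p y (c *\<^sub>R x)" using c by (intro le) simp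
    then have "c * lower p y x \<le> lower p y (c *\<^sub>R x)" using c by (simp add: field_simps)
    then show ?thesis using le[OF c, of x] by simp
  qed
qed

lemma minimal_sublin_linear:
  assumes p: "sublin p" and min: "\<And>q. sublin q \<Longrightarrow> (\<And>x. q x \<le> p x) \<Longrightarrow> q = p"
  shows "linear p"
proof -
  have low: "lower p y = p" for y
    using lower_le[OF p, of 0] by (intro min sublin_lower p) simp
  \<comment> \<open>The parameter \<open>t = 1\<close> in the lowering gives
    \<open>p x \<le> p (x + y) - p y\<close>, the inequality converse to subadditivity.\<close>
  have add: "p (x + y) = p x + p y" for x y
    using lower_le[OF p, of 1 y x] sublinD(1)[OF p, of x y] by (simp add: low)
  have neg: "p (- x) = - p x" for x using add[of x "- x"] sublinD(3)[OF p] by simp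
  have "p (c *\<^sub>R x) = c * p x" for c x
  proof (cases "c \<ge> 0")
    case False
    then have "p ((- c) *\<^sub>R x) = (- c) * p x" using sublinD(2)[OF p, of "- c" x] by simp
    then show ?thesis using neg[of "c *\<^sub>R x"] by simp
  qed (use sublinD(2)[OF p] in auto)
  then show ?thesis using add by (intro linearI) auto
qed

lemma exists_linear_below_sublin:
  assumes p: "sublin (p :: 'a::real_vector \<Rightarrow> real)"
  obtains f where "linear f" "\<And>x. f x \<le> p x"
proof -
  define A where "A = {q. sublin q \<and> (\<forall>x. q x \<le> p x)}"
  \<comment> \<open>The order is reversed, so that the maximal element supplied by Zorn's lemma is a
    minimal functional.\<close>
  define P where "P = (\<lambda>q r :: 'a \<Rightarrow> real. \<forall>x. r x \<le> q x)"
  have "\<exists>m\<in>A. \<forall>a\<in>A. P m a \<longrightarrow> a = m"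
  proof (rule predicate_Zorn)
    show "partial_order_on A (relation_of P A)"
      by (rule partial_order_on_relation_ofI) (auto simp: P_def fun_eq_iff intro: order_trans antisym)
    fix C assume C: "C \<in> Chains (relation_of P A)"
    then have CA: "C \<subseteq> A" and tot: "\<And>q r. q \<in> C \<Longrightarrow> r \<in> C \<Longrightarrow> P q r \<or> P r q"
      unfolding Chains_def relation_of_def by blast+
    show "\<exists>u\<in>A. \<forall>a\<in>C. P a u"
    proof (cases "C = {}")
      case True
      then show ?thesis using p by (auto simp: A_def)
    next
      case False
      define u where "u x = (INF q\<in>C. q x)" for x
      have bdd: "bdd_below ((\<lambda>q. q x) ` C)" for x
      proof (rule bdd_belowI2)
        fix q assume "q \<in> C"
        then have q: "sublin q" "q (- x) \<le> p (- x)" using CA by (auto simp: A_def)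
        then show "- p (- x) \<le> q x" using sublinD(4)[OF q(1), of x] by simp
      qed
      have ule: "u x \<le> q x" if "q \<in> C" for q x unfolding u_def by (intro cINF_lower bdd that)
      have uge: "c \<le> u x" if "\<And>q. q \<in> C \<Longrightarrow> c \<le> q x" for c x
        unfolding u_def using False that by (intro cINF_greatest) auto
      have "sublin u" unfolding sublin_def
      proof (intro conjI allI impI)
        fix x y
        have "u (x + y) - q x \<le> u y" if q: "q \<in> C" for q
        proof (rule uge)
          fix r assume r: "r \<in> C"
          \<comment> \<open>Infima of subadditive functions need not be subadditive; in a chain the
            smaller of \<open>q\<close> and \<open>r\<close> serves for both arguments.\<close>
          obtain s where s: "s \<in> C" "\<And>z. s z \<le> q z" "\<And>z. s z \<le> r z"
            using tot[OF q r] q r unfolding P_def by blast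
          have "sublin s" using s(1) CA by (auto simp: A_def)
          then have "u (x + y) \<le> s x + s y" using ule[OF s(1), of "x + y"] sublinD(1) order_trans by blast
          then show "u (x + y) - q x \<le> r y" using s(2)[of x] s(3)[of y] by simp
        qed
        then have "u (x + y) - u y \<le> u x" by (intro uge) (simp add: algebra_simps)
        then show "u (x + y) \<le> u x + u y" by simp
      next
        fix x and t :: real assume t: "t \<ge> 0"
        have hom: "q (t *\<^sub>R x) = t * q x" if "q \<in> C" for q
          using sublinD(2)[OF _ t, of q x] that CA by (auto simp: A_def)
        show "u (t *\<^sub>R x) = t * u x"
        proof (rule antisym)
          show "t * u x \<le> u (t *\<^sub>R x)" 
          proof (rule uge)
            fix q assume q: "q \<in> C"
            show "t * u x \<le> q (t *\<^sub>R x)" unfolding hom[OF q] by (rule mult_left_mono[OF ule[OF q] t])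
          qed
          show "u (t *\<^sub>R x) \<le> t * u x"
          proof (cases "t = 0")
            case True
            obtain q where "q \<in> C" using False by blast
            then show ?thesis using True ule[of q "t *\<^sub>R x"] hom[of q] by simp
          next
            case nz: False
            have "u (t *\<^sub>R x) / t \<le> u x"
            proof (rule uge)
              fix q assume q: "q \<in> C"
              show "u (t *\<^sub>R x) / t \<le> q x" using ule[OF q, of "t *\<^sub>R x"] t nz unfolding hom[OF q] by (simp add: field_simps)
            qed
            then show ?thesis using t nz by (simp add: field_simps)
          qed
        qed
      qed
      moreover have "u x \<le> p x" for x
      proof -
        obtain q where q: "q \<in> C" using False by blast
        then have "q x \<le> p x" using CA by (auto simp: A_def)
        with ule[OF q, of x] show ?thesis by simp
      qed
      ultimately show ?thesis using ule by (auto simp: A_def P_def)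
    qed
  qed
  then obtain f where f: "f \<in> A" "\<And>q. q \<in> A \<Longrightarrow> P f q \<Longrightarrow> q = f" by blast
  then have "linear f"
    by (intro minimal_sublin_linear) (auto simp: A_def P_def intro: order_trans)
  then show thesis using f(1) by (intro that) (auto simp: A_def)
qed

lemma sublin_norm: "sublin norm"
  by (auto simp: sublin_def norm_triangle_ineq)

text \<open>Domination by \<open>lower norm w\<close> instead of the norm pins down the value at
  \<open>w\<close>: at \<open>- w\<close>, with parameter 1, it is at most
  \<open>norm (- w + w) - norm w\<close>, so \<open>f w \<ge> norm w\<close>.\<close>

lemma norming_functional:
  fixes w :: "'a::real_normed_vector"
  obtains f where "bounded_linear f" "\<And>x. \<bar>f x\<bar> \<le> norm x" "f w = norm w"
proof -
  obtain f where f: "linear f" "\<And>x. f x \<le> lower norm w x"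
    using exists_linear_below_sublin[OF sublin_lower[OF sublin_norm]] by blast
  have le: "f x \<le> norm x" for x using f(2)[of x] lower_le[OF sublin_norm, of 0 w x] by simp
  have abs: "\<bar>f x\<bar> \<le> norm x" for x
    using le[of x] le[of "- x"] linear_neg[OF f(1), of x] by (auto simp: abs_le_iff)
  have "f (- w) \<le> - norm w" using f(2)[of "- w"] lower_le[OF sublin_norm, of 1 w "- w"] by simp
  then have "f w = norm w" using le[of w] linear_neg[OF f(1), of w] by simp
  moreover have "bounded_linear f"
    using abs by (intro bounded_linear_intro[of _ 1]) (auto simp: linear_add[OF f(1)] linear_scale[OF f(1)])
  ultimately show thesis using abs that by blast
qed

section \<open>Bounded systems that are biorthogonal for nearby indices\<close>

lemma kernels_infinite_dimensional:
  fixes \<Phi> :: "('a::real_vector \<Rightarrow> real) set"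
  assumes "finite \<Phi>" "\<And>\<phi>. \<phi> \<in> \<Phi> \<Longrightarrow> linear \<phi>" "infinite_dimensional TYPE('a)"
  shows "\<not> (\<exists>B. finite B \<and> {x. \<forall>\<phi>\<in>\<Phi>. \<phi> x = 0} \<subseteq> span B)"
  using assms(1,2)
proof (induction \<Phi>)
  case empty
  show ?case using assms(3) unfolding infinite_dimensional_def by auto
next
  case (insert f \<Phi>)
  let ?Y = "{x. \<forall>\<phi>\<in>\<Phi>. \<phi> x = 0}"
  have IH: "\<not> (\<exists>B. finite B \<and> ?Y \<subseteq> span B)" using insert by simp
  show ?case
  proof
    assume "\<exists>B. finite B \<and> {x. \<forall>\<phi>\<in>insert f \<Phi>. \<phi> x = 0} \<subseteq> span B"
    then obtain B where B: "finite B" "\<And>x. x \<in> ?Y \<Longrightarrow> f x = 0 \<Longrightarrow> x \<in> span B" by auto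
    show False
    proof (cases "\<forall>x\<in>?Y. f x = 0")
      case True
      then show False using B IH by blast
    next
      case False
      then obtain y where y: "y \<in> ?Y" "f y \<noteq> 0" by blast
      \<comment> \<open>One more functional cuts off at most one dimension: a vector minus a
        suitable multiple of \<open>y\<close> lies in the kernel of \<open>f\<close>.\<close>
      have "?Y \<subseteq> span (insert y B)"
      proof
        fix x assume x: "x \<in> ?Y"
        have "x - (f x / f y) *\<^sub>R y \<in> span B"
          using x y insert.prems
          by (intro B(2)) (auto simp: linear_diff linear_scale)
        then show "x \<in> span (insert y B)" unfolding span_insert by blast
      qed
      then show False using IH B(1) by blast
    qed
  qed
qed

lemma unit_vector_in_kernels:
  fixes \<Phi> :: "('a::real_normed_vector \<Rightarrow> real) set"
  assumes "finite \<Phi>" "\<And>\<phi>. \<phi> \<in> \<Phi> \<Longrightarrow> bounded_linear \<phi>" "infinite_dimensional TYPE('a)"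
  obtains w where "norm w = 1" "\<And>\<phi>. \<phi> \<in> \<Phi> \<Longrightarrow> \<phi> w = 0"
proof -
  have "\<not> {x::'a. \<forall>\<phi>\<in>\<Phi>. \<phi> x = (0::real)} \<subseteq> span {}"
    using kernels_infinite_dimensional[OF assms(1) bounded_linear.linear[OF assms(2)] assms(3)] by blast
  then obtain y :: 'a where y: "y \<noteq> 0" "\<And>\<phi>. \<phi> \<in> \<Phi> \<Longrightarrow> \<phi> y = 0" by auto
  show thesis
  proof (rule that[of "inverse (norm y) *\<^sub>R y"])
    show "\<phi> (inverse (norm y) *\<^sub>R y) = 0" if "\<phi> \<in> \<Phi>" for \<phi>
      using that y(2) linear_scale[OF bounded_linear.linear[OF assms(2)], of \<phi> "inverse (norm y)" y] by simp
  qed (use y in auto)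
qed

text \<open>Each \<open>w n\<close> is taken in the kernels of all earlier functionals, and
  \<open>g n\<close> is norming for it. This is one half of biorthogonality; for
  \<open>i > n\<close> only \<open>\<bar>g i (w n)\<bar> \<le> 1\<close> is available.\<close>

lemma triangular_system:
  assumes "infinite_dimensional TYPE('a::real_normed_vector)"
  obtains w :: "nat \<Rightarrow> 'a::real_normed_vector" and g :: "nat \<Rightarrow> 'a \<Rightarrow> real"
  where "\<And>n. norm (w n) = 1" "\<And>n. bounded_linear (g n)" "\<And>n x. \<bar>g n x\<bar> \<le> norm x"
    "\<And>n. g n (w n) = 1" "\<And>i n. i < n \<Longrightarrow> g i (w n) = 0"
proof -
  define P :: "(nat \<Rightarrow> 'a \<times> ('a \<Rightarrow> real)) \<Rightarrow> nat \<Rightarrow> 'a \<times> ('a \<Rightarrow> real) \<Rightarrow> bool" where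
    "P F n r \<longleftrightarrow> norm (fst r) = 1 \<and> bounded_linear (snd r) \<and> (\<forall>x. \<bar>snd r x\<bar> \<le> norm x) \<and>
       snd r (fst r) = 1 \<and> (\<forall>i<n. snd (F i) (fst r) = 0)" for F n r
  have "\<exists>F. \<forall>n. P F n (F n)"
  proof (rule dependent_wf_choice)
    show "wf {(i::nat, j). i < j}" by (rule wf)
    show "P F n r = P G n r" if "\<And>z. (z, n) \<in> {(i, j). i < j} \<Longrightarrow> F z = G z" for F G n r
      using that by (simp add: P_def)
    show "\<exists>r. P F n r" if F: "\<And>y. (y, n) \<in> {(i, j). i < j} \<Longrightarrow> P F y (F y)" for F n
    proof -
      have fin: "finite ((\<lambda>i. snd (F i)) ` {..<n})" by simp
      obtain w :: 'a where w: "norm w = 1" "\<And>\<phi>. \<phi> \<in> (\<lambda>i. snd (F i)) ` {..<n} \<Longrightarrow> \<phi> w = 0"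
        using unit_vector_in_kernels[OF fin _ assms] F by (auto simp: P_def)
      obtain f where "bounded_linear f" "\<And>x. \<bar>f x\<bar> \<le> norm x" "f w = norm w"
        using norming_functional by blast
      then have "P F n (w, f)" using w by (auto simp: P_def)
      then show ?thesis by blast
    qed
  qed
  then obtain F where F: "\<And>n. P F n (F n)" by blast
  show thesis by (rule that[of "\<lambda>n. fst (F n)" "\<lambda>n. snd (F n)"]) (use F in \<open>auto simp: P_def\<close>)
qed


text \<open>Correcting each functional by its two predecessors makes the system biorthogonal as far as
  indices at distance at most two are concerned, with a uniform bound.\<close>
lemma near_biorthogonal_system:
  assumes "infinite_dimensional TYPE('a::real_normed_vector)"
  obtains e :: "'a::real_normed_vector" and u a \<psi>
  where "norm e = 1" "\<And>n::nat. norm (a n) = 1" "bounded_linear u" "\<And>n. bounded_linear (\<psi> n)"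
    "\<And>x. \<bar>u x\<bar> \<le> norm x" "\<And>n x. \<bar>\<psi> n x\<bar> \<le> 8 * norm x"
    "u e = (1::real)" "\<And>n. u (a n) = 0" "\<And>n. \<psi> n e = (0::real)"
    "\<And>n j. n \<le> j + 2 \<Longrightarrow> \<psi> n (a j) = (if n = j then 1 else 0)"
proof -
  obtain w :: "nat \<Rightarrow> 'a" and g where w: "\<And>n. norm (w n) = 1" "\<And>n. bounded_linear (g n)"
    "\<And>n x. \<bar>g n x\<bar> \<le> norm x" "\<And>n. g n (w n) = 1" "\<And>i n. i < n \<Longrightarrow> g i (w n) = 0"
    using triangular_system[OF assms] by blast
  \<comment> \<open>\<open>\<beta>\<close>, \<open>\<gamma>\<close> and \<open>\<alpha>\<close> are
    determined successively by requiring that \<open>\<psi> n\<close> vanish at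
    \<open>w (n + 2)\<close>, \<open>w (n + 1)\<close> and \<open>w 0\<close>. Their bounds 1, 2 and
    4 add up, with the leading coefficient 1, to the norm bound 8. The vector \<open>w 0\<close>
    becomes \<open>e\<close>, which shifts the indices of the \<open>a n\<close> by 3.\<close>
  define \<beta> where "\<beta> n = - g (n + 3) (w (n + 2))" for n
  define \<gamma> where "\<gamma> n = - (g (n + 3) (w (n + 1)) + \<beta> n * g (n + 2) (w (n + 1)))" for n
  define \<alpha> where "\<alpha> n = - (g (n + 3) (w 0) + \<beta> n * g (n + 2) (w 0) + \<gamma> n * g (n + 1) (w 0))" for n
  define \<psi> where "\<psi> n x = g (n + 3) x + \<beta> n * g (n + 2) x + \<gamma> n * g (n + 1) x + \<alpha> n * g 0 x" for n x
  have gw: "\<bar>g i (w n)\<bar> \<le> 1" for i n using w(3)[of i "w n"] w(1) by simp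
  have mb: "\<bar>c * t\<bar> \<le> C * T" if "\<bar>c\<bar> \<le> C" "\<bar>t\<bar> \<le> T" for c t C T :: real
    unfolding abs_mult using that by (intro mult_mono) auto
  have \<beta>: "\<bar>\<beta> n\<bar> \<le> 1" for n using gw by (simp add: \<beta>_def)
  have \<gamma>: "\<bar>\<gamma> n\<bar> \<le> 2" for n
    using gw[of "n+3" "n+1"] mb[OF \<beta>[of n] gw[of "n+2" "n+1"]] unfolding \<gamma>_def by linarith
  have \<alpha>: "\<bar>\<alpha> n\<bar> \<le> 4" for n
    using gw[of "n+3" 0] mb[OF \<beta>[of n] gw[of "n+2" 0]] mb[OF \<gamma>[of n] gw[of "n+1" 0]] unfolding \<alpha>_def by linarith
  show thesis
  proof (rule that[of "w 0" "\<lambda>n. w (n + 3)" "g 0" \<psi>])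
    show "bounded_linear (\<psi> n)" for n
      unfolding \<psi>_def by (intro bounded_linear_add bounded_linear_mult_const bounded_linear_const_mult w)
    show "\<bar>\<psi> n x\<bar> \<le> 8 * norm x" for n x
      using w(3)[of "n+3" x] mb[OF \<beta>[of n] w(3)[of "n+2" x]] mb[OF \<gamma>[of n] w(3)[of "n+1" x]]
        mb[OF \<alpha>[of n] w(3)[of 0 x]] unfolding \<psi>_def by linarith
    show "\<psi> n (w 0) = 0" for n by (simp add: \<psi>_def \<alpha>_def w(4))
    show "\<psi> n (w (j + 3)) = (if n = j then 1 else 0)" if nj: "n \<le> j + 2" for n j
    proof -
      consider "n = j" | "n = j + 1" | "n = j + 2" | "n < j" using nj by linarith
      then show ?thesis
      proof cases
        case 2
        then have "w (j + 3) = w (n + 2)" by (simp add: eval_nat_numeral)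
        then show ?thesis using 2 by (simp add: \<psi>_def w(4,5) \<beta>_def)
      next
        case 3
        then have "w (j + 3) = w (n + 1)" by (simp add: eval_nat_numeral)
        then show ?thesis using 3 w(4)[of "n+1"] w(5)[of 0 "n+1"] by (simp add: \<psi>_def \<gamma>_def)
      qed (auto simp: \<psi>_def w(4,5))
    qed
  qed (use w in auto)
qed

section \<open>The tube\<close>

text \<open>\<open>c0\<close> is the cross-section and \<open>\<gamma>\<close> its height on the
  central line. The radius 1/80 is 1/10 divided by the norm bound 8 of the
  \<open>\<psi> n\<close>.\<close>

locale tube =
  fixes e :: "'a::real_normed_vector" and a :: "nat \<Rightarrow> 'a" and u :: "'a \<Rightarrow> real" and \<psi> :: "nat \<Rightarrow> 'a \<Rightarrow> real"
    and c0 :: "'a \<Rightarrow> real" and \<gamma> :: real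
  assumes norm_e: "norm e = 1" and norm_a: "norm (a n) = 1"
    and lin_u: "bounded_linear u" and lin_\<psi>: "bounded_linear (\<psi> n)"
    and u_le: "\<bar>u x\<bar> \<le> norm x" and \<psi>_le: "\<bar>\<psi> n x\<bar> \<le> 8 * norm x"
    and u_e: "u e = 1" and u_a: "u (a n) = 0" and \<psi>_e: "\<psi> n e = 0"
    and \<psi>_a: "n \<le> j + 2 \<Longrightarrow> \<psi> n (a j) = (if n = j then 1 else 0)"
    and c0_supp: "c0 y \<noteq> 0 \<Longrightarrow> norm y \<le> 1/80"
    and c0_range: "0 \<le> c0 y" "c0 y \<le> 1" and c0_0: "c0 0 = \<gamma>" and \<gamma>_pos: "\<gamma> > 0"
begin

text \<open>The tube runs through the points \<open>a 0, a 0 + a 1, a 1, a 1 + a 2, \<dots>\<close> of the hyperplane \<open>u = 0\<close>,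
  crossing it in the direction \<open>e\<close> at the even ones and \<open>-e\<close> at the odd ones. The \<open>n\<close>-th cell
  is the U-turn from the \<open>n\<close>-th to the \<open>(n + 1)\<close>-st of these points: the coordinate \<open>\<psi> (mi n)\<close> stays at \<open>1\<close>,
  the coordinate \<open>\<psi> (ki n)\<close> changes from \<open>0\<close> to \<open>1\<close> (\<open>n\<close> even) or from \<open>1\<close> to \<open>0\<close> (\<open>n\<close> odd), and
  \<open>tc n\<close> goes from \<open>0\<close> to \<open>1\<close>.\<close>

definition mi :: "nat \<Rightarrow> nat" where "mi n = (n + 1) div 2"
definition ki :: "nat \<Rightarrow> nat" where "ki n = (if even n then n div 2 + 1 else n div 2)"
definition sg :: "nat \<Rightarrow> real" where "sg n = (if even n then 1 else -1)"
definition vc :: "nat \<Rightarrow> 'a \<Rightarrow> real" where "vc n x = sg n * u x"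
definition tc :: "nat \<Rightarrow> 'a \<Rightarrow> real" where "tc n x = (if even n then 0 else 1) + sg n * \<psi> (ki n) x"

text \<open>\<open>Q n\<close> straightens the cell: it maps each flow line of the tube to a point.\<close>
definition Q :: "nat \<Rightarrow> 'a \<Rightarrow> 'a" where
  "Q n x = x - u x *\<^sub>R e + (1 - 2 * \<psi> (mi n) x) *\<^sub>R a (mi n)
     + (tau (tc n x) - step (vc n x - 1/4) - \<psi> (ki n) x) *\<^sub>R a (ki n)"

text \<open>The time along the flow: \<open>3 n - 4 + v\<close> on the way out, \<open>3 (n + 1) - 4 - v\<close> on the way back.\<close>
definition tm :: "nat \<Rightarrow> 'a \<Rightarrow> real" where
  "tm n x = 3 * real n - 4 + vc n x + hstep (tc n x) * (3 - 2 * vc n x)"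

definition W :: "nat \<Rightarrow> 'a \<Rightarrow> real" where
  "W n x = c0 (Q n x) - \<gamma> / 2 - exp (- tm n x)"

section \<open>Coordinates of the points of a cell\<close>

lemma sg_sq [simp]: "sg n * sg n = 1" "sg n * (sg n * r) = r" "\<bar>sg n\<bar> = 1"
  by (auto simp: sg_def)

lemma mi_ki: "mi n \<noteq> ki n" "n div 2 \<le> mi n" "n div 2 \<le> ki n" "mi n \<le> n div 2 + 1" "ki n \<le> n div 2 + 1"
  by (auto simp: mi_def ki_def elim!: evenE oddE)

lemmas lin = linear_add[OF bounded_linear.linear] linear_diff[OF bounded_linear.linear]
  linear_scale[OF bounded_linear.linear]

lemma \<psi>_ae:
  "\<psi> (mi n) (a (ki n)) = 0" "\<psi> (ki n) (a (ki n)) = 1" "\<psi> (mi n) (a (mi n)) = 1" "\<psi> (ki n) (a (mi n)) = 0"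
  using mi_ki[of n] by (auto simp: \<psi>_a)

text \<open>For \<open>i \<le> n div 2 + 2\<close> the values of \<open>\<psi> i\<close> on the two
  vectors \<open>a (mi n)\<close> and \<open>a (ki n)\<close> are known, so only two of these
  coordinates are changed by \<open>Q n\<close>.\<close>

lemma \<psi>_Q:
  assumes "i \<le> n div 2 + 2"
  shows "\<psi> i (Q n x) = (if i = mi n then 1 - \<psi> (mi n) x
     else if i = ki n then tau (tc n x) - step (vc n x - 1/4) else \<psi> i x)"
proof -
  have "i \<le> mi n + 2" "i \<le> ki n + 2" using assms mi_ki[of n] by linarith+
  then show ?thesis using mi_ki(1)[of n]
    by (auto simp: Q_def lin[OF lin_\<psi>] \<psi>_e \<psi>_a)
qed

lemma in_cell_\<psi>:
  assumes "c0 (Q n x) \<noteq> 0" shows "\<bar>\<psi> i (Q n x)\<bar> \<le> 1/10"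
  using \<psi>_le[of i "Q n x"] c0_supp[OF assms] by linarith

lemma in_cell_other:
  assumes "c0 (Q n x) \<noteq> 0" "i \<le> n div 2 + 2" "i \<noteq> mi n" "i \<noteq> ki n" shows "\<bar>\<psi> i x\<bar> \<le> 1/10"
  using in_cell_\<psi>[OF assms(1), of i] assms(3,4) by (simp add: \<psi>_Q[OF assms(2)])

lemma in_cell_mi: "c0 (Q n x) \<noteq> 0 \<Longrightarrow> \<bar>1 - \<psi> (mi n) x\<bar> \<le> 1/10"
  using in_cell_\<psi>[of n x "mi n"] mi_ki[of n] by (simp add: \<psi>_Q)

lemma in_cell_tau: "c0 (Q n x) \<noteq> 0 \<Longrightarrow> \<bar>tau (tc n x) - step (vc n x - 1/4)\<bar> \<le> 1/10"
  using in_cell_\<psi>[of n x "ki n"] mi_ki[of n] by (simp add: \<psi>_Q)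

text \<open>Outside [0, 1] the profile is \<open>t\<close> or \<open>1 - t\<close> and hence
  negative, while \<open>step\<close> is nonnegative; a difference of at most 1/10 leaves no more
  room.\<close>

lemma in_cell_tc:
  assumes "c0 (Q n x) \<noteq> 0" shows "-1/10 \<le> tc n x" "tc n x \<le> 11/10"
  using in_cell_tau[OF assms] step_range[of "vc n x - 1/4"] tau_left[of "tc n x"] tau_right[of "tc n x"]
  by (auto simp: abs_le_iff not_le intro: ccontr)

text \<open>The turn happens before \<open>v = 5/4\<close>: there \<open>step\<close> has reached 1,
  but \<open>tau\<close> is at most 3/4.\<close>

lemma in_cell_vc:
  assumes "c0 (Q n x) \<noteq> 0" shows "vc n x < 5/4"
proof (rule ccontr)
  assume "\<not> vc n x < 5/4"
  then have "step (vc n x - 1/4) = 1" by (intro step_1) simp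
  then show False using in_cell_tau[OF assms] tau_le[of "tc n x"] by simp
qed

text \<open>Below \<open>v = 1/4\<close> the step is 0, and \<open>tau\<close> is at most 1/10 only
  near the two ends of the profile. The cell consists there of two separate straight legs.\<close>

lemma in_cell_flat:
  assumes "c0 (Q n x) \<noteq> 0" "vc n x \<le> 1/4"
  shows "tc n x \<le> 1/10 \<or> 9/10 \<le> tc n x"
proof -
  have "step (vc n x - 1/4) = 0" using assms(2) by (intro step_0) simp
  then have "\<bar>tau (tc n x)\<bar> \<le> 1/10" using in_cell_tau[OF assms(1)] by simp
  note b = this
  consider "tc n x \<le> 1/4" | "3/4 \<le> tc n x" | "1/4 \<le> tc n x" "tc n x \<le> 3/4" by linarith
  then show ?thesis
  proof cases
    case 1 then show ?thesis using b unfolding tau_left[OF 1] by linarith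
  next
    case 2 then show ?thesis using b unfolding tau_right[OF 2] by linarith
  next
    case 3 then show ?thesis using b tau_mid(1)[OF 3] by linarith
  qed
qed

section \<open>Transition between consecutive cells, separation, boundedness\<close>

lemma flat_start:
  assumes "vc n x \<le> 1/4" "tc n x \<le> 1/4"
  shows "Q n x = x - u x *\<^sub>R e + (1 - 2 * \<psi> (mi n) x) *\<^sub>R a (mi n) + (tc n x - \<psi> (ki n) x) *\<^sub>R a (ki n)"
    and "tm n x = 3 * real n - 4 + vc n x"
  using assms by (auto simp: Q_def tm_def step_0 tau_left hstep_0)

lemma flat_end:
  assumes "vc n x \<le> 1/4" "3/4 \<le> tc n x"
  shows "Q n x = x - u x *\<^sub>R e + (1 - 2 * \<psi> (mi n) x) *\<^sub>R a (mi n) + (1 - tc n x - \<psi> (ki n) x) *\<^sub>R a (ki n)"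
    and "tm n x = 3 * real (Suc n) - 4 - vc n x"
  using assms by (auto simp: Q_def tm_def step_0 tau_right hstep_1)

text \<open>For even \<open>n\<close> the indices \<open>mi\<close> and \<open>ki\<close> exchange
  roles, and the reflected coordinate \<open>1 - \<psi> (mi n)\<close> in \<open>Q\<close> is what
  makes the two formulas coincide. For odd \<open>n\<close> the switching coordinate cancels on both
  sides. The times agree since \<open>vc\<close> changes sign.\<close>

lemma flat_glue:
  assumes "\<bar>u x\<bar> \<le> 1/4" "3/4 \<le> tc n x" "tc (Suc n) x \<le> 1/4"
  shows "Q (Suc n) x = Q n x" "W (Suc n) x = W n x"
proof -
  have v: "vc n x \<le> 1/4" "vc (Suc n) x \<le> 1/4" "vc (Suc n) x = - vc n x" using assms(1) by (auto simp: vc_def sg_def)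
  note s = flat_start[OF v(2) assms(3)] and e = flat_end[OF v(1) assms(2)]
  show q: "Q (Suc n) x = Q n x"
  proof (cases "even n")
    case True
    then have "mi (Suc n) = ki n" "ki (Suc n) = mi n" by (auto simp: mi_def ki_def elim!: evenE)
    then show ?thesis using True unfolding s(1) e(1) by (simp add: tc_def sg_def algebra_simps)
  next
    case False
    then have "mi (Suc n) = mi n" by (auto simp: mi_def elim!: oddE)
    then show ?thesis using False unfolding s(1) e(1) by (simp add: tc_def sg_def)
  qed
  show "W (Suc n) x = W n x" unfolding W_def q s(2) e(2) v(3) by simp
qed

text \<open>For even \<open>n\<close> the coordinate that switches next is the one held near 1 now,
  and \<open>tc\<close> reverses it. For odd \<open>n\<close> it is the new one with index
  \<open>j + 2\<close>, near 0; this is the largest index under control.\<close>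

lemma glue_next:
  assumes "c0 (Q n x) \<noteq> 0" "\<bar>u x\<bar> \<le> 1/4" "9/10 \<le> tc n x"
  shows "W (Suc n) x = W n x"
proof (intro flat_glue(2) assms(2))
  show "3/4 \<le> tc n x" using assms(3) by simp
  show "tc (Suc n) x \<le> 1/4"
  proof (cases "even n")
    case True
    then have "mi n = ki (Suc n)" by (auto simp: mi_def ki_def)
    then have "tc (Suc n) x = 1 - \<psi> (mi n) x" using True by (simp add: tc_def sg_def)
    then show ?thesis using in_cell_mi[OF assms(1)] by linarith
  next
    case False
    then obtain j where j: "n = 2 * j + 1" by (auto elim: oddE)
    have "\<bar>\<psi> (j + 2) x\<bar> \<le> 1/10" by (rule in_cell_other[OF assms(1)]) (auto simp: j mi_def ki_def)
    then show ?thesis by (simp add: j tc_def sg_def ki_def)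
  qed
qed

lemma glue_prev:
  assumes "c0 (Q (Suc n) x) \<noteq> 0" "\<bar>u x\<bar> \<le> 1/4" "tc (Suc n) x \<le> 1/10"
  shows "W n x = W (Suc n) x"
proof (rule flat_glue(2)[symmetric, OF assms(2)])
  show "tc (Suc n) x \<le> 1/4" using assms(3) by simp
  show "3/4 \<le> tc n x"
  proof (cases "even n")
    case True
    then have "mi (Suc n) = ki n" by (auto simp: mi_def ki_def)
    then have "tc n x = \<psi> (mi (Suc n)) x" using True by (simp add: tc_def sg_def)
    then show ?thesis using in_cell_mi[OF assms(1)] by linarith
  next
    case False
    then obtain j where j: "n = 2 * j + 1" by (auto elim: oddE)
    have "\<bar>\<psi> j x\<bar> \<le> 1/10" by (rule in_cell_other[OF assms(1)]) (auto simp: j mi_def ki_def)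
    then show ?thesis by (simp add: j tc_def sg_def ki_def abs_le_iff)
  qed
qed

text \<open>Some known coordinate is within 1/10 of 1 in one cell and within 1/10 of 0 in the other.
  The gap 8/10 divided by the norm bound 8 is the distance 1/10.\<close>

lemma separated:
  assumes "c0 (Q n x) \<noteq> 0" "c0 (Q n' y) \<noteq> 0" "n < n'" "even n = even n'"
  shows "1/10 \<le> norm (x - y)"
proof -
  have "\<exists>i. 8/10 \<le> \<bar>\<psi> i x - \<psi> i y\<bar>"
  proof (cases "even n")
    case True
    then obtain j j' where j: "n = 2 * j" "n' = 2 * j'" using assms(4) by (auto elim!: evenE)
    have "\<bar>1 - \<psi> j x\<bar> \<le> 1/10" using in_cell_mi[OF assms(1)] by (simp add: j mi_def)
    moreover have "\<bar>\<psi> j y\<bar> \<le> 1/10"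
      by (rule in_cell_other[OF assms(2)]) (use assms(3) in \<open>auto simp: j mi_def ki_def\<close>)
    ultimately show ?thesis by (intro exI[of _ j]) linarith
  next
    case False
    then obtain j j' where j: "n = 2 * j + 1" "n' = 2 * j' + 1" using assms(4) by (auto elim!: oddE)
    show ?thesis
    \<comment> \<open>If \<open>j' = j + 1\<close>, the coordinate held at 1 in the first cell is
      the switching one in the second and cannot separate them; the coordinate \<open>j + 2\<close>,
      held at 1 in the second cell, does.\<close>
    proof (cases "j' = j + 1")
      case True
      have "\<bar>1 - \<psi> (j + 2) y\<bar> \<le> 1/10" using in_cell_mi[OF assms(2)] by (simp add: j True mi_def)
      moreover have "\<bar>\<psi> (j + 2) x\<bar> \<le> 1/10"
        by (rule in_cell_other[OF assms(1)]) (auto simp: j mi_def ki_def)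
      ultimately show ?thesis by (intro exI[of _ "j + 2"]) linarith
    next
      case False
      have "\<bar>1 - \<psi> (j + 1) x\<bar> \<le> 1/10" using in_cell_mi[OF assms(1)] by (simp add: j mi_def)
      moreover have "\<bar>\<psi> (j + 1) y\<bar> \<le> 1/10"
        by (rule in_cell_other[OF assms(2)]) (use assms(3) False in \<open>auto simp: j mi_def ki_def\<close>)
      ultimately show ?thesis by (intro exI[of _ "j + 1"]) linarith
    qed
  qed
  then obtain i where "8/10 \<le> \<bar>\<psi> i (x - y)\<bar>" by (auto simp: lin[OF lin_\<psi>])
  then show ?thesis using \<psi>_le[of i "x - y"] by linarith
qed

lemma in_cell_norm:
  assumes "c0 (Q n x) \<noteq> 0" "-1/4 < vc n x" shows "norm x \<le> 5"
proof -
  have "\<bar>u x\<bar> = \<bar>vc n x\<bar>" by (simp add: vc_def abs_mult)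
  then have u: "\<bar>u x\<bar> \<le> 5/4" using in_cell_vc[OF assms(1)] assms(2) by simp
  have m: "\<bar>1 - 2 * \<psi> (mi n) x\<bar> \<le> 12/10" using in_cell_mi[OF assms(1)] by linarith
  have "-1/10 \<le> \<psi> (ki n) x \<and> \<psi> (ki n) x \<le> 11/10"
    using in_cell_tc[OF assms(1)] by (auto simp: tc_def sg_def split: if_splits)
  then have k: "\<bar>tau (tc n x) - step (vc n x - 1/4) - \<psi> (ki n) x\<bar> \<le> 12/10"
    using in_cell_tau[OF assms(1)] by linarith
  have tri: "norm (p + q - r - s) \<le> norm p + norm q + norm r + norm s" for p q r s :: 'a
    using norm_triangle_ineq4[of "p + q - r" s] norm_triangle_ineq4[of "p + q" r] norm_triangle_ineq[of p q] by linarith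
  have "norm x = norm (Q n x + u x *\<^sub>R e - (1 - 2 * \<psi> (mi n) x) *\<^sub>R a (mi n)
     - (tau (tc n x) - step (vc n x - 1/4) - \<psi> (ki n) x) *\<^sub>R a (ki n))" by (simp add: Q_def)
  also have "\<dots> \<le> norm (Q n x) + norm (u x *\<^sub>R e) + norm ((1 - 2 * \<psi> (mi n) x) *\<^sub>R a (mi n))
     + norm ((tau (tc n x) - step (vc n x - 1/4) - \<psi> (ki n) x) *\<^sub>R a (ki n))" by (rule tri)
  also have "\<dots> \<le> 5" using u m k c0_supp[OF assms(1)] by (simp add: norm_e norm_a)
  finally show ?thesis .
qed

lemma W_nonneg_in_cell: "0 \<le> W n x \<Longrightarrow> c0 (Q n x) \<noteq> 0"
  using \<gamma>_pos exp_gt_zero[of "- tm n x"] unfolding W_def by linarith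

lemma W_nonneg_exp: "0 \<le> W n x \<Longrightarrow> exp (- tm n x) \<le> 1"
  using \<gamma>_pos c0_range(2)[of "Q n x"] unfolding W_def by linarith

text \<open>The offset 4 in the time exceeds 13/4, which bounds \<open>v\<close> and
  \<open>3 - v\<close> here; so the time is negative and the threshold above 1. As a consequence
  cell 0 is never active and every active cell has a predecessor.\<close>

lemma W_0_neg:
  assumes "-1/4 < vc 0 x" shows "W 0 x < 0"
proof (rule ccontr)
  assume "\<not> W 0 x < 0"
  then have c: "c0 (Q 0 x) \<noteq> 0" and "exp (- tm 0 x) \<le> 1" using W_nonneg_in_cell W_nonneg_exp by auto
  then have "tm 0 x \<ge> 0" by simp
  moreover have "tm 0 x < 0"
  proof -
    let ?h = "hstep (tc 0 x)"
    have "tm 0 x = -4 + ((1 - ?h) * vc 0 x + ?h * (3 - vc 0 x))" by (simp add: tm_def algebra_simps)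
    also have "\<dots> \<le> -4 + ((1 - ?h) * (13/4) + ?h * (13/4))"
      using assms in_cell_vc[OF c] hstep_range[of "tc 0 x"] by (intro add_left_mono add_mono mult_left_mono) auto
    finally show ?thesis by argo
  qed
  ultimately show False by simp
qed

text \<open>At \<open>a j\<close>, the entry of cell \<open>2 * j\<close>, the cross-section has its
  central height \<open>\<gamma>\<close>, and for large \<open>j\<close> the exponential term is at
  most \<open>\<gamma> / 4\<close>.\<close>

lemma W_pos_exists: "\<exists>n x. 0 < W n x \<and> u x = 0"
proof -
  obtain j :: nat where j: "- ln (\<gamma> / 4) + 4 < real j" using reals_Archimedean2 by blast
  have i: "mi (2 * j) = j" "ki (2 * j) = j + 1" by (auto simp: mi_def ki_def)
  have z: "\<psi> (j + 1) (a j) = 0" "\<psi> j (a j) = 1" by (auto simp: \<psi>_a)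
  have "tc (2 * j) (a j) = 0" "vc (2 * j) (a j) = 0" by (auto simp: tc_def vc_def i z[simplified] u_a)
  then have "Q (2 * j) (a j) = 0" "tm (2 * j) (a j) = 6 * real j - 4"
    using flat_start[of "2 * j" "a j"] by (auto simp: i z[simplified] u_a)
  then have w: "W (2 * j) (a j) = \<gamma> / 2 - exp (- (6 * real j - 4))" by (simp add: W_def c0_0)
  have "exp (- (6 * real j - 4)) \<le> exp (ln (\<gamma> / 4))" using j by simp
  also have "\<dots> = \<gamma> / 4" using \<gamma>_pos by simp
  finally have "0 < W (2 * j) (a j)" using \<gamma>_pos w by simp
  then show ?thesis using u_a by blast
qed

text \<open>\<open>Q\<close> is a composition of shears along \<open>a (ki i)\<close>,
  \<open>a (mi i)\<close> and \<open>e\<close>, applied in this order. Each coefficient is unchanged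
  by the shears before it, because \<open>\<psi> (mi i)\<close> vanishes on \<open>a (ki i)\<close>
  and \<open>u\<close> on both vectors.\<close>

lemma CF_W:
  assumes "CF n 0 (\<lambda>x h. c0 x)" shows "CF n 0 (\<lambda>x h. W i x)"
proof -
  have u: "CF n 0 (\<lambda>x h. u x)" and p: "CF n 0 (\<lambda>x h. \<psi> j x)" for j
    using CF_bounded_linear lin_u lin_\<psi> by blast+
  have t: "CF n 0 (\<lambda>x h. tc i x)" unfolding tc_def by (intro CF_add CF_cmult CF_const p)
  have v: "CF n 0 (\<lambda>x h. vc i x)" unfolding vc_def by (intro CF_cmult u)
  have tm: "CF n 0 (\<lambda>x h. tm i x)" unfolding tm_def
    by (intro CF_add CF_mult CF_diff CF_cmult CF_const CF_hstep t v)
  let ?s = "\<lambda>x. tau (tc i x) - step (vc i x - 1/4) - \<psi> (ki i) x"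
  have s: "CF n 0 (\<lambda>x h. ?s x)" by (intro CF_diff CF_tau[OF t] CF_step[OF CF_diff[OF v CF_const]] p)
  define A where "A x = c0 (1 *\<^sub>R x + (- u x) *\<^sub>R e)" for x
  define B where "B x = A (1 *\<^sub>R x + (1 - 2 * \<psi> (mi i) x) *\<^sub>R a (mi i))" for x
  have A: "CF n 0 (\<lambda>x h. A x)" unfolding A_def
    using CF_shear[OF CF_cmult[OF u, of "-1"] assms, of 1 e] by simp
  have B: "CF n 0 (\<lambda>x h. B x)" unfolding B_def
    by (rule CF_shear[OF CF_diff[OF CF_const CF_cmult[OF p]] A])
  have C: "CF n 0 (\<lambda>x h. B (1 *\<^sub>R x + ?s x *\<^sub>R a (ki i)))" by (rule CF_shear[OF s B])
  have e: "B (1 *\<^sub>R x + ?s x *\<^sub>R a (ki i)) = c0 (Q i x)" for x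
  proof -
    have "\<psi> (mi i) (x + ?s x *\<^sub>R a (ki i)) = \<psi> (mi i) x" by (simp add: lin[OF lin_\<psi>] \<psi>_ae)
    then show ?thesis unfolding A_def B_def Q_def by (simp add: lin[OF lin_u] u_a algebra_simps)
  qed
  have "CF n 0 (\<lambda>x h. c0 (Q i x))" using C unfolding e .
  moreover have "CF n 0 (\<lambda>x h. exp ((-1) * tm i x))" by (intro CF_exp CF_cmult tm)
  ultimately show ?thesis unfolding W_def by (intro CF_diff CF_const) auto
qed

end

section \<open>The bump function\<close>

lemma lipschitz_has_derivative_bound:
  fixes f :: "'a::real_normed_vector \<Rightarrow> real"
  assumes L: "L-lipschitz_on UNIV f" and D: "(f has_derivative D) (at x)"
  shows "\<bar>D w\<bar> \<le> L * norm w"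
proof (cases "w = 0")
  case True
  then show ?thesis using linear_0[OF has_derivative_linear[OF D]] by simp
next
  case False
  have lin: "linear D" by (rule has_derivative_linear[OF D])
  have "((\<lambda>t. x + t *\<^sub>R w) has_derivative (\<lambda>t. t *\<^sub>R w)) (at 0)"
    by (auto intro!: derivative_eq_intros)
  from has_derivative_compose[OF this, of f D] D
  have "((\<lambda>t. f (x + t *\<^sub>R w)) has_derivative (\<lambda>t. D (t *\<^sub>R w))) (at 0)" by simp
  then have "((\<lambda>t. f (x + t *\<^sub>R w)) has_real_derivative D w) (at 0)"
    unfolding has_field_derivative_def by (simp add: linear_scale[OF lin] mult.commute[of _ "D w"])
  then have "(\<lambda>h. (f (x + h *\<^sub>R w) - f x) / h) \<midarrow>0\<rightarrow> D w" by (simp add: DERIV_def)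
  then have "(\<lambda>h. \<bar>(f (x + h *\<^sub>R w) - f x) / h\<bar>) \<midarrow>0\<rightarrow> \<bar>D w\<bar>" by (rule tendsto_rabs)
  moreover have "\<forall>\<^sub>F h in at 0. \<bar>(f (x + h *\<^sub>R w) - f x) / h\<bar> \<le> L * norm w"
  proof (rule eventually_at_filter[THEN iffD2], rule always_eventually, intro allI impI)
    fix h :: real assume h: "h \<noteq> 0"
    have "\<bar>f (x + h *\<^sub>R w) - f x\<bar> \<le> L * (\<bar>h\<bar> * norm w)"
      using lipschitz_onD[OF L, of "x + h *\<^sub>R w" x] by (simp add: dist_norm)
    then show "\<bar>(f (x + h *\<^sub>R w) - f x) / h\<bar> \<le> L * norm w" using h by (simp add: field_simps)
  qed
  ultimately show ?thesis by (intro tendsto_upperbound[of _ "\<bar>D w\<bar>" "at 0"]) auto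
qed

lemma bounded_derivative_lipschitz:
  fixes f :: "'a::real_normed_vector \<Rightarrow> real"
  assumes "\<And>x. \<exists>D. (f has_derivative D) (at x) \<and> (\<forall>w. \<bar>D w\<bar> \<le> L * norm w)" "0 \<le> L"
  shows "L-lipschitz_on UNIV f"
proof (rule lipschitz_onI)
  fix x y
  obtain D where D: "\<And>x. (f has_derivative D x) (at x)" "\<And>x w. \<bar>D x w\<bar> \<le> L * norm w" using assms(1) by metis
  have "norm (f x - f y) \<le> L * norm (x - y)"
  proof (rule differentiable_bound[of UNIV f D])
    show "onorm (D z) \<le> L" for z using assms(2) D(2) by (intro onorm_bound) auto
  qed (use D(1) in auto)
  then show "dist (f x) (f y) \<le> L * dist x y" by (simp add: dist_norm)
qed (rule assms)

context tube
begin

section \<open>The derivative of W along the flow and its norm\<close>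

definition Q' :: "nat \<Rightarrow> 'a \<Rightarrow> 'a \<Rightarrow> 'a" where
  "Q' n x w = w - u w *\<^sub>R e - (2 * \<psi> (mi n) w) *\<^sub>R a (mi n)
     + (tau' (tc n x) * (sg n * \<psi> (ki n) w) - step' (vc n x - 1/4) * (sg n * u w) - \<psi> (ki n) w) *\<^sub>R a (ki n)"

definition tm' :: "nat \<Rightarrow> 'a \<Rightarrow> 'a \<Rightarrow> real" where
  "tm' n x w = sg n * u w * (1 - 2 * hstep (tc n x)) + hstep' (tc n x) * (sg n * \<psi> (ki n) w) * (3 - 2 * vc n x)"

lemma tc_deriv: "(tc n has_derivative (\<lambda>w. sg n * \<psi> (ki n) w)) (at x)"
  unfolding tc_def by (rule derivative_eq_intros bounded_linear_imp_has_derivative bounded_linear_const_mult lin_\<psi> | simp)+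

lemma vc_deriv: "(vc n has_derivative (\<lambda>w. sg n * u w)) (at x)"
  unfolding vc_def by (intro bounded_linear_imp_has_derivative bounded_linear_const_mult lin_u)

lemma Q_deriv: "(Q n has_derivative Q' n x) (at x)"
proof -
  have t: "((\<lambda>x. tau (tc n x)) has_derivative (\<lambda>w. tau' (tc n x) * (sg n * \<psi> (ki n) w))) (at x)"
    by (rule has_derivative_compose[OF tc_deriv tau_deriv[unfolded has_field_derivative_def]])
  have v: "((\<lambda>x. vc n x - 1/4) has_derivative (\<lambda>w. sg n * u w)) (at x)"
    by (auto intro!: derivative_eq_intros vc_deriv)
  have s: "((\<lambda>x. step (vc n x - 1/4)) has_derivative (\<lambda>w. step' (vc n x - 1/4) * (sg n * u w))) (at x)"
    by (rule has_derivative_compose[OF v step_deriv[unfolded has_field_derivative_def]])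
  show ?thesis unfolding Q_def[abs_def] Q'_def[abs_def]
    by (auto intro!: derivative_eq_intros t s bounded_linear_imp_has_derivative[OF lin_u] bounded_linear_imp_has_derivative[OF lin_\<psi>]
        simp: algebra_simps)
qed

lemma tm_deriv: "(tm n has_derivative tm' n x) (at x)"
proof -
  have h: "((\<lambda>x. hstep (tc n x)) has_derivative (\<lambda>w. hstep' (tc n x) * (sg n * \<psi> (ki n) w))) (at x)"
    by (rule has_derivative_compose[OF tc_deriv hstep_deriv[unfolded has_field_derivative_def]])
  show ?thesis unfolding tm_def[abs_def] tm'_def[abs_def]
    by (auto intro!: derivative_eq_intros h vc_deriv simp: fun_eq_iff algebra_simps)
qed

lemma W_deriv:
  assumes "(c0 has_derivative D) (at (Q n x))"
  shows "(W n has_derivative (\<lambda>w. D (Q' n x w) + exp (- tm n x) * tm' n x w)) (at x)"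
  unfolding W_def[abs_def]
  by (auto intro!: derivative_eq_intros has_derivative_compose[OF Q_deriv assms] tm_deriv simp: algebra_simps)

text \<open>In the coordinates \<open>(vc, tc)\<close> this is the field
  \<open>(tau', step')\<close>, the Hamiltonian field of \<open>tau (tc) - step (vc - 1/4)\<close>.
  It therefore preserves that function, the only entry of \<open>Q\<close> it could change.\<close>

definition flow :: "nat \<Rightarrow> 'a \<Rightarrow> 'a" where
  "flow n x = (tau' (tc n x) * sg n) *\<^sub>R e + (step' (vc n x - 1/4) * sg n) *\<^sub>R a (ki n)"

lemma flow_coords:
  "u (flow n x) = tau' (tc n x) * sg n" "\<psi> (ki n) (flow n x) = step' (vc n x - 1/4) * sg n"
  "\<psi> (mi n) (flow n x) = 0"
  unfolding flow_def by (simp_all add: lin[OF lin_u] lin[OF lin_\<psi>] u_e u_a \<psi>_e \<psi>_ae)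

lemma Q'_flow: "Q' n x (flow n x) = 0"
  unfolding Q'_def flow_coords by (simp add: flow_def algebra_simps)

text \<open>The term \<open>tau' * (1 - 2 * hstep)\<close> is positive unless
  \<open>hstep = 1/2\<close>. There \<open>tau = 1/2\<close>, so \<open>step\<close> is within 1/10
  of 1/2, which makes \<open>step'\<close> and \<open>hstep'\<close> positive; their product carries
  the factor \<open>3 - 2 * vc\<close>, positive because \<open>vc < 5/4\<close>.\<close>

lemma tm'_flow_pos:
  assumes "c0 (Q n x) \<noteq> 0" shows "0 < tm' n x (flow n x)"
proof -
  let ?h = "hstep (tc n x)"
  have e: "tm' n x (flow n x) = tau' (tc n x) * (1 - 2 * ?h) + hstep' (tc n x) * step' (vc n x - 1/4) * (3 - 2 * vc n x)"
    unfolding tm'_def flow_coords by (simp add: mult_ac)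
  have v: "3 - 2 * vc n x > 0" using in_cell_vc[OF assms] by simp
  have nn: "hstep' (tc n x) * step' (vc n x - 1/4) * (3 - 2 * vc n x) \<ge> 0"
    using v by (intro mult_nonneg_nonneg hstep'_nonneg step'_nonneg) simp
  show ?thesis
  proof (cases "?h = 1/2")
    case True
    then have "\<bar>1/2 - step (vc n x - 1/4)\<bar> \<le> 1/10" using in_cell_tau[OF assms] by (simp only: tau_half)
    then have "0 < vc n x - 1/4 \<and> vc n x - 1/4 < 1"
      using step_0[of "vc n x - 1/4"] step_1[of "vc n x - 1/4"] by (cases "vc n x - 1/4 \<le> 0"; cases "1 \<le> vc n x - 1/4") auto
    then have "hstep' (tc n x) * step' (vc n x - 1/4) * (3 - 2 * vc n x) > 0"
      using v by (intro mult_pos_pos hstep'_half[OF True] step'_pos) auto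
    then show ?thesis unfolding e True by simp
  next
    case False
    then have "(1 - 2 * ?h)\<^sup>2 > 0" by simp
    then show ?thesis unfolding e using tau'_hstep[of "tc n x"] nn by linarith
  qed
qed

lemma W_deriv_flow_pos:
  assumes "0 \<le> W n x" "linear D" shows "0 < D (Q' n x (flow n x)) + exp (- tm n x) * tm' n x (flow n x)"
  unfolding Q'_flow linear_0[OF assms(2)] using tm'_flow_pos[OF W_nonneg_in_cell[OF assms(1)]] by simp

text \<open>The constants collect 1 + 1 + 16 + 8 + 8 = 34 and, for the coefficient of
  \<open>K0\<close>, 16 + 1 = 17. They do not depend on the cell, and a global Lipschitz constant
  comes from this.\<close>

lemma Q'_bound: "norm (Q' n x w) \<le> (34 + 17 * K0) * norm w"
proof -
  have k: "\<bar>\<psi> (ki n) w\<bar> \<le> 8 * norm w" and u: "\<bar>u w\<bar> \<le> norm w" by (rule \<psi>_le u_le)+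
  have "\<bar>tau' (tc n x) * (sg n * \<psi> (ki n) w)\<bar> \<le> (1 + 2 * K0) * (8 * norm w)"
    unfolding abs_mult sg_sq mult_1 using K0_pos by (intro mult_mono tau'_bound k) auto
  moreover have "\<bar>step' (vc n x - 1/4) * (sg n * u w)\<bar> \<le> K0 * norm w"
    unfolding abs_mult sg_sq mult_1 using K0_pos step'_nonneg[of "vc n x - 1/4"] step'_le[of "vc n x - 1/4"] by (intro mult_mono u) auto
  ultimately have "\<bar>tau' (tc n x) * (sg n * \<psi> (ki n) w) - step' (vc n x - 1/4) * (sg n * u w) - \<psi> (ki n) w\<bar>
      \<le> (1 + 2 * K0) * (8 * norm w) + K0 * norm w + 8 * norm w" using k by linarith
  moreover have "norm (Q' n x w) \<le> norm w + \<bar>u w\<bar> + \<bar>2 * \<psi> (mi n) w\<bar>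
     + \<bar>tau' (tc n x) * (sg n * \<psi> (ki n) w) - step' (vc n x - 1/4) * (sg n * u w) - \<psi> (ki n) w\<bar>"
  proof -
    have tri: "norm (p - q - r + s) \<le> norm p + norm q + norm r + norm s" for p q r s :: 'a
      using norm_triangle_ineq[of "p - q - r" s] norm_triangle_ineq4[of "p - q" r] norm_triangle_ineq4[of p q] by linarith
    show ?thesis unfolding Q'_def by (rule order_trans[OF tri]) (simp add: norm_e norm_a)
  qed
  moreover have "\<bar>2 * \<psi> (mi n) w\<bar> \<le> 16 * norm w" using \<psi>_le[of "mi n" w] by simp
  moreover have "(34 + 17 * K0) * norm w = norm w + norm w + 16 * norm w + ((1 + 2 * K0) * (8 * norm w) + K0 * norm w + 8 * norm w)"
    by (simp add: algebra_simps)
  ultimately show ?thesis using u by linarith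
qed

text \<open>In the cell -1/4 < v < 5/4, so \<open>3 - 2 * vc\<close> is at most 4 in absolute value;
  with the bounds \<open>2 * K0\<close> for \<open>hstep'\<close> and 8 for \<open>\<psi>\<close>
  this gives 64.\<close>

lemma tm'_bound:
  assumes "c0 (Q n x) \<noteq> 0" "-1/4 < vc n x" shows "\<bar>tm' n x w\<bar> \<le> (1 + 64 * K0) * norm w"
proof -
  have "\<bar>sg n * u w * (1 - 2 * hstep (tc n x))\<bar> \<le> norm w * 1"
    unfolding abs_mult sg_sq mult_1 using hstep_range[of "tc n x"] by (intro mult_mono u_le) (auto simp: abs_le_iff)
  moreover have "\<bar>hstep' (tc n x) * (sg n * \<psi> (ki n) w) * (3 - 2 * vc n x)\<bar> \<le> (2 * K0) * (8 * norm w) * 4"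
    unfolding abs_mult[of "sg n"] abs_mult[of "hstep' (tc n x)"] abs_mult[of _ "3 - 2 * vc n x"] sg_sq mult_1
    using in_cell_vc[OF assms(1)] assms(2) K0_pos
    by (intro mult_mono hstep'_bound \<psi>_le) (auto simp: abs_le_iff)
  ultimately show ?thesis unfolding tm'_def by (simp add: algebra_simps abs_le_iff)
qed

section \<open>Gluing the cells to one function\<close>

definition act :: "nat \<Rightarrow> 'a \<Rightarrow> bool" where
  "act n x \<longleftrightarrow> -1/4 < vc n x \<and> 0 < W n x"

text \<open>A cell counts only where \<open>vc > -1/4\<close>, since \<open>W n\<close> also
  describes the legs prolonged backwards beyond the neighbouring cells. The choice of the active
  cell turns out not to affect the value.\<close>

definition bmp :: "'a \<Rightarrow> real" where
  "bmp x = (if \<exists>n. act n x then eta (W (SOME n. act n x) x) else 0)"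

lemma act_in_cell: "act n x \<Longrightarrow> c0 (Q n x) \<noteq> 0"
  using W_nonneg_in_cell[of n x] by (simp add: act_def)

text \<open>In the slab an active cell is on one of its two legs, which it shares with its
  predecessor at the start and with its successor at the end.\<close>

lemma act_switch:
  assumes "act n x" "\<bar>u x\<bar> < 1/4"
  obtains n' where "even n' \<noteq> even n" "act n' x" "W n' x = W n x"
proof -
  have c: "c0 (Q n x) \<noteq> 0" by (rule act_in_cell[OF assms(1)])
  have v: "\<bar>vc m x\<bar> < 1/4" for m using assms(2) by (simp add: vc_def abs_mult)
  have v1: "vc n x \<le> 1/4" using v[of n] by linarith
  have v2: "-1/4 < vc m x" for m using v[of m] by linarith
  have u: "\<bar>u x\<bar> \<le> 1/4" using assms(2) by simp
  from in_cell_flat[OF c v1] consider "tc n x \<le> 1/10" | "9/10 \<le> tc n x" by blast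
  then show thesis
  proof cases
    case 1
    have "n \<noteq> 0" using assms(1) W_0_neg[OF v2[of 0]] unfolding act_def by (metis less_asym)
    then obtain m where m: "n = Suc m" by (cases n) auto
    have "W m x = W n x" using glue_prev[of m x] c u 1 by (simp add: m)
    then show thesis using assms(1) v2[of m] by (intro that[of m]) (auto simp: act_def m)
  next
    case 2
    have "W (Suc n) x = W n x" by (rule glue_next[OF c u 2])
    then show thesis using assms(1) v2[of "Suc n"] by (intro that[of "Suc n"]) (auto simp: act_def)
  qed
qed

lemma act_same_parity:
  assumes "act n x" "act n' y" "even n = even n'" "norm (x - y) < 1/10" shows "n = n'"
proof (rule ccontr)
  assume "n \<noteq> n'"
  then consider "n < n'" | "n' < n" by linarith
  then show False
  proof cases
    case 1
    then show False using separated[OF act_in_cell[OF assms(1)] act_in_cell[OF assms(2)]] assms(3,4) by simp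
  next
    case 2
    then show False using separated[OF act_in_cell[OF assms(2)] act_in_cell[OF assms(1)]] assms(3,4)
      by (simp add: norm_minus_commute)
  qed
qed

text \<open>Two active cells of equal parity coincide by separation. For opposite parity both
  conditions on \<open>vc\<close> place the point in the slab, and the neighbour found there must be
  the second cell.\<close>

lemma act_W_eq:
  assumes "act n x" "act n' x" shows "W n x = W n' x"
proof (cases "even n = even n'")
  case True
  then show ?thesis using act_same_parity[OF assms True] by simp
next
  case False
  then have "vc n' x = - vc n x" by (auto simp: vc_def sg_def)
  then have "\<bar>vc n x\<bar> < 1/4" using assms by (auto simp: act_def abs_less_iff)
  then have "\<bar>u x\<bar> < 1/4" by (simp add: vc_def abs_mult)
  then obtain m where m: "even m \<noteq> even n" "act m x" "W m x = W n x" using act_switch[OF assms(1)] by blast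
  then have "m = n'" using False by (intro act_same_parity[OF m(2) assms(2)]) auto
  then show ?thesis using m(3) by simp
qed

lemma bmp_act: "act n x \<Longrightarrow> bmp x = eta (W n x)"
  unfolding bmp_def using act_W_eq[OF someI[of "\<lambda>n. act n x"]] by auto

text \<open>In a ball of radius 1/20 points are less than 1/10 apart, so at most one cell of a given
  parity is active in it. The parity is chosen by the sign of \<open>u x\<close>, which keeps
  \<open>vc\<close> above -1/4 on the whole ball; this bound is recorded for the Lipschitz
  estimate.\<close>

lemma bmp_local:
  "\<exists>N. open N \<and> x \<in> N \<and> ((\<forall>y\<in>N. bmp y = 0) \<or> (\<exists>n. \<forall>y\<in>N. bmp y = eta (W n y) \<and> -1/4 < vc n y))"
proof -
  define P :: "nat \<Rightarrow> bool" where "P n \<longleftrightarrow> (even n \<longleftrightarrow> 0 \<le> u x)" for n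
  let ?N = "ball x (1/20)"
  have v: "-1/4 < vc n y" if "P n" "y \<in> ?N" for n y
  proof -
    have "\<bar>u (x - y)\<bar> \<le> 1/20" using u_le[of "x - y"] that(2) by (simp add: dist_norm)
    then have "\<bar>u x - u y\<bar> \<le> 1/20" by (simp add: lin[OF lin_u])
    note d = this
    show ?thesis
    proof (cases "even n")
      case True
      then have "0 \<le> u x" "vc n y = u y" using that(1) by (auto simp: P_def vc_def sg_def)
      then show ?thesis using d by linarith
    next
      case False
      then have "\<not> 0 \<le> u x" "vc n y = - u y" using that(1) by (auto simp: P_def vc_def sg_def)
      then show ?thesis using d by linarith
    qed
  qed
  have sw: "\<exists>m. P m \<and> act m y \<and> W m y = W n y" if an: "act n y" and yN: "y \<in> ?N" for n y
  proof (cases "P n")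
    case True then show ?thesis using an by blast
  next
    case False
    define m where "m = Suc n"
    have "P m" using False by (auto simp: P_def m_def)
    then have "-1/4 < vc m y" using v yN by blast
    then have "\<bar>vc n y\<bar> < 1/4" using an by (auto simp: m_def act_def vc_def sg_def abs_less_iff split: if_splits)
    then have "\<bar>u y\<bar> < 1/4" by (simp add: vc_def abs_mult)
    then obtain n' where "even n' \<noteq> even n" "act n' y" "W n' y = W n y" using act_switch[OF an] by blast
    then show ?thesis using False by (intro exI[of _ n']) (auto simp: P_def)
  qed
  have "(\<forall>y\<in>?N. bmp y = 0) \<or> (\<exists>n. \<forall>y\<in>?N. bmp y = eta (W n y) \<and> -1/4 < vc n y)"
  proof (cases "\<exists>n y. P n \<and> y \<in> ?N \<and> act n y")
    case False
    then have "\<not> act n y" if "y \<in> ?N" for n y using sw that by blast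
    then have "\<forall>y\<in>?N. bmp y = 0" by (auto simp: bmp_def)
    then show ?thesis by blast
  next
    case True
    then obtain n z where n: "P n" "z \<in> ?N" "act n z" by blast
    have "bmp y = eta (W n y)" if y: "y \<in> ?N" for y
    proof (cases "\<exists>n'. act n' y")
      case False
      then have "\<not> act n y" by blast
      then have "W n y \<le> 0" using v[OF n(1) y] by (simp add: act_def not_less)
      then show ?thesis using False by (auto simp: bmp_def)
    next
      case True
      then obtain m where m: "P m" "act m y" using sw y by blast
      have "dist z y < 1/20 + 1/20" using n(2) y dist_triangle_less_add[of z x "1/20" y "1/20"] by (simp add: dist_commute)
      then have "n = m" using m(1) n(1) by (intro act_same_parity[OF n(3) m(2)]) (auto simp: P_def dist_norm)
      then show ?thesis using bmp_act[OF m(2)] by simp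
    qed
    then show ?thesis using v[OF n(1)] by blast
  qed
  then show ?thesis by (intro exI[of _ ?N]) auto
qed

lemma bmp_range: "0 \<le> bmp x" "bmp x \<le> 1"
  using eta_nonneg eta_less_1[THEN less_imp_le] by (auto simp: bmp_def)

lemma bmp_Cn:
  assumes "Cn n c0" shows "Cn n bmp"
proof (rule Cn_local)
  fix x
  obtain N where N: "open N" "x \<in> N" "(\<forall>y\<in>N. bmp y = 0) \<or> (\<exists>n. \<forall>y\<in>N. bmp y = eta (W n y) \<and> -1/4 < vc n y)"
    using bmp_local by blast
  from N(3) show "\<exists>N g. open N \<and> x \<in> N \<and> Cn n g \<and> (\<forall>y\<in>N. bmp y = g y)"
  proof
    assume "\<forall>y\<in>N. bmp y = 0"
    moreover have "Cn n (\<lambda>x::'a. 0)" unfolding Cn_iff_CF by (rule CF_const)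
    ultimately show ?thesis using N(1,2) by blast
  next
    assume "\<exists>n. \<forall>y\<in>N. bmp y = eta (W n y) \<and> -1/4 < vc n y"
    then obtain i where i: "\<forall>y\<in>N. bmp y = eta (W i y)" by blast
    have "Cn n (\<lambda>y. eta (W i y))" using assms unfolding Cn_iff_CF by (intro CF_eta CF_W)
    then show ?thesis using N(1,2) i by blast
  qed
qed

lemma bmp_bump: "bump bmp"
proof -
  obtain n x where nx: "0 < W n x" "u x = 0" using W_pos_exists by blast
  then have "bmp x = eta (W n x)" by (intro bmp_act) (auto simp: act_def vc_def)
  then have "bmp x \<noteq> 0" using eta_pos(1)[OF nx(1)] by simp
  moreover have "{x. bmp x \<noteq> 0} \<subseteq> cball 0 5"
  proof
    fix x assume "x \<in> {x. bmp x \<noteq> 0}"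
    then obtain n where n: "act n x" by (auto simp: bmp_def split: if_splits)
    then show "x \<in> cball 0 5" using in_cell_norm[OF act_in_cell[OF n]] by (simp add: act_def)
  qed
  then have "bounded (supp bmp)" unfolding supp_def using bounded_subset[OF bounded_cball] bounded_closure by blast
  ultimately show ?thesis unfolding bump_def by blast
qed

lemma eta_W_deriv:
  assumes "(c0 has_derivative D) (at (Q n x))"
  shows "((\<lambda>y. eta (W n y)) has_derivative (\<lambda>w. eta' (W n x) * (D (Q' n x w) + exp (- tm n x) * tm' n x w))) (at x)"
  by (rule has_derivative_compose[OF W_deriv[OF assms] eta_deriv[unfolded has_field_derivative_def]])

lemma bmp_regular:
  assumes d: "\<And>y. \<exists>D. (c0 has_derivative D) (at y)" and x: "x \<in> interior (supp bmp)"
  shows "frechet_derivative bmp (at x) \<noteq> (\<lambda>v. 0)"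
proof -
  obtain N where N: "open N" "x \<in> N" "(\<forall>y\<in>N. bmp y = 0) \<or> (\<exists>n. \<forall>y\<in>N. bmp y = eta (W n y) \<and> -1/4 < vc n y)"
    using bmp_local by blast
  have x': "x \<in> closure {y. bmp y \<noteq> 0}" using x interior_subset unfolding supp_def by blast
  have "\<not> (\<forall>y\<in>N. bmp y = 0)" using x' N(1,2) unfolding closure_iff_nhds_not_empty by blast
  then obtain n where n: "\<And>y. y \<in> N \<Longrightarrow> bmp y = eta (W n y)" using N(3) by blast
  obtain D where D: "(c0 has_derivative D) (at (Q n x))" using d by blast
  let ?W' = "\<lambda>w. D (Q' n x w) + exp (- tm n x) * tm' n x w"
  have W': "(W n has_derivative ?W') (at x)" by (rule W_deriv[OF D])
  have pos: "0 < ?W' (flow n x)" if "0 \<le> W n x" by (rule W_deriv_flow_pos[OF that has_derivative_linear[OF D]])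
  have ev: "\<forall>\<^sub>F y in nhds x. y \<in> N" using eventually_nhds_in_open[OF N(1,2)] .
  have "0 < W n x"
  proof (rule ccontr)
    assume le: "\<not> 0 < W n x"
    have contW: "isCont (W n) y" for y
    proof -
      obtain D where "(c0 has_derivative D) (at (Q n y))" using d by blast
      then show ?thesis using W_deriv has_derivative_continuous by blast
    qed
    have opn: "open {y. W n y < 0}"
      by (intro open_Collect_less continuous_at_imp_continuous_on) (simp_all add: contW)
    \<comment> \<open>Such a \<open>y\<close> is contradictory: \<open>bmp\<close> vanishes on the
      open set of points of \<open>N\<close> with \<open>W n < 0\<close>, whereas \<open>y\<close>
      is in the closure of its nonzero set.\<close>
    have "\<exists>y\<in>N \<inter> interior (supp bmp). W n y < 0"
    proof (cases "W n x < 0")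
      case True then show ?thesis using x N(2) by blast
    next
      case False
      then have z: "W n x = 0" using le by simp
      \<comment> \<open>On the zero set one walks backwards along the flow direction, where
        \<open>W n\<close> becomes negative at once.\<close>
      have lin: "((\<lambda>t. x + t *\<^sub>R flow n x) has_derivative (\<lambda>t. t *\<^sub>R flow n x)) (at 0)"
        by (auto intro!: derivative_eq_intros)
      from has_derivative_compose[OF lin, of "W n" ?W'] W'
      have "((\<lambda>t. W n (x + t *\<^sub>R flow n x)) has_derivative (\<lambda>t. ?W' (t *\<^sub>R flow n x))) (at 0)" by simp
      then have "((\<lambda>t. W n (x + t *\<^sub>R flow n x)) has_real_derivative ?W' (flow n x)) (at 0)"
        unfolding has_field_derivative_def linear_scale[OF has_derivative_linear[OF W']]
        by (simp add: mult.commute[of _ "?W' (flow n x)"])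
      from DERIV_pos_inc_left[OF this pos] z
      obtain r where r: "r > 0" "\<And>h. 0 < h \<Longrightarrow> h < r \<Longrightarrow> W n (x - h *\<^sub>R flow n x) < 0" by auto
      have "((\<lambda>h. x - h *\<^sub>R flow n x) \<longlongrightarrow> x - 0 *\<^sub>R flow n x) (at_right 0)"
        by (intro tendsto_intros)
      then have "\<forall>\<^sub>F h in at_right 0. x - h *\<^sub>R flow n x \<in> N \<inter> interior (supp bmp)"
        by (rule topological_tendstoD) (use N x in auto)
      moreover have "\<forall>\<^sub>F h in at_right 0. 0 < h \<and> h < r"
        using r(1) by (intro eventually_at_rightI[of 0 r]) auto
      ultimately have "\<forall>\<^sub>F h in at_right (0::real). x - h *\<^sub>R flow n x \<in> N \<inter> interior (supp bmp) \<and> W n (x - h *\<^sub>R flow n x) < 0"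
        by eventually_elim (use r(2) in auto)
      then show ?thesis using eventually_happens'[OF trivial_limit_at_right_real] by blast
    qed
    then obtain y where y: "y \<in> N" "y \<in> interior (supp bmp)" "W n y < 0" by blast
    have "y \<in> closure {y. bmp y \<noteq> 0}" using y(2) interior_subset unfolding supp_def by blast
    then have "(N \<inter> {y. W n y < 0}) \<inter> {y. bmp y \<noteq> 0} \<noteq> {}"
      using y(1,3) open_Int[OF N(1) opn] unfolding closure_iff_nhds_not_empty by blast
    then show False using n by force
  qed
  then have "0 < eta' (W n x) * ?W' (flow n x)" using eta_pos(2) pos by simp
  moreover have "(bmp has_derivative (\<lambda>w. eta' (W n x) * ?W' w)) (at x)"
    by (rule has_derivative_transform_within_open[OF eta_W_deriv[OF D] N(1,2)]) (simp add: n)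
  then have "frechet_derivative bmp (at x) = (\<lambda>w. eta' (W n x) * ?W' w)"
    by (rule frechet_derivative_at[symmetric])
  ultimately show ?thesis by (metis less_irrefl)
qed

text \<open>Where \<open>W n \<le> 0\<close> the factor \<open>eta'\<close> is 0. Elsewhere the
  point is in the cell and \<open>exp (- tm) \<le> 1\<close>, so the bounds on \<open>Q'\<close> and
  \<open>tm'\<close> apply, with 4 for \<open>eta'\<close>.\<close>

lemma bmp_lipschitz:
  assumes d: "\<And>y. \<exists>D. (c0 has_derivative D) (at y)" and L: "L-lipschitz_on UNIV c0"
  shows "\<exists>L. L-lipschitz_on UNIV bmp"
proof -
  define M where "M = 4 * (L * (34 + 17 * K0) + (1 + 64 * K0))"
  have L0: "L \<ge> 0" using lipschitz_on_nonneg[OF L] .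
  have M: "M \<ge> 0" unfolding M_def using L0 K0_pos by simp
  have "\<exists>D. (bmp has_derivative D) (at x) \<and> (\<forall>w. \<bar>D w\<bar> \<le> M * norm w)" for x
  proof -
    obtain N where N: "open N" "x \<in> N" "(\<forall>y\<in>N. bmp y = 0) \<or> (\<exists>n. \<forall>y\<in>N. bmp y = eta (W n y) \<and> -1/4 < vc n y)"
      using bmp_local by blast
    from N(3) show ?thesis
    proof
      assume z: "\<forall>y\<in>N. bmp y = 0"
      have "(bmp has_derivative (\<lambda>w. 0)) (at x)"
        by (rule has_derivative_transform_within_open[OF has_derivative_const N(1,2)]) (use z in auto)
      then show ?thesis using M by (intro exI[of _ "\<lambda>w. 0"]) auto
    next
      assume "\<exists>n. \<forall>y\<in>N. bmp y = eta (W n y) \<and> -1/4 < vc n y"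
      then obtain n where n: "\<And>y. y \<in> N \<Longrightarrow> bmp y = eta (W n y)" "-1/4 < vc n x" using N(2) by blast
      obtain D where D: "(c0 has_derivative D) (at (Q n x))" using d by blast
      let ?W' = "\<lambda>w. D (Q' n x w) + exp (- tm n x) * tm' n x w"
      have "(bmp has_derivative (\<lambda>w. eta' (W n x) * ?W' w)) (at x)"
        by (rule has_derivative_transform_within_open[OF eta_W_deriv[OF D] N(1,2)]) (simp add: n)
      moreover have "\<bar>eta' (W n x) * ?W' w\<bar> \<le> M * norm w" for w
      proof (cases "W n x \<le> 0")
        case True
        then show ?thesis using M by simp
      next
        case False
        then have W: "0 \<le> W n x" by simp
        have "\<bar>D (Q' n x w)\<bar> \<le> L * ((34 + 17 * K0) * norm w)"
          by (rule order_trans[OF lipschitz_has_derivative_bound[OF L D] mult_left_mono[OF Q'_bound L0]])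
        moreover have "\<bar>exp (- tm n x) * tm' n x w\<bar> \<le> 1 * ((1 + 64 * K0) * norm w)"
          unfolding abs_mult using W_nonneg_exp[OF W] tm'_bound[OF W_nonneg_in_cell[OF W] n(2)]
          by (intro mult_mono) auto
        ultimately have w: "\<bar>?W' w\<bar> \<le> (L * (34 + 17 * K0) + (1 + 64 * K0)) * norm w"
          unfolding distrib_right[of "L * (34 + 17 * K0)"] mult.assoc mult_1 by linarith
        have "\<bar>eta' (W n x)\<bar> * \<bar>?W' w\<bar> \<le> 4 * ((L * (34 + 17 * K0) + (1 + 64 * K0)) * norm w)"
          using eta'_le_4[of "W n x"] eta_nonneg(2)[of "W n x"] by (intro mult_mono w) auto
        then show ?thesis unfolding abs_mult M_def mult.assoc .
      qed
      ultimately show ?thesis by blast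
    qed
  qed
  then show ?thesis using bounded_derivative_lipschitz[OF _ M] by blast
qed

end

section \<open>Rescaling the given bump to a cross-section\<close>

lemma cross_section:
  fixes b :: "'a::real_normed_vector \<Rightarrow> real"
  assumes "bump b"
  obtains c x0 l where "\<bar>c\<bar> = (1::real)" "l > (0::real)" "b x0 \<noteq> 0" "0 < c * b x0"
    "\<And>y. b (l *\<^sub>R y + x0) \<noteq> 0 \<Longrightarrow> norm y \<le> 1/80"
proof -
  obtain x0 where x0: "b x0 \<noteq> 0" using assms by (auto simp: bump_def)
  have "bounded {x. b x \<noteq> 0}"
    using assms closure_subset bounded_subset unfolding bump_def supp_def by blast
  then obtain R where R: "R > 0" "\<And>x. b x \<noteq> 0 \<Longrightarrow> norm x \<le> R" by (auto simp: bounded_pos)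
  show thesis
  \<comment> \<open>Translated by \<open>x0\<close>, the nonzero set of \<open>b\<close> lies in the
    ball of radius \<open>R + norm x0\<close>, and the factor 80 shrinks this to 1/80. The sign
    makes the value at the centre positive.\<close>
  proof (rule that[of "sgn (b x0)" "80 * (R + norm x0)" x0])
    show l: "0 < 80 * (R + norm x0)" using R(1) by (simp add: add_pos_nonneg)
    fix y assume "b ((80 * (R + norm x0)) *\<^sub>R y + x0) \<noteq> 0"
    then have "norm ((80 * (R + norm x0)) *\<^sub>R y + x0) \<le> R" by (rule R(2))
    then have "norm ((80 * (R + norm x0)) *\<^sub>R y) \<le> R + norm x0"
      using norm_triangle_ineq4[of "(80 * (R + norm x0)) *\<^sub>R y + x0" x0] by simp
    then have "(R + norm x0) * (80 * norm y) \<le> (R + norm x0) * 1" using l by (simp add: mult_ac)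
    then show "norm y \<le> 1/80" using l by simp
  qed (use x0 in \<open>auto simp: sgn_if\<close>)
qed

lemma smooth_differentiable:
  assumes "smooth p f" "p \<ge> 1" obtains D where "(f has_derivative D) (at x)"
proof -
  have "Cn 1 f" using assms unfolding smooth_def by (simp add: one_enat_def)
  then show thesis using Cn_differentiable[of 1 f x] that by auto
qed

lemma bump_without_critical_points:
  fixes b :: "'a::real_normed_vector \<Rightarrow> real"
  assumes "infinite_dimensional TYPE('a)" "p \<ge> 1" "smooth p b" "bump b"
  shows "\<exists>f::'a \<Rightarrow> real. smooth p f \<and> bump f \<and> (\<forall>x. f x \<in> {0..1}) \<and>
     (\<forall>x\<in>interior (supp f). frechet_derivative f (at x) \<noteq> (\<lambda>v. 0)) \<and>
     ((\<exists>L. L-lipschitz_on UNIV b) \<longrightarrow> (\<exists>L. L-lipschitz_on UNIV f))"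
proof -
  obtain c x0 l where c: "\<bar>c\<bar> = (1::real)" "l > (0::real)" "b x0 \<noteq> 0" "0 < c * b x0"
    "\<And>y. b (l *\<^sub>R y + x0) \<noteq> 0 \<Longrightarrow> norm y \<le> 1/80" by (rule cross_section[OF assms(4)], rule that, assumption+)
  \<comment> \<open>\<open>eta\<close> smoothly replaces the negative values by 0 and brings the
    rest into [0, 1); it creates no new support, and being 4-Lipschitz it preserves the Lipschitz
    property.\<close>
  define c0 where "c0 y = eta (c * b (l *\<^sub>R y + x0))" for y
  have Cn: "Cn n c0" if "Cn n b" for n
  proof -
    have "CF n 0 (\<lambda>x h. b (l *\<^sub>R x + 1 *\<^sub>R x0))"
      using CF_shear[of n "\<lambda>x. 1" 0 "\<lambda>x h. b x" l x0, OF CF_const] that by (simp add: Cn_iff_CF)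
    then have "CF n 0 (\<lambda>x h. eta (c * b (l *\<^sub>R x + 1 *\<^sub>R x0)))" by (rule CF_eta[OF CF_cmult])
    then show ?thesis unfolding Cn_iff_CF c0_def by simp
  qed
  have sm: "smooth p c0" using assms(3) Cn unfolding smooth_def by blast
  have d: "\<exists>D. (c0 has_derivative D) (at y)" for y by (rule smooth_differentiable[OF sm assms(2), of y]) blast
  obtain e :: 'a and u a \<psi> where sys: "norm e = 1" "\<And>n::nat. norm (a n) = 1" "bounded_linear u" "\<And>n. bounded_linear (\<psi> n)"
    "\<And>x. \<bar>u x\<bar> \<le> norm x" "\<And>n x. \<bar>\<psi> n x\<bar> \<le> 8 * norm x"
    "u e = (1::real)" "\<And>n. u (a n) = 0" "\<And>n. \<psi> n e = (0::real)"
    "\<And>n j. n \<le> j + 2 \<Longrightarrow> \<psi> n (a j) = (if n = j then 1 else 0)"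
    by (rule near_biorthogonal_system[OF assms(1)], rule that, assumption+)
  interpret tube e a u \<psi> c0 "c0 0"
  proof (rule tube.intro)
    show "norm y \<le> 1/80" if "c0 y \<noteq> 0" for y
    proof (rule c(5), rule notI)
      assume "b (l *\<^sub>R y + x0) = 0"
      then show False using that by (simp add: c0_def)
    qed
    show "0 < c0 0" unfolding c0_def using c(4) by (simp add: eta_pos)
    show "0 \<le> c0 y" "c0 y \<le> 1" for y unfolding c0_def using eta_nonneg eta_less_1[THEN less_imp_le] by auto
  qed (fact sys refl)+
  have "\<exists>L. L-lipschitz_on UNIV bmp" if lb: "\<exists>L. L-lipschitz_on UNIV b"
  proof -
    obtain L where L: "L-lipschitz_on UNIV b" using lb by blast
    have e: "\<bar>eta s - eta t\<bar> \<le> 4 * \<bar>s - t\<bar>" for s t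
      using field_differentiable_bound[of UNIV eta eta' 4 s t] by (simp add: eta_deriv eta'_le_4 eta_nonneg)
    have "(4 * (L * l))-lipschitz_on UNIV c0"
    proof (rule lipschitz_onI)
      fix x y
      have "\<bar>b (l *\<^sub>R x + x0) - b (l *\<^sub>R y + x0)\<bar> \<le> L * norm (l *\<^sub>R x - l *\<^sub>R y)"
        using lipschitz_onD[OF L, of "l *\<^sub>R x + x0" "l *\<^sub>R y + x0"] by (simp add: dist_norm)
      also have "\<dots> = L * l * norm (x - y)" using c(2) by (simp add: scaleR_diff_right[symmetric])
      finally have "\<bar>c * b (l *\<^sub>R x + x0) - c * b (l *\<^sub>R y + x0)\<bar> \<le> L * l * norm (x - y)"
        using c(1) by (simp add: right_diff_distrib[symmetric] abs_mult)
      then show "dist (c0 x) (c0 y) \<le> 4 * (L * l) * dist x y"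
        using e[of "c * b (l *\<^sub>R x + x0)" "c * b (l *\<^sub>R y + x0)"] unfolding c0_def dist_norm by simp
    qed (use c(2) lipschitz_on_nonneg[OF L] in simp)
    then show ?thesis using bmp_lipschitz[OF d] by blast
  qed
  moreover have "smooth p bmp" using sm bmp_Cn unfolding smooth_def by blast
  ultimately show ?thesis using bmp_bump bmp_range bmp_regular[OF d] by (intro exI[of _ bmp] conjI allI ballI impI) simp_all
qed

theorem theorem1p1:
  fixes p :: enat
  assumes "infinite_dimensional TYPE('a::banach)"
    and "p \<ge> 1"
  shows "((\<exists>b::'a \<Rightarrow> real. smooth p b \<and> bump b) \<longrightarrow>
           (\<exists>f::'a \<Rightarrow> real. smooth p f \<and> bump f \<and> (\<forall>x. f x \<in> {0..1}) \<and>
              (\<forall>x\<in>interior (supp f). frechet_derivative f (at x) \<noteq> (\<lambda>v. 0)))) \<and>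
         ((\<exists>b::'a \<Rightarrow> real. smooth p b \<and> bump b \<and> (\<exists>L. L-lipschitz_on UNIV b)) \<longrightarrow>
           (\<exists>f::'a \<Rightarrow> real. smooth p f \<and> bump f \<and> (\<forall>x. f x \<in> {0..1}) \<and>
              (\<forall>x\<in>interior (supp f). frechet_derivative f (at x) \<noteq> (\<lambda>v. 0)) \<and>
              (\<exists>L. L-lipschitz_on UNIV f)))"
  using bump_without_critical_points[OF assms] by meson

end
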